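(* Let $K$ be a field of characteristic $0$ and let $F=K[C_1,C_2]$ be the generic algebra of $M_{11}(E)$ in two generators. Then the polynomials $$[[t_1,t_2][t_3,t_4],t_5],\qquad [t_1,t_2][t_3,t_4][t_5,t_6],\qquad s_4(t_1,t_2,t_3,t_4)=\sum_{\sigma\in S_4}(-1)^{\sigma}t_{\sigma(1)}t_{\sigma(2)}t_{\sigma(3)}t_{\sigma(4)}$$ form a basis of the polynomial identities of $F$; that is, the T-ideal $T(F)$ is generated as a T-ideal by these three polynomials.
   Context: All algebras are unitary associative algebras over $K$. $K\langle T\rangle$ is the free unitary associative algebra on $T=\{t_1,t_2,\dots\}$. $T(A)\subseteq K\langle T\rangle$ is the ideal of all polynomial identities of an algebra $A$; a T-ideal is an ideal of $K\langle T\rangle$ closed under all endomorphisms of $K\langle T\rangle$, and the T-ideal generated by a set of polynomials is the smallest T-ideal containing it. $[a,b]=ab-ba$, and $(-1)^\sigma$ is the sign of $\sigma$. The algebra $F$: let $K[X;Y]=K[x_1,x_2,x_1',x_2']\otimes_K E(y_1,y_2,y_1',y_2')$ be the free supercommutative algebra on even (commuting, central) variables $X=\{x_1,x_2,x_1',x_2'\}$ and odd (pairwise anticommuting, square zero) variables $Y=\{y_1,y_2,y_1',y_2'\}$, where $E(y_1,y_2,y_1',y_2')$ is the Grassmann algebra on the vector space with basis $Y$. Put $C_i=\begin{pmatrix}x_i&y_i\\ y_i'&x_i'\end{pmatrix}\in M_2(K[X;Y])$ for $i=1,2$. Then $F=K[C_1,C_2]$ is the unitary $K$-subalgebra of $M_2(K[X;Y])$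 generated by $C_1$ and $C_2$ (it is isomorphic to the relatively free algebra of rank 2 of $M_{11}(E)$, where $E$ is the infinite dimensional Grassmann algebra and $M_{11}(E)\subseteq M_2(E)$ consists of the matrices with diagonal entries in $E_0$ and off-diagonal entries in $E_1$). *)

theory Defs
  imports "HOL-Analysis.Determinants" "HOL-Library.Poly_Mapping"
begin

section \<open>Unitary associative algebras\<close>

locale assoc_algebra = vector_space scl
  for scl :: "'k::field \<Rightarrow> 'b::ring_1 \<Rightarrow> 'b" +
  assumes scale_mult_left: "scl c x * y = scl c (x * y)"
    and scale_mult_right: "x * scl c y = scl c (x * y)"

definition algebra_hom ::
  "('k::field \<Rightarrow> 'b::ring_1 \<Rightarrow> 'b) \<Rightarrow> ('k \<Rightarrow> 'c::ring_1 \<Rightarrow> 'c) \<Rightarrow> ('b \<Rightarrow> 'c) \<Rightarrow> bool"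
  where "algebra_hom scl1 scl2 f \<longleftrightarrow>
    Vector_Spaces.linear scl1 scl2 f \<and> f 1 = 1 \<and> (\<forall>x y. f (x * y) = f x * f y)"

definition subalgebra :: "('k::field \<Rightarrow> 'b::ring_1 \<Rightarrow> 'b) \<Rightarrow> 'b set \<Rightarrow> bool"
  where "subalgebra scl A \<longleftrightarrow>
    module.subspace scl A \<and> 1 \<in> A \<and> (\<forall>x\<in>A. \<forall>y\<in>A. x * y \<in> A)"

definition two_sided_ideal :: "('k::field \<Rightarrow> 'b::ring_1 \<Rightarrow> 'b) \<Rightarrow> 'b set \<Rightarrow> bool"
  where "two_sided_ideal scl I \<longleftrightarrow>
    module.subspace scl I \<and> (\<forall>x\<in>I. \<forall>y. y * x \<in> I \<and> x * y \<in> I)"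

definition commutator :: "'b::ring_1 \<Rightarrow> 'b \<Rightarrow> 'b"
  where "commutator a b = a * b - b * a"


section \<open>The free algebra, polynomial identities and T-ideals\<close>

text \<open>
  The product of \<^typ>\<open>'m \<Rightarrow>\<^sub>0 'k\<close> is convolution over the additively written monoid
  \<^typ>\<open>'m\<close>.  Over the free monoid (words under concatenation) this is therefore the free unitary
  associative algebra, and over the monoid of exponent functions the commutative polynomial algebra.
\<close>

datatype 'v free_monoid = Free_Monoid (letters: "'v list")

instantiation free_monoid :: (type) monoid_add
begin

definition zero_free_monoid :: "'v free_monoid"
  where "zero_free_monoid = Free_Monoid []"

definition plus_free_monoid :: "'v free_monoid \<Rightarrow> 'v free_monoid \<Rightarrow> 'v free_monoid"
  where "plus_free_monoid u v = Free_Monoid (letters u @ letters v)"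

instance
  by standard (simp_all add: zero_free_monoid_def plus_free_monoid_def)

end

type_synonym 'k free_algebra = "nat free_monoid \<Rightarrow>\<^sub>0 'k"

definition pm_scale :: "'k::field \<Rightarrow> ('m \<Rightarrow>\<^sub>0 'k) \<Rightarrow> ('m \<Rightarrow>\<^sub>0 'k)"
  where "pm_scale c f = Poly_Mapping.map ((*) c) f"

lemma lookup_pm_scale [simp]:
  "Poly_Mapping.lookup (pm_scale c f) m = c * Poly_Mapping.lookup f m"
  by (simp add: pm_scale_def Poly_Mapping.map.rep_eq when_def)

lemma pm_scale_eq_times:
  "pm_scale c f = Poly_Mapping.single 0 c * (f :: 'm::monoid_add \<Rightarrow>\<^sub>0 'k::field)"
  by (simp add: pm_scale_def mult_map_scale_conv_mult)

lemma single_zero_central: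
  "f * Poly_Mapping.single 0 c = Poly_Mapping.single 0 c * (f :: 'm::monoid_add \<Rightarrow>\<^sub>0 'k::field)"
proof (induction f rule: update_induct)
  case const
  show ?case by simp
next
  case (update f a b)
  have "Poly_Mapping.update a b f = Poly_Mapping.single a b + f"
    using update.hyps
    by (intro poly_mapping_eqI)
      (auto simp: lookup_update lookup_add lookup_single when_def in_keys_iff)
  then show ?case
    by (simp add: mult_single mult.commute distrib_left distrib_right update.IH)
qed

lemma vector_space_pm_scale: "vector_space (pm_scale :: 'k::field \<Rightarrow> ('m \<Rightarrow>\<^sub>0 'k) \<Rightarrow> _)"
  by standard (rule poly_mapping_eqI, simp add: lookup_add algebra_simps)+

lemma assoc_algebra_pm_scale:
  "assoc_algebra (pm_scale :: 'k::field \<Rightarrow> ('m::monoid_add \<Rightarrow>\<^sub>0 'k) \<Rightarrow> _)"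
proof -
  interpret vector_space "pm_scale :: 'k \<Rightarrow> ('m \<Rightarrow>\<^sub>0 'k) \<Rightarrow> _"
    by (rule vector_space_pm_scale)
  show ?thesis
  proof
    fix c and x y :: "'m \<Rightarrow>\<^sub>0 'k"
    show "pm_scale c x * y = pm_scale c (x * y)"
      by (simp add: pm_scale_eq_times mult.assoc)
    have "x * (Poly_Mapping.single 0 c * y) = Poly_Mapping.single 0 c * x * y"
      by (metis mult.assoc single_zero_central)
    then show "x * pm_scale c y = pm_scale c (x * y)"
      by (simp add: pm_scale_eq_times mult.assoc)
  qed
qed

text \<open>
  The countably many free generators carry the natural numbers as labels, so there is also a
  generator \<open>t 0\<close>; which countable set of labels is used is immaterial.
\<close>

definition t :: "nat \<Rightarrow> 'k::field free_algebra"
  where "t i = Poly_Mapping.single (Free_Monoid [i]) 1"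

definition evaluate :: "('k::field \<Rightarrow> 'b::ring_1 \<Rightarrow> 'b) \<Rightarrow> (nat \<Rightarrow> 'b) \<Rightarrow> 'k free_algebra \<Rightarrow> 'b"
  where "evaluate scl a f =
    (\<Sum>w\<in>Poly_Mapping.keys f. scl (Poly_Mapping.lookup f w) (prod_list (map a (letters w))))"

definition polynomial_identities ::
  "('k::field \<Rightarrow> 'b::ring_1 \<Rightarrow> 'b) \<Rightarrow> 'b set \<Rightarrow> 'k free_algebra set"
  where "polynomial_identities scl A =
    {f. \<forall>a. (\<forall>i. a i \<in> A) \<longrightarrow> evaluate scl a f = 0}"

definition T_ideal :: "'k::field free_algebra set \<Rightarrow> bool"
  where "T_ideal I \<longleftrightarrow> two_sided_ideal pm_scale I \<and>
    (\<forall>\<phi>. algebra_hom pm_scale pm_scale \<phi> \<longrightarrow> \<phi> ` I \<subseteq> I)"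

definition T_ideal_generated :: "'k::field free_algebra set \<Rightarrow> 'k free_algebra set"
  where "T_ideal_generated G = T_ideal hull G"

lemma T_ideal_Inter:
  assumes "\<And>I. I \<in> \<I> \<Longrightarrow> T_ideal I"
  shows "T_ideal (\<Inter>\<I>)"
proof -
  interpret vector_space "pm_scale :: 'a \<Rightarrow> 'a free_algebra \<Rightarrow> _"
    by (rule vector_space_pm_scale)
  show ?thesis
    using assms unfolding T_ideal_def two_sided_ideal_def
    by (auto intro!: subspace_Inter) blast
qed

lemma T_ideal_T_ideal_generated: "T_ideal (T_ideal_generated G)"
  unfolding T_ideal_generated_def by (rule hull_in) (blast intro: T_ideal_Inter)


section \<open>Grassmann algebras\<close>

text \<open>
  An element of the Grassmann algebra over a commutative ring \<open>'r\<close> on the finite set of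
  generators \<open>'v\<close> is given by its coefficients with respect to the basis of
  monomials \<open>e\<^sub>S\<close>, the product of the elements of \<open>S\<close> in increasing order.  For disjoint
  \<open>S\<close> and \<open>T\<close> the product of \<open>e\<^sub>S\<close> and \<open>e\<^sub>T\<close> is \<open>e\<^bsub>S \<union> T\<^esub>\<close> up to the sign given by the number
  of pairs that are out of order, and otherwise the product is zero.
\<close>

typedef ('v, 'r) grassmann = "UNIV :: ('v set \<Rightarrow> 'r) set"
  morphisms gcoeff Abs_grassmann ..

setup_lifting type_definition_grassmann

definition inversions :: "'v::linorder set \<Rightarrow> 'v set \<Rightarrow> nat"
  where "inversions S T = card {(s, u). s \<in> S \<and> u \<in> T \<and> u < s}"

definition gsign :: "'v::linorder set \<Rightarrow> 'v set \<Rightarrow> 'r::comm_ring_1"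
  where "gsign S T = (- 1) ^ inversions S T"

lemma inversions_Un_left:
  fixes S S' T :: "'v::{finite, linorder} set"
  assumes "S \<inter> S' = {}"
  shows "inversions (S \<union> S') T = inversions S T + inversions S' T"
proof -
  have "{(s, u). s \<in> S \<union> S' \<and> u \<in> T \<and> u < s} =
      {(s, u). s \<in> S \<and> u \<in> T \<and> u < s} \<union> {(s, u). s \<in> S' \<and> u \<in> T \<and> u < s}"
    by auto
  then show ?thesis
    unfolding inversions_def using assms by (simp add: card_Un_disjoint disjoint_iff)
qed

lemma inversions_Un_right:
  fixes S T T' :: "'v::{finite, linorder} set"
  assumes "T \<inter> T' = {}"
  shows "inversions S (T \<union> T') = inversions S T + inversions S T'"
proof -
  have "{(s, u). s \<in> S \<and> u \<in> T \<union> T' \<and> u < s} =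
      {(s, u). s \<in> S \<and> u \<in> T \<and> u < s} \<union> {(s, u). s \<in> S \<and> u \<in> T' \<and> u < s}"
    by auto
  then show ?thesis
    unfolding inversions_def using assms by (simp add: card_Un_disjoint disjoint_iff)
qed

lemma gsign_empty [simp]: "gsign {} T = 1" "gsign S {} = 1"
  by (simp_all add: gsign_def inversions_def)

lemma gsign_cocycle:
  fixes A B C :: "'v::{finite, linorder} set"
  assumes "A \<inter> B = {}" "A \<inter> C = {}" "B \<inter> C = {}"
  shows "gsign A B * gsign (A \<union> B) C = (gsign A (B \<union> C) * gsign B C :: 'r::comm_ring_1)"
  using assms by (simp add: gsign_def inversions_Un_left inversions_Un_right power_add)

lemma sum_subsets_assoc:
  fixes F :: "'v::finite set \<Rightarrow> 'v set \<Rightarrow> 'v set \<Rightarrow> 'r::comm_monoid_add"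
  shows "(\<Sum>B\<in>Pow S. \<Sum>A\<in>Pow B. F A (B - A) (S - B)) =
    (\<Sum>A\<in>Pow S. \<Sum>C\<in>Pow (S - A). F A C (S - A - C))"
proof -
  have "(\<Sum>B\<in>Pow S. \<Sum>A\<in>Pow B. F A (B - A) (S - B)) =
      (\<Sum>(B, A)\<in>Sigma (Pow S) Pow. F A (B - A) (S - B))"
    by (rule sum.Sigma) auto
  also have "\<dots> = (\<Sum>(A, C)\<in>Sigma (Pow S) (\<lambda>A. Pow (S - A)). F A C (S - A - C))"
    by (rule sum.reindex_bij_witness[where i = "\<lambda>(A, C). (A \<union> C, A)" and j = "\<lambda>(B, A). (A, B - A)"])
      (auto intro!: arg_cong[where f = "F _ _"])
  also have "\<dots> = (\<Sum>A\<in>Pow S. \<Sum>C\<in>Pow (S - A). F A C (S - A - C))"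
    by (rule sum.Sigma[symmetric]) auto
  finally show ?thesis .
qed

instantiation grassmann :: ("{finite, linorder}", comm_ring_1) ring_1
begin

lift_definition zero_grassmann :: "('a, 'b) grassmann" is "\<lambda>_. 0" .
lift_definition one_grassmann :: "('a, 'b) grassmann" is "\<lambda>S. if S = {} then 1 else 0" .
lift_definition plus_grassmann :: "('a, 'b) grassmann \<Rightarrow> ('a, 'b) grassmann \<Rightarrow> ('a, 'b) grassmann"
  is "\<lambda>f g S. f S + g S" .
lift_definition minus_grassmann :: "('a, 'b) grassmann \<Rightarrow> ('a, 'b) grassmann \<Rightarrow> ('a, 'b) grassmann"
  is "\<lambda>f g S. f S - g S" .
lift_definition uminus_grassmann :: "('a, 'b) grassmann \<Rightarrow> ('a, 'b) grassmann"
  is "\<lambda>f S. - f S" .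
lift_definition times_grassmann :: "('a, 'b) grassmann \<Rightarrow> ('a, 'b) grassmann \<Rightarrow> ('a, 'b) grassmann"
  is "\<lambda>f g S. \<Sum>A\<in>Pow S. gsign A (S - A) * f A * g (S - A)" .

instance
proof
  fix a b c :: "('a, 'b) grassmann"
  show "a * b * c = a * (b * c)"
  proof (transfer, rule ext)
    fix f g h :: "'a set \<Rightarrow> 'b" and S :: "'a set"
    have "(\<Sum>B\<in>Pow S. gsign B (S - B) * (\<Sum>A\<in>Pow B. gsign A (B - A) * f A * g (B - A)) * h (S - B)) =
        (\<Sum>B\<in>Pow S. \<Sum>A\<in>Pow B.
          gsign A (B - A) * gsign (A \<union> (B - A)) (S - B) * f A * g (B - A) * h (S - B))"
      by (intro sum.cong refl)
        (auto simp: sum_distrib_left sum_distrib_right Un_absorb1 algebra_simps intro!: sum.cong)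
    also have "\<dots> = (\<Sum>A\<in>Pow S. \<Sum>C\<in>Pow (S - A).
        gsign A C * gsign (A \<union> C) (S - A - C) * f A * g C * h (S - A - C))"
      by (rule sum_subsets_assoc)
    also have "\<dots> = (\<Sum>A\<in>Pow S. \<Sum>C\<in>Pow (S - A).
        gsign A (S - A) * gsign C (S - A - C) * f A * g C * h (S - A - C))"
    proof (intro sum.cong refl)
      fix A C assume "A \<in> Pow S" and C: "C \<in> Pow (S - A)"
      then have "gsign A C * gsign (A \<union> C) (S - A - C) =
          (gsign A (C \<union> (S - A - C)) * gsign C (S - A - C) :: 'b)"
        by (intro gsign_cocycle) auto
      also have "C \<union> (S - A - C) = S - A"
        using C by auto
      finally show "gsign A C * gsign (A \<union> C) (S - A - C) * f A * g C * h (S - A - C) =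
          gsign A (S - A) * gsign C (S - A - C) * f A * g C * h (S - A - C)"
        by simp
    qed
    also have "\<dots> = (\<Sum>A\<in>Pow S. gsign A (S - A) * f A *
        (\<Sum>C\<in>Pow (S - A). gsign C (S - A - C) * g C * h (S - A - C)))"
      by (simp add: sum_distrib_left mult_ac)
    finally show "(\<Sum>B\<in>Pow S. gsign B (S - B) *
          (\<Sum>A\<in>Pow B. gsign A (B - A) * f A * g (B - A)) * h (S - B)) =
        (\<Sum>A\<in>Pow S. gsign A (S - A) * f A *
          (\<Sum>C\<in>Pow (S - A). gsign C (S - A - C) * g C * h (S - A - C)))" .
  qed
  show "1 * a = a"
  proof (transfer, rule ext)
    fix f :: "'a set \<Rightarrow> 'b" and S :: "'a set"
    have "(\<Sum>A\<in>Pow S. gsign A (S - A) * (if A = {} then 1 else 0) * f (S - A)) =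
        (\<Sum>A\<in>{{}}. gsign A (S - A) * (if A = {} then 1 else 0) * f (S - A))"
      by (rule sum.mono_neutral_right) auto
    then show "(\<Sum>A\<in>Pow S. gsign A (S - A) * (if A = {} then 1 else 0) * f (S - A)) = f S"
      by simp
  qed
  show "a * 1 = a"
  proof (transfer, rule ext)
    fix f :: "'a set \<Rightarrow> 'b" and S :: "'a set"
    have "(\<Sum>A\<in>Pow S. gsign A (S - A) * f A * (if S - A = {} then 1 else 0)) =
        (\<Sum>A\<in>{S}. gsign A (S - A) * f A * (if S - A = {} then 1 else 0))"
      by (rule sum.mono_neutral_right) auto
    then show "(\<Sum>A\<in>Pow S. gsign A (S - A) * f A * (if S - A = {} then 1 else 0)) = f S"
      by simp
  qed
  show "(0 :: ('a, 'b) grassmann) \<noteq> 1"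
    by transfer (auto dest: fun_cong[of _ _ "{}"])
qed (transfer; force simp: fun_eq_iff algebra_simps sum.distrib)+

end

lift_definition gconst :: "'r \<Rightarrow> ('v, 'r::comm_ring_1) grassmann"
  is "\<lambda>r S. if S = {} then r else 0" .

lift_definition ggen :: "'v \<Rightarrow> ('v, 'r::comm_ring_1) grassmann"
  is "\<lambda>v S. if S = {v} then 1 else 0" .

lemma gcoeff_gconst_times:
  fixes f :: "('v::{finite, linorder}, 'r::comm_ring_1) grassmann"
  shows "gcoeff (gconst r * f) S = r * gcoeff f S"
proof transfer
  fix r :: 'r and f :: "'v set \<Rightarrow> 'r" and S :: "'v set"
  have "(\<Sum>A\<in>Pow S. gsign A (S - A) * (if A = {} then r else 0) * f (S - A)) =
      (\<Sum>A\<in>{{}}. gsign A (S - A) * (if A = {} then r else 0) * f (S - A))"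
    by (rule sum.mono_neutral_right) auto
  then show "(\<Sum>A\<in>Pow S. gsign A (S - A) * (if A = {} then r else 0) * f (S - A)) = r * f S"
    by simp
qed

lemma gcoeff_times_gconst:
  fixes f :: "('v::{finite, linorder}, 'r::comm_ring_1) grassmann"
  shows "gcoeff (f * gconst r) S = r * gcoeff f S"
proof transfer
  fix r :: 'r and f :: "'v set \<Rightarrow> 'r" and S :: "'v set"
  have "(\<Sum>A\<in>Pow S. gsign A (S - A) * f A * (if S - A = {} then r else 0)) =
      (\<Sum>A\<in>{S}. gsign A (S - A) * f A * (if S - A = {} then r else 0))"
    by (rule sum.mono_neutral_right) auto
  then show "(\<Sum>A\<in>Pow S. gsign A (S - A) * f A * (if S - A = {} then r else 0)) = r * f S"
    by simp
qed

lemma gconst_central: "gconst r * f = f * gconst r"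
  by (simp add: gcoeff_inject[symmetric] fun_eq_iff gcoeff_gconst_times gcoeff_times_gconst)

lemma gcoeff_ggen_times_ggen:
  fixes u v :: "'v::{finite, linorder}"
  shows "gcoeff (ggen u * ggen v :: ('v, 'r::comm_ring_1) grassmann) S =
    (if u \<noteq> v \<and> S = {u, v} then (if v < u then - 1 else 1) else 0)"
proof transfer
  fix u v :: 'v and S :: "'v set"
  have eq: "(\<Sum>A\<in>Pow S. gsign A (S - A) * (if A = {u} then 1 else 0) * (if S - A = {v} then 1 else 0))
      = (if u \<in> S \<and> S - {u} = {v} then gsign {u} {v} else 0 :: 'r)"
  proof -
    have "(\<Sum>A\<in>Pow S. gsign A (S - A) * (if A = {u} then 1 else 0) * (if S - A = {v} then 1 else 0)) =
        (\<Sum>A\<in>Pow S. if A = {u} then (if S - {u} = {v} then gsign {u} {v} else 0) else 0 :: 'r)"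
      by (intro sum.cong) auto
    also have "\<dots> = (if u \<in> S \<and> S - {u} = {v} then gsign {u} {v} else 0)"
      by (subst sum.delta) auto
    finally show ?thesis .
  qed
  have "{(s, w). s \<in> {u} \<and> w \<in> {v} \<and> w < s} = (if v < u then {(u, v)} else {})"
    by auto
  then have sgn: "gsign {u} {v} = (if v < u then - 1 else 1 :: 'r)"
    by (auto simp: gsign_def inversions_def)
  have "u \<in> S \<and> S - {u} = {v} \<longleftrightarrow> u \<noteq> v \<and> S = {u, v}"
    by auto
  with eq sgn
  show "(\<Sum>A\<in>Pow S. gsign A (S - A) * (if A = {u} then 1 else 0) * (if S - A = {v} then 1 else 0))
      = (if u \<noteq> v \<and> S = {u, v} then (if v < u then - 1 else 1) else 0 :: 'r)"
    by simp
qed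

lemma ggen_anticommute: "ggen u * ggen v = - (ggen v * ggen u)"
  by (auto simp: gcoeff_inject[symmetric] fun_eq_iff gcoeff_ggen_times_ggen
      uminus_grassmann.rep_eq insert_commute)

lemma ggen_square_zero: "ggen v * ggen v = 0"
  by (simp add: gcoeff_inject[symmetric] fun_eq_iff gcoeff_ggen_times_ggen zero_grassmann.rep_eq)


section \<open>The free supercommutative algebra\<close>

datatype even_var = X1 | X2 | X1' | X2'

datatype odd_var = Y1 | Y2 | Y1' | Y2'

instance odd_var :: finite
proof
  have "(UNIV :: odd_var set) = {Y1, Y2, Y1', Y2'}"
    using odd_var.exhaust by blast
  then show "finite (UNIV :: odd_var set)"
    by (metis finite.emptyI finite.insertI)
qed

text \<open>The order of the odd variables only fixes the basis of monomials.\<close>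

fun odd_rank :: "odd_var \<Rightarrow> nat" where
  "odd_rank Y1 = 0"
| "odd_rank Y2 = 1"
| "odd_rank Y1' = 2"
| "odd_rank Y2' = 3"

instantiation odd_var :: linorder
begin

definition less_eq_odd_var :: "odd_var \<Rightarrow> odd_var \<Rightarrow> bool"
  where "u \<le> v \<longleftrightarrow> odd_rank u \<le> odd_rank v"

definition less_odd_var :: "odd_var \<Rightarrow> odd_var \<Rightarrow> bool"
  where "u < v \<longleftrightarrow> odd_rank u < odd_rank v"

instance
proof
  fix u v :: odd_var
  show "u \<le> v \<Longrightarrow> v \<le> u \<Longrightarrow> u = v"
    by (cases u; cases v) (simp_all add: less_eq_odd_var_def)
qed (auto simp: less_eq_odd_var_def less_odd_var_def)

end

text \<open>
  The tensor product of the polynomial algebra in the even variables with the Grassmann algebra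
  over \<open>'k\<close> is the Grassmann algebra with coefficients in that polynomial algebra.
\<close>

type_synonym 'k super_poly = "(odd_var, (even_var \<Rightarrow>\<^sub>0 nat) \<Rightarrow>\<^sub>0 'k) grassmann"

definition super_scale :: "'k::field \<Rightarrow> 'k super_poly \<Rightarrow> 'k super_poly"
  where "super_scale c f = Abs_grassmann (\<lambda>S. pm_scale c (gcoeff f S))"

lemma gcoeff_super_scale [simp]: "gcoeff (super_scale c f) S = pm_scale c (gcoeff f S)"
  by (simp add: super_scale_def Abs_grassmann_inverse)

definition even_gen :: "even_var \<Rightarrow> 'k::field super_poly"
  where "even_gen x = gconst (Poly_Mapping.single (Poly_Mapping.single x 1) 1)"

definition odd_gen :: "odd_var \<Rightarrow> 'k::field super_poly"
  where "odd_gen y = ggen y"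

lemma super_scale_eq_times: "super_scale c f = gconst (Poly_Mapping.single 0 c) * f"
  by (simp add: gcoeff_inject[symmetric] fun_eq_iff gcoeff_gconst_times
      pm_scale_eq_times)

lemma assoc_algebra_super_scale: "assoc_algebra (super_scale :: 'k::field \<Rightarrow> _)"
proof -
  interpret P: vector_space "pm_scale :: 'k \<Rightarrow> ((even_var \<Rightarrow>\<^sub>0 nat) \<Rightarrow>\<^sub>0 'k) \<Rightarrow> _"
    by (rule vector_space_pm_scale)
  show ?thesis
  proof
    fix a b :: 'k and x y :: "'k super_poly"
    show "super_scale a (x + y) = super_scale a x + super_scale a y"
      by (simp add: gcoeff_inject[symmetric] fun_eq_iff plus_grassmann.rep_eq P.scale_right_distrib)
    show "super_scale (a + b) x = super_scale a x + super_scale b x"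
      by (simp add: gcoeff_inject[symmetric] fun_eq_iff plus_grassmann.rep_eq P.scale_left_distrib)
    show "super_scale a (super_scale b x) = super_scale (a * b) x"
      by (simp add: gcoeff_inject[symmetric] fun_eq_iff)
    show "super_scale 1 x = x"
      by (simp add: gcoeff_inject[symmetric] fun_eq_iff)
    show "super_scale a x * y = super_scale a (x * y)"
      by (simp add: super_scale_eq_times mult.assoc)
    show "x * super_scale a y = super_scale a (x * y)"
      unfolding super_scale_eq_times by (metis gconst_central mult.assoc)
  qed
qed


section \<open>Matrix algebras\<close>

text \<open>
  The type class product of \<^typ>\<open>'a ^ 'n ^ 'n\<close> is componentwise.  The following copy of this type
  is a ring under matrix multiplication.
\<close>

typedef ('a, 'n) sqmat = "UNIV :: ('a ^ 'n ^ 'n) set"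
  morphisms of_sqmat to_sqmat ..

setup_lifting type_definition_sqmat

instantiation sqmat :: (ring_1, finite) ring_1
begin

lift_definition zero_sqmat :: "('a, 'b) sqmat" is "0" .
lift_definition one_sqmat :: "('a, 'b) sqmat" is "mat 1" .
lift_definition plus_sqmat :: "('a, 'b) sqmat \<Rightarrow> ('a, 'b) sqmat \<Rightarrow> ('a, 'b) sqmat" is "(+)" .
lift_definition minus_sqmat :: "('a, 'b) sqmat \<Rightarrow> ('a, 'b) sqmat \<Rightarrow> ('a, 'b) sqmat" is "(-)" .
lift_definition uminus_sqmat :: "('a, 'b) sqmat \<Rightarrow> ('a, 'b) sqmat" is "uminus" .
lift_definition times_sqmat :: "('a, 'b) sqmat \<Rightarrow> ('a, 'b) sqmat \<Rightarrow> ('a, 'b) sqmat" is "(**)" .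

instance
proof
  fix x y z :: "('a, 'b) sqmat"
  show "x * y * z = x * (y * z)"
    by transfer (rule matrix_mul_assoc[symmetric])
  show "1 * x = x"
    by transfer (rule matrix_mul_lid)
  show "x * 1 = x"
    by transfer (rule matrix_mul_rid)
  show "(x + y) * z = x * z + y * z"
    by transfer (simp add: vec_eq_iff matrix_matrix_mult_def distrib_right sum.distrib)
  show "x * (y + z) = x * y + x * z"
    by transfer (rule matrix_add_ldistrib)
  show "(0 :: ('a, 'b) sqmat) \<noteq> 1"
  proof transfer
    have "(0 :: 'a ^ 'b ^ 'b) $ i $ i \<noteq> mat 1 $ i $ i" for i
      by (simp add: mat_def)
    then show "(0 :: 'a ^ 'b ^ 'b) \<noteq> mat 1"
      by metis
  qed
qed (transfer, simp)+

end

definition mat_scale ::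
  "'k::field \<Rightarrow> ('k super_poly, 'n::finite) sqmat \<Rightarrow> ('k super_poly, 'n) sqmat"
  where "mat_scale c M = to_sqmat (\<chi> i j. super_scale c (of_sqmat M $ i $ j))"

lemma of_sqmat_mat_scale [simp]:
  "of_sqmat (mat_scale c M) = (\<chi> i j. super_scale c (of_sqmat M $ i $ j))"
  by (simp add: mat_scale_def to_sqmat_inverse)

lemma assoc_algebra_mat_scale:
  "assoc_algebra (mat_scale :: 'k::field \<Rightarrow> ('k super_poly, 'n::finite) sqmat \<Rightarrow> _)"
proof -
  interpret S: assoc_algebra "super_scale :: 'k \<Rightarrow> _"
    by (rule assoc_algebra_super_scale)
  show ?thesis
  proof
    fix a b :: 'k and x y :: "('k super_poly, 'n) sqmat"
    show "mat_scale a (x + y) = mat_scale a x + mat_scale a y"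
      by (simp add: of_sqmat_inject[symmetric] plus_sqmat.rep_eq times_sqmat.rep_eq vec_eq_iff S.scale_right_distrib)
    show "mat_scale (a + b) x = mat_scale a x + mat_scale b x"
      by (simp add: of_sqmat_inject[symmetric] plus_sqmat.rep_eq times_sqmat.rep_eq vec_eq_iff S.scale_left_distrib)
    show "mat_scale a (mat_scale b x) = mat_scale (a * b) x"
      by (simp add: of_sqmat_inject[symmetric] plus_sqmat.rep_eq times_sqmat.rep_eq vec_eq_iff)
    show "mat_scale 1 x = x"
      by (simp add: of_sqmat_inject[symmetric] plus_sqmat.rep_eq times_sqmat.rep_eq vec_eq_iff)
    show "mat_scale a x * y = mat_scale a (x * y)"
      by (simp add: of_sqmat_inject[symmetric] plus_sqmat.rep_eq times_sqmat.rep_eq vec_eq_iff matrix_matrix_mult_def S.scale_mult_left S.scale_sum_right)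
    show "x * mat_scale a y = mat_scale a (x * y)"
      by (simp add: of_sqmat_inject[symmetric] plus_sqmat.rep_eq times_sqmat.rep_eq vec_eq_iff matrix_matrix_mult_def S.scale_mult_right S.scale_sum_right)
  qed
qed


section \<open>The generic algebra in two generators\<close>

definition C1 :: "('k::field super_poly, 2) sqmat"
  where "C1 = to_sqmat (vector
    [vector [even_gen X1, odd_gen Y1],
     vector [odd_gen Y1', even_gen X1']])"

definition C2 :: "('k::field super_poly, 2) sqmat"
  where "C2 = to_sqmat (vector
    [vector [even_gen X2, odd_gen Y2],
     vector [odd_gen Y2', even_gen X2']])"

definition generic_algebra :: "('k::field super_poly, 2) sqmat set"
  where "generic_algebra = subalgebra mat_scale hull {C1, C2}"

lemma subalgebra_generic_algebra: "subalgebra mat_scale generic_algebra"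
proof -
  interpret assoc_algebra "mat_scale :: 'k::field \<Rightarrow> ('k super_poly, 2) sqmat \<Rightarrow> _"
    by (rule assoc_algebra_mat_scale)
  show ?thesis
    unfolding generic_algebra_def
    by (rule hull_in) (auto simp: subalgebra_def intro!: subspace_Inter)
qed

end

theory Submission
  imports Defs
begin

text \<open>
  Let \<open>C\<close> be the commutator ideal of the free algebra and \<open>I\<close> the T-ideal generated by the three
  polynomials.

  The identities hold in the generic algebra because, after inverting \<open>x\<^sub>1 - x\<^sub>1'\<close>, a conjugation
  diagonalises \<open>C1\<close>.  Then all elements have off-diagonal entries in \<open>Z \<eta>\<close> and \<open>Z \<eta>'\<close> for two fixed
  odd elements \<open>\<eta>\<close>, \<open>\<eta>'\<close> and the even part \<open>Z\<close>, and commutators lie in a very small set.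

  Conversely, modulo \<open>I\<close> the ideal \<open>C\<^sup>3\<close> vanishes and \<open>C\<^sup>2\<close> is central, so that left and right
  multiplications by the generators make \<open>C / C\<^sup>2\<close> and \<open>C\<^sup>2 / I\<close> modules over the polynomial ring in
  \<open>x\<^sub>i\<close> and \<open>u\<^sub>i\<close>, where \<open>u\<^sub>i\<close> acts as the commutator with \<open>t\<^sub>i\<close>.  The first is the module of
  1-boundaries of the Koszul complex of the \<open>u\<^sub>i\<close>, the second a quotient of its tensor square
  \<open>M \<otimes> M\<close>.  The torsion of \<open>M \<otimes> M\<close> is generated by the elements which \<open>s\<^sub>4\<close> kills, so what remains
  embeds into a free module; in characteristic 0 explicit left inverses are given by differentiation.
  The coordinates in this free module are polynomial functions of the entries of 2 by 2 matrices
  over a Grassmann algebra in two odd variables, and arbitrary such entries arise by specialising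
  the generic algebra.
\<close>

section \<open>Linear extension from a basis\<close>

text \<open>The descent from the free algebra through C and C^2 to \<open>I\<close> takes one layer
  at a time. In each layer a family of words spans, entries of test matrices give the coordinates of
  a combination, and in the two lower layers an exactness lemma puts a combination with zero
  coordinates into the next ideal. The bottom layer is the obstacle. A priori each of the two
  commutator factors carries its own multiplications and its own u_i. Centrality of C^2 modulo
  \<open>I\<close> merges the multiplications and makes ad t_i on one factor the negative of ad t_i
  on the other, so one polynomial ring suffices, and the second factor can be a plain commutator.
  Differentiating there returns a multiple of the original plus the element with its tensor factors
  exchanged, so symmetric and antisymmetric parts are scaled by different integers, all nonzero in
  characteristic 0. Neither quotients nor localisations are formed: a projection with prescribed
  kernel replaces each quotient, and powers of x_1 - x_1' are carried along in place of
  inverses.\<close>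

definition lin_ext :: "('k::field \<Rightarrow> 'b::ab_group_add \<Rightarrow> 'b) \<Rightarrow> ('m \<Rightarrow> 'b) \<Rightarrow> ('m \<Rightarrow>\<^sub>0 'k) \<Rightarrow> 'b"
  where "lin_ext scl g z = (\<Sum>m\<in>Poly_Mapping.keys z. scl (Poly_Mapping.lookup z m) (g m))"

lemma linear_iff_pointwise:
  "Vector_Spaces.linear s1 s2 f \<longleftrightarrow> vector_space s1 \<and> vector_space s2 \<and>
    (\<forall>x y. f (x + y) = f x + f y) \<and> (\<forall>c x. f (s1 c x) = s2 c (f x))"
  by (simp add: Vector_Spaces.linear_iff_module_hom module_hom_iff vector_space_def module_def)

lemma poly_mapping_sum_single:
  "(z :: 'm \<Rightarrow>\<^sub>0 'k::comm_monoid_add) = (\<Sum>m\<in>Poly_Mapping.keys z. Poly_Mapping.single m (Poly_Mapping.lookup z m))"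
  by (rule poly_mapping_eqI) (auto simp: lookup_sum lookup_single when_def in_keys_iff)

lemma poly_mapping_add_induct [case_names zero single add]:
  fixes z :: "'m \<Rightarrow>\<^sub>0 'k::comm_monoid_add"
  assumes "P 0" "\<And>m c. P (Poly_Mapping.single m c)" "\<And>x y. P x \<Longrightarrow> P y \<Longrightarrow> P (x + y)"
  shows "P z"
proof -
  have "P (\<Sum>m\<in>A. Poly_Mapping.single m (Poly_Mapping.lookup z m))" if "finite A" for A
    using that by induction (auto intro: assms)
  then show ?thesis
    by (subst poly_mapping_sum_single) simp
qed

context vector_space
begin

lemma lin_ext_superset:
  assumes "finite S" "Poly_Mapping.keys z \<subseteq> S"
  shows "lin_ext scale g z = (\<Sum>m\<in>S. scale (Poly_Mapping.lookup z m) (g m))"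
  unfolding lin_ext_def using assms
  by (intro sum.mono_neutral_left) (auto simp: in_keys_iff)

lemma lin_ext_zero [simp]: "lin_ext scale g 0 = 0"
  by (simp add: lin_ext_def)

lemma lin_ext_single [simp]: "lin_ext scale g (Poly_Mapping.single m c) = scale c (g m)"
  by (subst lin_ext_superset[where S = "{m}"]) auto

lemma lin_ext_add: "lin_ext scale g (x + y) = lin_ext scale g x + lin_ext scale g y"
proof -
  let ?S = "Poly_Mapping.keys x \<union> Poly_Mapping.keys y"
  have "Poly_Mapping.keys (x + y) \<subseteq> ?S"
    by (rule keys_add)
  then show ?thesis
    by (simp add: lin_ext_superset[of ?S] lookup_add scale_left_distrib sum.distrib)
qed

lemma lin_ext_pm_scale: "lin_ext scale g (pm_scale c x) = scale c (lin_ext scale g x)"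
proof -
  have "Poly_Mapping.keys (pm_scale c x) \<subseteq> Poly_Mapping.keys x"
    by (auto simp: in_keys_iff)
  then show ?thesis
    by (simp add: lin_ext_superset[of "Poly_Mapping.keys x"] scale_sum_right)
qed

lemma linear_lin_ext: "Vector_Spaces.linear pm_scale scale (lin_ext scale g)"
  by (simp add: linear_iff_pointwise vector_space_pm_scale lin_ext_add lin_ext_pm_scale)
    (rule vector_space_axioms)

lemma lin_ext_minus: "lin_ext scale g (x - y) = lin_ext scale g x - lin_ext scale g y"
  by (metis add_diff_cancel diff_add_cancel lin_ext_add)

lemma lin_ext_in_subspace:
  assumes "subspace W" "\<And>m. g m \<in> W"
  shows "lin_ext scale g z \<in> W"
  unfolding lin_ext_def using assms by (intro subspace_sum subspace_scale) auto

end

lemma lin_ext_comp: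
  assumes "Vector_Spaces.linear s1 s2 f"
  shows "f (lin_ext s1 g z) = lin_ext s2 (\<lambda>m. f (g m)) z"
proof -
  interpret Vector_Spaces.linear s1 s2 f by fact
  show ?thesis
    by (simp add: lin_ext_def sum scale)
qed

context assoc_algebra
begin

lemma lin_ext_mult:
  assumes "\<And>m n. g (m + n) = g m * g (n :: 'm::monoid_add)"
  shows "lin_ext scl g (x * y) = lin_ext scl g x * lin_ext scl g y"
proof (induction x rule: poly_mapping_add_induct)
  case (single m c)
  show ?case
  proof (induction y rule: poly_mapping_add_induct)
    case (single n d)
    then show ?case
      by (simp add: mult_single assms scale_mult_left scale_mult_right)
  qed (simp_all add: lin_ext_add distrib_left)
qed (simp_all add: lin_ext_add distrib_right)

lemma algebra_hom_lin_ext: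
  assumes "g 0 = 1" "\<And>m n. g (m + n) = g m * g (n :: 'm::monoid_add)"
  shows "algebra_hom pm_scale scl (lin_ext scl g)"
  unfolding algebra_hom_def
  by (auto simp: linear_lin_ext lin_ext_mult[OF assms(2)] assms(1) simp flip: single_one)

end

section \<open>Evaluation of free algebra elements\<close>

lemma evaluate_eq_lin_ext:
  "evaluate scl a = lin_ext scl (\<lambda>w. prod_list (map a (letters w)))"
  by (simp add: evaluate_def lin_ext_def fun_eq_iff)

lemma letters_zero [simp]: "letters 0 = []"
  and letters_plus [simp]: "letters (u + v) = letters u @ letters v"
  by (simp_all add: zero_free_monoid_def plus_free_monoid_def)

lemma algebra_homD:
  assumes "algebra_hom s1 s2 f"
  shows "f (x + y) = f x + f y" "f (s1 c x) = s2 c (f x)" "f 0 = 0" "f (- x) = - f x"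
    "f (x - y) = f x - f y" "f 1 = 1" "f (x * y) = f x * f y"
    "f (commutator x y) = commutator (f x) (f y)" "f (sum h A) = (\<Sum>i\<in>A. f (h i))"
    "f (of_int n) = of_int n" "f (prod_list xs) = prod_list (map f xs)"
proof -
  interpret Vector_Spaces.linear s1 s2 f
    using assms by (simp add: algebra_hom_def)
  show "f (x + y) = f x + f y" "f (s1 c x) = s2 c (f x)" "f 0 = 0" "f (- x) = - f x"
    "f (x - y) = f x - f y" "f (sum h A) = (\<Sum>i\<in>A. f (h i))"
    by (simp_all add: add scale zero neg diff sum)
  show f1: "f 1 = 1" and fm: "\<And>x y. f (x * y) = f x * f y"
    using assms by (auto simp: algebra_hom_def)
  show "f (commutator x y) = commutator (f x) (f y)"
    by (simp add: commutator_def fm diff)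
  have "f (of_nat k) = of_nat k" for k
    by (induction k) (simp_all add: zero add f1)
  then show "f (of_int n) = of_int n"
    by (cases n) (simp_all add: neg del: of_nat_Suc)
  show "f (prod_list xs) = prod_list (map f xs)"
    by (induction xs) (simp_all add: f1 fm)
qed

lemma (in assoc_algebra) algebra_hom_evaluate: "algebra_hom pm_scale scl (evaluate scl a)"
  unfolding evaluate_eq_lin_ext by (rule algebra_hom_lin_ext) simp_all

lemma (in assoc_algebra) evaluate_t [simp]: "evaluate scl a (t i) = a i"
  by (simp add: evaluate_eq_lin_ext t_def)

lemma single_eq_prod_t:
  "(Poly_Mapping.single w c :: 'k::field free_algebra) = pm_scale c (prod_list (map t (letters w)))"
proof -
  have "prod_list (map t l) = (Poly_Mapping.single (Free_Monoid l) 1 :: 'k free_algebra)" for l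
  proof (induction l)
    case Nil
    then show ?case by (simp flip: single_one zero_free_monoid_def)
  next
    case (Cons i l)
    then show ?case by (simp add: t_def mult_single plus_free_monoid_def)
  qed
  then show ?thesis
    by (simp add: pm_scale_eq_times mult_single)
qed

lemma free_algebra_hom_unique:
  assumes "algebra_hom pm_scale scl f" "algebra_hom pm_scale scl g" "\<And>i. f (t i) = g (t i)"
  shows "f x = g x"
proof (induction x rule: poly_mapping_add_induct)
  case (single w c)
  show ?case
    by (simp add: single_eq_prod_t algebra_homD[OF assms(1)] algebra_homD[OF assms(2)]
        assms(3) o_def)
qed (simp_all add: algebra_homD[OF assms(1)] algebra_homD[OF assms(2)])

lemma algebra_hom_comp:
  assumes "algebra_hom s1 s2 f" "algebra_hom s2 s3 g"
  shows "algebra_hom s1 s3 (\<lambda>x. g (f x))"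
  using assms unfolding algebra_hom_def linear_iff_pointwise by auto

lemma evaluate_in_subalgebra:
  assumes "assoc_algebra scl" "subalgebra scl A" "\<And>i. a i \<in> A"
  shows "evaluate scl a f \<in> A"
proof -
  interpret assoc_algebra scl by fact
  have "prod_list (map a l) \<in> A" for l
    by (induction l) (use assms in \<open>auto simp: subalgebra_def\<close>)
  then show ?thesis
    using assms(2) unfolding evaluate_eq_lin_ext subalgebra_def
    by (intro lin_ext_in_subspace) auto
qed

text \<open>\<open>h\<close> is asked to respect the operations on \<open>A\<close> only, because
  the map onto the test algebra, \<open>to_tri\<close>, is multiplicative on a suitable subalgebra
  of the matrices but not on all of them.\<close>

lemma evaluate_hom:
  assumes "assoc_algebra s1" "assoc_algebra s2"
    and add: "\<And>x y. x \<in> A \<Longrightarrow> y \<in> A \<Longrightarrow> h (x + y) = h x + h y"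
    and scale: "\<And>c x. x \<in> A \<Longrightarrow> h (s1 c x) = s2 c (h x)"
    and mult: "\<And>x y. x \<in> A \<Longrightarrow> y \<in> A \<Longrightarrow> h (x * y) = h x * h y"
    and one: "h 1 = 1"
    and A: "subalgebra s1 A" "\<And>i. a i \<in> A"
  shows "h (evaluate s1 a f) = evaluate s2 (\<lambda>i. h (a i)) f"
proof -
  interpret B: assoc_algebra s1 by fact
  interpret C: assoc_algebra s2 by fact
  have sub: "B.subspace A" and A1: "1 \<in> A" and Am: "\<And>x y. x \<in> A \<Longrightarrow> y \<in> A \<Longrightarrow> x * y \<in> A"
    using A(1) by (auto simp: subalgebra_def)
  note E = algebra_homD[OF B.algebra_hom_evaluate] and E' = algebra_homD[OF C.algebra_hom_evaluate]
  show ?thesis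
  proof (induction f rule: poly_mapping_add_induct)
    case zero
    have "h 0 = 0"
      using scale[of 1 0] A1 by (metis B.scale_zero_left C.scale_zero_left scale)
    then show ?case by (simp add: E E')
  next
    case (single w c)
    have l: "prod_list (map a l) \<in> A \<and> h (prod_list (map a l)) = prod_list (map (\<lambda>i. h (a i)) l)" for l
      by (induction l) (use A1 Am A(2) in \<open>auto simp: one mult\<close>)
    then show ?case
      by (simp add: evaluate_eq_lin_ext scale)
  next
    case (add x y)
    then show ?case
      using evaluate_in_subalgebra[OF assms(1) A] by (simp add: E E' assms(3))
  qed
qed

text \<open>Evaluating after an endomorphism \<open>\<phi>\<close> is the same as evaluating at the
  values of the \<open>\<phi> (t i)\<close>, which again lie in \<open>A\<close>.\<close>

lemma T_ideal_polynomial_identities: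
  assumes "assoc_algebra scl" "subalgebra scl A"
  shows "T_ideal (polynomial_identities scl A)"
proof -
  interpret assoc_algebra scl by fact
  interpret P: assoc_algebra "pm_scale :: 'a \<Rightarrow> 'a free_algebra \<Rightarrow> _" by (rule assoc_algebra_pm_scale)
  note E = algebra_homD[OF algebra_hom_evaluate]
  have "\<phi> f \<in> polynomial_identities scl A"
    if \<phi>: "algebra_hom pm_scale pm_scale \<phi>" and f: "f \<in> polynomial_identities scl A" for \<phi> f
  proof -
    have "evaluate scl a (\<phi> f) = 0" if a: "\<And>i. a i \<in> A" for a
    proof -
      have "evaluate scl a (\<phi> f) = evaluate scl (\<lambda>i. evaluate scl a (\<phi> (t i))) f"
        by (rule free_algebra_hom_unique[OF algebra_hom_comp[OF \<phi> algebra_hom_evaluate]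
              algebra_hom_evaluate]) simp
      also have "\<dots> = 0"
        using f evaluate_in_subalgebra[OF assms a] by (simp add: polynomial_identities_def)
      finally show ?thesis .
    qed
    then show ?thesis by (simp add: polynomial_identities_def)
  qed
  then show ?thesis
    unfolding T_ideal_def two_sided_ideal_def P.subspace_def
    by (auto simp: polynomial_identities_def E)
qed

lemma T_ideal_substitution:
  assumes "T_ideal I" "f \<in> I"
  shows "evaluate pm_scale a f \<in> I"
proof -
  have "algebra_hom pm_scale pm_scale (evaluate pm_scale a :: 'a free_algebra \<Rightarrow> _)"
    by (rule assoc_algebra.algebra_hom_evaluate[OF assoc_algebra_pm_scale])
  then show ?thesis using assms unfolding T_ideal_def by blast
qed

lemma generators_subset_T_ideal_generated: "G \<subseteq> T_ideal_generated G"
  unfolding T_ideal_generated_def by (rule hull_subset)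

lemma T_ideal_generated_minimal: "G \<subseteq> I \<Longrightarrow> T_ideal I \<Longrightarrow> T_ideal_generated G \<subseteq> I"
  unfolding T_ideal_generated_def by (rule hull_minimal)

section \<open>Linear algebra\<close>

text \<open>Stands in for the quotient by \<open>J\<close> without leaving the type:
  \<open>\<pi>\<close> kills a basis of \<open>J\<close> and fixes a complementary part of a basis.
  Congruences modulo \<open>J\<close> become equations between values of \<open>\<pi>\<close>, the
  form in which the exactness lemmas take their hypotheses.\<close>

lemma (in vector_space) ex_linear_with_kernel:
  assumes "subspace J"
  shows "\<exists>\<pi>. Vector_Spaces.linear scale scale \<pi> \<and> (\<forall>x. \<pi> x = 0 \<longleftrightarrow> x \<in> J)"
proof -
  interpret pair: vector_space_pair scale scale ..
  obtain B where B: "B \<subseteq> J" "independent B" "J \<subseteq> span B"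
    by (rule basis_exists[of J])
  then have J: "span B = J"
    using assms span_minimal by blast
  define E where "E = extend_basis B"
  have E: "independent E" "B \<subseteq> E" "span E = UNIV"
    using B(2) by (auto simp: E_def independent_extend_basis extend_basis_superset)
  obtain \<pi> where \<pi>: "Vector_Spaces.linear scale scale \<pi>" "\<forall>x\<in>E. \<pi> x = (if x \<in> B then 0 else x)"
    using pair.linear_independent_extend[OF E(1), of "\<lambda>x. if x \<in> B then 0 else x"] by blast
  interpret \<pi>: Vector_Spaces.linear scale scale \<pi> by fact
  have z: "\<pi> y = 0" if "y \<in> span B" for y
    using that by (rule \<pi>.eq_0_on_span[rotated]) (use \<pi>(2) E(2) in auto)
  have i: "\<pi> y = y" if "y \<in> span (E - B)" for y
    using that
    by (induction rule: span_induct_alt) (use \<pi>(2) in \<open>auto simp: \<pi>.zero \<pi>.add \<pi>.scale\<close>)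
  have "x \<in> J" if "\<pi> x = 0" for x
  proof -
    have "x \<in> span (B \<union> (E - B))"
      using E by (simp add: Un_absorb1)
    then obtain y w where yw: "x = y + w" "y \<in> span B" "w \<in> span (E - B)"
      unfolding span_Un by blast
    then show ?thesis
      using that z i J by (auto simp: \<pi>.add)
  qed
  then show ?thesis
    using \<pi>(1) z J by auto
qed

section \<open>Linear independence of monomials\<close>

text \<open>Dedekind's argument: replacing \<open>p\<close> by \<open>pmul q p\<close> and
  subtracting \<open>ch n q\<close> times the original relation removes the term of
  \<open>n\<close>, and the shorter relation has coefficients
  \<open>c m * (ch m q - ch n q)\<close>.\<close>

lemma characters_independent:
  fixes ch :: "'m \<Rightarrow> 'p \<Rightarrow> 'k::field"
  assumes "finite M"
    and mult: "\<And>m p q. ch m (pmul p q) = ch m p * ch m q"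
    and distinct: "\<And>m m'. m \<noteq> m' \<Longrightarrow> \<exists>p. ch m p \<noteq> ch m' p"
    and nonzero: "\<And>m. \<exists>p. ch m p \<noteq> 0"
    and zero: "\<And>p. (\<Sum>m\<in>M. c m * ch m p) = 0"
  shows "\<forall>m\<in>M. c m = 0"
  using assms(1) zero
proof (induction M arbitrary: c)
  case (insert n M)
  have "(\<Sum>m\<in>M. (c m * (ch m q - ch n q)) * ch m p) = 0" for p q
  proof -
    have "(\<Sum>m\<in>insert n M. c m * ch m (pmul q p)) - ch n q * (\<Sum>m\<in>insert n M. c m * ch m p) = 0"
      by (simp add: insert.prems del: sum.insert)
    then show ?thesis
      using insert.hyps
      by (simp add: mult algebra_simps sum_subtractf sum_distrib_left)
  qed
  then have "\<forall>m\<in>M. c m * (ch m q - ch n q) = 0" for q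
    by (rule insert.IH)
  then have M: "c m = 0" if "m \<in> M" for m
    using distinct[of m n] that insert.hyps(2) by auto
  obtain p where "ch n p \<noteq> 0"
    using nonzero by blast
  with insert.prems[of p] M insert.hyps have "c n = 0"
    by simp
  with M show ?case by auto
qed simp

text \<open>The value of x^a u^b d_k e_l at a point. Being linear in d and in e, these monomials
  represent the free module over K[x, u] with basis indexed by the pairs (k, l).\<close>

definition monomial_value ::
  "(nat \<Rightarrow> 'k) \<times> (nat \<Rightarrow> 'k) \<times> (nat \<Rightarrow> 'k) \<times> (nat \<Rightarrow> 'k) \<Rightarrow>
    nat multiset \<times> nat multiset \<times> nat \<times> nat \<Rightarrow> 'k::comm_ring_1"
  where "monomial_value = (\<lambda>(x, u, d, e) (a, b, k, l).
    (\<Prod>i\<in>#a. x i) * (\<Prod>i\<in>#b. u i) * d k * e l)"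

lemma prod_mset_delta:
  "(\<Prod>j\<in>#a. if j = i then c else 1) = (c :: 'k::comm_monoid_mult) ^ count a i"
  by (induction a) auto

text \<open>A monomial is a character for the componentwise product of points, so a polynomial
  function that vanishes at all points has zero coefficients by independence of characters.\<close>

lemma monomial_values_independent:
  fixes z :: "(nat multiset \<times> nat multiset \<times> nat \<times> nat) \<Rightarrow>\<^sub>0 'k::field_char_0"
  assumes "\<And>x u d e. lin_ext (*) (monomial_value (x, u, d, e)) z = 0"
  shows "z = 0"
proof -
  let ?mul = "\<lambda>(x, u, d, e) (x', u', d', e').
    (\<lambda>i::nat. x i * x' i :: 'k, \<lambda>i::nat. u i * u' i :: 'k, \<lambda>i::nat. d i * d' i :: 'k, \<lambda>i::nat. e i * e' i :: 'k)"
  have "\<forall>m\<in>Poly_Mapping.keys z. Poly_Mapping.lookup z m = 0"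
  proof (rule characters_independent[where ch = "\<lambda>m p. monomial_value p m" and pmul = ?mul])
    fix m p q
    show "monomial_value (?mul p q) m = monomial_value p m * monomial_value q m"
      by (cases m; cases p; cases q) (simp add: monomial_value_def prod_mset.distrib mult_ac)
  next
    fix m :: "nat multiset \<times> nat multiset \<times> nat \<times> nat"
    have "monomial_value (\<lambda>_. 1, \<lambda>_. 1, \<lambda>_. 1, \<lambda>_. 1) m = (1 :: 'k)"
      by (cases m) (simp add: monomial_value_def)
    then show "\<exists>p. monomial_value p m \<noteq> (0 :: 'k)"
      by (metis one_neq_zero)
  next
    fix m m' :: "nat multiset \<times> nat multiset \<times> nat \<times> nat"
    assume "m \<noteq> m'"
    moreover obtain a b k l a' b' k' l' where m: "m = (a, b, k, l)" "m' = (a', b', k', l')"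
      by (cases m; cases m')
    ultimately consider "a \<noteq> a'" | "b \<noteq> b'" | "k \<noteq> k'" | "l \<noteq> l'"
      by auto
    \<comment> \<open>This is where characteristic 0 enters: setting one coordinate to 2 and the
      others to 1 reveals an exponent. For the indices of d and e, which occur to the first power
      only, the values 0 and 1 are enough.\<close>
    moreover have "inj (\<lambda>n. (2 :: 'k) ^ n)"
    proof (rule injI)
      fix n n' :: nat
      assume "(2 :: 'k) ^ n = 2 ^ n'"
      then have "of_nat (2 ^ n) = (of_nat (2 ^ n') :: 'k)"
        by simp
      then show "n = n'"
        by (simp only: of_nat_eq_iff) simp
    qed
    ultimately have "\<exists>x u d e. monomial_value (x, u, d, e) m \<noteq> (monomial_value (x, u, d, e) m' :: 'k)"
    proof cases
      case 1
      then obtain i where "count a i \<noteq> count a' i"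
        by (auto simp: multiset_eq_iff)
      then have "(2 :: 'k) ^ count a i \<noteq> 2 ^ count a' i"
        using \<open>inj _\<close> by (auto dest: injD)
      then have "monomial_value (\<lambda>j. if j = i then 2 else 1, \<lambda>_. 1, \<lambda>_. 1, \<lambda>_. 1) m \<noteq>
          (monomial_value (\<lambda>j. if j = i then 2 else 1, \<lambda>_. 1, \<lambda>_. 1, \<lambda>_. 1) m' :: 'k)"
        by (simp add: m monomial_value_def prod_mset_delta)
      then show ?thesis by blast
    next
      case 2
      then obtain i where "count b i \<noteq> count b' i"
        by (auto simp: multiset_eq_iff)
      then have "(2 :: 'k) ^ count b i \<noteq> 2 ^ count b' i"
        using \<open>inj _\<close> by (auto dest: injD)
      then have "monomial_value (\<lambda>_. 1, \<lambda>j. if j = i then 2 else 1, \<lambda>_. 1, \<lambda>_. 1) m \<noteq>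
          (monomial_value (\<lambda>_. 1, \<lambda>j. if j = i then 2 else 1, \<lambda>_. 1, \<lambda>_. 1) m' :: 'k)"
        by (simp add: m monomial_value_def prod_mset_delta)
      then show ?thesis by blast
    next
      case 3
      then have "monomial_value (\<lambda>_. 1, \<lambda>_. 1, \<lambda>j. if j = k then 1 else 0, \<lambda>_. 1) m \<noteq>
          (monomial_value (\<lambda>_. 1, \<lambda>_. 1, \<lambda>j. if j = k then 1 else 0, \<lambda>_. 1) m' :: 'k)"
        by (simp add: m monomial_value_def)
      then show ?thesis by blast
    next
      case 4
      then have "monomial_value (\<lambda>_. 1, \<lambda>_. 1, \<lambda>_. 1, \<lambda>j. if j = l then 1 else 0) m \<noteq>
          (monomial_value (\<lambda>_. 1, \<lambda>_. 1, \<lambda>_. 1, \<lambda>j. if j = l then 1 else 0) m' :: 'k)"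
        by (simp add: m monomial_value_def)
      then show ?thesis by blast
    qed
    then show "\<exists>p. monomial_value p m \<noteq> (monomial_value p m' :: 'k)"
      by blast
  next
    fix p :: "(nat \<Rightarrow> 'k) \<times> (nat \<Rightarrow> 'k) \<times> (nat \<Rightarrow> 'k) \<times> (nat \<Rightarrow> 'k)"
    show "(\<Sum>m\<in>Poly_Mapping.keys z. Poly_Mapping.lookup z m * monomial_value p m) = 0"
      using assms by (cases p) (simp add: lin_ext_def)
  qed simp
  then show ?thesis
    by (intro poly_mapping_eqI) (metis in_keys_iff lookup_zero)
qed

section \<open>Contraction along a multiset\<close>

text \<open>The total differential of the monomial u^b: a letter is removed once for each of its
  occurrences, which supplies the exponent, and \<open>f\<close> receives the letter and the
  remaining monomial.\<close>

definition contract :: "'i multiset \<Rightarrow> ('i \<Rightarrow> 'i multiset \<Rightarrow> 'b::comm_monoid_add) \<Rightarrow> 'b"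
  where "contract b f = (\<Sum>i\<in>#b. f i (b - {#i#}))"

lemma contract_cong:
  assumes "\<And>i c. b = add_mset i c \<Longrightarrow> f i c = g i c"
  shows "contract b f = contract b g"
  unfolding contract_def
  by (rule arg_cong[where f = sum_mset, OF image_mset_cong]) (auto intro!: assms)

text \<open>The Leibniz rule for u_p u^b.\<close>

lemma contract_add_mset:
  "contract (add_mset p b) f = f p b + contract b (\<lambda>i c. f i (add_mset p c))"
proof -
  have "(\<Sum>i\<in>#b. f i (add_mset p b - {#i#})) = (\<Sum>i\<in>#b. f i (add_mset p (b - {#i#})))"
    by (rule arg_cong[where f = sum_mset, OF image_mset_cong]) (auto simp: multiset_eq_iff)
  then show ?thesis
    by (simp add: contract_def)
qed

lemma contract_add: "contract b (\<lambda>i c. f i c + g i c) = contract b f + contract b g"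
  by (simp add: contract_def sum_mset.distrib)

lemma contract_minus:
  "contract b (\<lambda>i c. f i c - g i c) = contract b f - (contract b g :: 'b::ab_group_add)"
proof -
  have "(\<Sum>i\<in>#A. f i (b - {#i#}) - g i (b - {#i#})) =
      (\<Sum>i\<in>#A. f i (b - {#i#})) - (\<Sum>i\<in>#A. g i (b - {#i#}))" for A
    by (induction A) auto
  then show ?thesis by (simp add: contract_def)
qed

text \<open>Euler's identity: if all letters contribute the same value, differentiation multiplies
  by the degree.\<close>

lemma (in vector_space) contract_const:
  assumes "\<And>i c. b = add_mset i c \<Longrightarrow> f i c = x"
  shows "contract b f = scale (of_nat (size b)) x"
proof -
  have "(\<Sum>i\<in>#A. x) = scale (of_nat (size A)) x" for A :: "'c multiset"
    by (induction A) (auto simp: scale_left_distrib)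
  moreover have "contract b f = contract b (\<lambda>_ _. x)"
    using assms by (rule contract_cong)
  ultimately show ?thesis by (simp add: contract_def)
qed

section \<open>Contracting homotopies\<close>

text \<open>
  The index \<open>(a, b, p, k)\<close> stands for \<open>x\<^sup>a u\<^sup>b e\<^bsub>pk\<^esub>\<close> with \<open>e\<^bsub>pk\<^esub> \<mapsto> u\<^sub>p d\<^sub>k - u\<^sub>k d\<^sub>p\<close>, and
  \<open>koszul2\<close> is the tensor square over the polynomial ring.  The last component \<open>0\<close> of the values
  of \<open>koszul\<close> is a dummy which allows the same monomials to serve for both maps.
\<close>

definition koszul ::
  "nat multiset \<times> nat multiset \<times> nat \<times> nat \<Rightarrow>
    (nat multiset \<times> nat multiset \<times> nat \<times> nat) \<Rightarrow>\<^sub>0 'k::field"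
  where "koszul = (\<lambda>(a, b, p, k).
    Poly_Mapping.single (a, add_mset p b, k, 0) 1 - Poly_Mapping.single (a, add_mset k b, p, 0) 1)"

definition koszul2 ::
  "nat multiset \<times> nat multiset \<times> nat \<times> nat \<times> nat \<times> nat \<Rightarrow>
    (nat multiset \<times> nat multiset \<times> nat \<times> nat) \<Rightarrow>\<^sub>0 'k::field"
  where "koszul2 = (\<lambda>(a, b, p, k, q, l).
    Poly_Mapping.single (a, add_mset p (add_mset q b), k, l) 1 -
    Poly_Mapping.single (a, add_mset k (add_mset q b), p, l) 1 -
    Poly_Mapping.single (a, add_mset p (add_mset l b), k, q) 1 +
    Poly_Mapping.single (a, add_mset k (add_mset l b), p, q) 1)"

text \<open>It suffices to find \<open>R\<close> with
  \<open>lin_ext scl R (koszul m) = \<phi> m\<close>, since then \<open>\<phi>\<close> factors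
  through \<open>koszul\<close>. By \<open>jacobi\<close> every letter of \<open>b\<close>
  contributes one copy of \<open>\<phi> (a, b, p, k)\<close>, and \<open>anti\<close> doubles the
  term in which the new letter is removed, for a total of \<open>size b + 2\<close>. The monomials
  in \<open>koszul\<close> have degree \<open>size b + 1\<close>, hence the divisor in
  \<open>R\<close> exceeds the degree by one.\<close>

lemma koszul_exact:
  fixes scl :: "'k::field_char_0 \<Rightarrow> 'b::ab_group_add \<Rightarrow> 'b"
    and \<phi> :: "nat multiset \<times> nat multiset \<times> nat \<times> nat \<Rightarrow> 'b"
  assumes "vector_space scl"
    and anti: "\<And>a b p k. \<phi> (a, b, k, p) = - \<phi> (a, b, p, k)"
    and jacobi: "\<And>a b i p k. \<phi> (a, add_mset i b, p, k) =
      \<phi> (a, add_mset p b, i, k) - \<phi> (a, add_mset k b, i, p)"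
    and cycle: "lin_ext pm_scale koszul z = 0"
  shows "lin_ext scl \<phi> z = 0"
proof -
  interpret vector_space scl by fact
  txt \<open>The de Rham differential in the variables \<open>u\<close>, divided by the degree of the form.\<close>
  define R where "R = (\<lambda>(a, b, k, l::nat).
    scl (1 / of_nat (size b + 1)) (contract b (\<lambda>i c. \<phi> (a, c, i, k))))"
  have "lin_ext scl R (koszul m) = \<phi> m" for m
  proof (cases m)
    case (fields a b p k)
    have "contract (add_mset p b) (\<lambda>i c. \<phi> (a, c, i, k)) - contract (add_mset k b) (\<lambda>i c. \<phi> (a, c, i, p))
      = \<phi> (a, b, p, k) - \<phi> (a, b, k, p) +
        contract b (\<lambda>i c. \<phi> (a, add_mset p c, i, k) - \<phi> (a, add_mset k c, i, p))"
      by (simp add: contract_add_mset contract_minus)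
    also have "contract b (\<lambda>i c. \<phi> (a, add_mset p c, i, k) - \<phi> (a, add_mset k c, i, p)) =
        scl (of_nat (size b)) (\<phi> (a, b, p, k))"
      by (rule contract_const) (simp add: jacobi[of a _ _ p k])
    also have "\<phi> (a, b, p, k) - \<phi> (a, b, k, p) + scl (of_nat (size b)) (\<phi> (a, b, p, k)) =
        scl (of_nat (size b + 2)) (\<phi> (a, b, p, k))"
      using scale_left_distrib[of 1 1 "\<phi> (a, b, p, k)"]
      by (simp add: anti[of a b k p] scale_left_distrib)
    finally show ?thesis
      using of_nat_neq_0[of "size b + 1", where ?'a = 'k]
      by (simp add: koszul_def R_def fields lin_ext_minus scale_right_diff_distrib[symmetric])
  qed
  then have "lin_ext scl \<phi> z = lin_ext scl (\<lambda>m. lin_ext scl R (koszul m)) z"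
    by simp
  also have "\<dots> = lin_ext scl R (lin_ext pm_scale koszul z)"
    by (rule lin_ext_comp[symmetric, OF linear_lin_ext])
  finally show ?thesis
    by (simp add: cycle)
qed

text \<open>Again a left inverse of the coordinate map is built, now by differentiating twice. The
  Leibniz terms in which the two new letters \<open>p\<close> and \<open>q\<close> change places are
  not multiples of the original element; \<open>standard\<close> rewrites their alternating sum as
  the element plus its flip.\<close>

lemma koszul2_exact:
  fixes scl :: "'k::field_char_0 \<Rightarrow> 'b::ab_group_add \<Rightarrow> 'b"
    and \<phi> :: "nat multiset \<times> nat multiset \<times> nat \<times> nat \<times> nat \<times> nat \<Rightarrow> 'b"
  assumes "vector_space scl"
    and anti1: "\<And>a b p k q l. \<phi> (a, b, k, p, q, l) = - \<phi> (a, b, p, k, q, l)"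
    and anti2: "\<And>a b p k q l. \<phi> (a, b, p, k, l, q) = - \<phi> (a, b, p, k, q, l)"
    and jacobi1: "\<And>a b i p k q l. \<phi> (a, add_mset i b, p, k, q, l) =
      \<phi> (a, add_mset p b, i, k, q, l) - \<phi> (a, add_mset k b, i, p, q, l)"
    and jacobi2: "\<And>a b i p k q l. \<phi> (a, add_mset i b, p, k, q, l) =
      \<phi> (a, add_mset q b, p, k, i, l) - \<phi> (a, add_mset l b, p, k, i, q)"
    and standard: "\<And>a p q k l. \<phi> (a, {#}, p, q, k, l) + \<phi> (a, {#}, k, l, p, q)
      - \<phi> (a, {#}, p, k, q, l) - \<phi> (a, {#}, q, l, p, k)
      + \<phi> (a, {#}, p, l, q, k) + \<phi> (a, {#}, q, k, p, l) = 0"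
    and cycle: "lin_ext pm_scale koszul2 z = 0"
  shows "lin_ext scl \<phi> z = 0"
proof -
  interpret vector_space scl by fact
  note sum_eq = arg_cong2[where f = "(+) :: 'b \<Rightarrow> _"]
  \<comment> \<open>For nonempty \<open>b\<close> the relation follows from the Jacobi relations
    alone: the standard element is killed by every u_i. Hence the hypothesis concerns
    \<open>b = {#}\<close> only.\<close>
  have standard': "\<phi> (a, b, p, q, k, l) + \<phi> (a, b, k, l, p, q)
      - \<phi> (a, b, p, k, q, l) - \<phi> (a, b, q, l, p, k)
      + \<phi> (a, b, p, l, q, k) + \<phi> (a, b, q, k, p, l) = 0" for a b p q k l
  proof (cases b)
    case empty
    then show ?thesis by (simp add: standard)
  next
    case (add i c)
    have 1: "\<phi> (a, add_mset p c, i, q, k, l) =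
        \<phi> (a, add_mset k c, i, q, p, l) - \<phi> (a, add_mset l c, i, q, p, k)"
      by (rule jacobi2)
    have 2: "\<phi> (a, add_mset q c, i, p, k, l) =
        \<phi> (a, add_mset k c, i, p, q, l) - \<phi> (a, add_mset l c, i, p, q, k)"
      by (rule jacobi2)
    have 3: "\<phi> (a, add_mset p c, i, l, q, k) =
        \<phi> (a, add_mset q c, i, l, p, k) - \<phi> (a, add_mset k c, i, l, p, q)"
      by (rule jacobi2)
    have 4: "\<phi> (a, add_mset p c, i, k, q, l) =
        \<phi> (a, add_mset q c, i, k, p, l) - \<phi> (a, add_mset l c, i, k, p, q)"
      by (rule jacobi2)
    show ?thesis
      by (simp add: add jacobi1[of a i c] 1 2 3 4)
  qed
  define T where "T a b k l = contract b (\<lambda>i c. contract c (\<lambda>j d. \<phi> (a, d, i, k, j, l)))"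
    for a b k l
  \<comment> \<open>In the Leibniz expansion of \<open>T\<close> at u_p u_q u^b, two terms remove
    exactly \<open>p\<close> and \<open>q\<close>. \<open>W\<close> collects the others, those which
    remove a letter \<open>j\<close> of \<open>b\<close>; in its last summand the second removed
    letter \<open>i\<close> also comes from \<open>b\<close>.\<close>
  define W where "W a p k q l j c = \<phi> (a, add_mset q c, p, k, j, l) + \<phi> (a, add_mset p c, q, k, j, l)
    + \<phi> (a, add_mset q c, j, k, p, l) + \<phi> (a, add_mset p c, j, k, q, l)
    + contract c (\<lambda>i d. \<phi> (a, add_mset p (add_mset q d), j, k, i, l))" for a p k q l j c
  have T: "T a (add_mset p (add_mset q b)) k l = \<phi> (a, b, p, k, q, l) + \<phi> (a, b, q, k, p, l)
      + contract b (W a p k q l)" for a b p k q l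
    unfolding T_def W_def contract_add contract_add_mset
    by (simp add: add_mset_commute ac_simps)
  \<comment> \<open>The scalar is 2 + 1 + 1 + 2 from \<open>g1\<close>, \<open>c1\<close>,
    \<open>c2\<close>, \<open>g4\<close>, plus \<open>size c\<close>, which is
    \<open>size b - 1\<close>, from pairs of letters of \<open>b\<close>.\<close>
  have W: "W a p k q l j c - W a k p q l j c - W a p k l q j c + W a k p l q j c =
      scl (of_nat (size b) + 5) (\<phi> (a, b, p, k, q, l))" if b: "b = add_mset j c" for a b p k q l j c
  proof -
    let ?x = "\<phi> (a, b, p, k, q, l)"
    have "contract c (\<lambda>i d. \<phi> (a, add_mset p (add_mset q d), j, k, i, l)
        - \<phi> (a, add_mset k (add_mset q d), j, p, i, l)
        - \<phi> (a, add_mset p (add_mset l d), j, k, i, q)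
        + \<phi> (a, add_mset k (add_mset l d), j, p, i, q)) = scl (of_nat (size c)) ?x"
    proof (rule contract_const)
      fix i d
      assume c: "c = add_mset i d"
      have 1: "?x = \<phi> (a, add_mset p c, j, k, q, l) - \<phi> (a, add_mset k c, j, p, q, l)"
        unfolding b by (rule jacobi1)
      have 2: "\<phi> (a, add_mset p c, j, k, q, l) =
          \<phi> (a, add_mset p (add_mset q d), j, k, i, l) - \<phi> (a, add_mset p (add_mset l d), j, k, i, q)"
        unfolding c using jacobi2[of a i "add_mset p d" j k q l] by (simp add: add_mset_commute)
      have 3: "\<phi> (a, add_mset k c, j, p, q, l) =
          \<phi> (a, add_mset k (add_mset q d), j, p, i, l) - \<phi> (a, add_mset k (add_mset l d), j, p, i, q)"
        unfolding c using jacobi2[of a i "add_mset k d" j p q l] by (simp add: add_mset_commute)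
      show "\<phi> (a, add_mset p (add_mset q d), j, k, i, l)
        - \<phi> (a, add_mset k (add_mset q d), j, p, i, l)
        - \<phi> (a, add_mset p (add_mset l d), j, k, i, q)
        + \<phi> (a, add_mset k (add_mset l d), j, p, i, q) = ?x"
        by (simp add: 1 2 3)
    qed
    then have inner: "contract c (\<lambda>i d. \<phi> (a, add_mset p (add_mset q d), j, k, i, l))
        - contract c (\<lambda>i d. \<phi> (a, add_mset k (add_mset q d), j, p, i, l))
        - contract c (\<lambda>i d. \<phi> (a, add_mset p (add_mset l d), j, k, i, q))
        + contract c (\<lambda>i d. \<phi> (a, add_mset k (add_mset l d), j, p, i, q)) = scl (of_nat (size c)) ?x"
      by (simp add: contract_add contract_minus)
    have r: "\<phi> (a, add_mset q c, p, k, j, l) = ?x + \<phi> (a, add_mset l c, p, k, j, q)"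
      using jacobi2[of a j c p k q l] by (simp add: b)
    have l: "\<phi> (a, add_mset p c, j, k, q, l) = ?x + \<phi> (a, add_mset k c, j, p, q, l)"
      using jacobi1[of a j c p k q l] by (simp add: b)
    have c1: "\<phi> (a, add_mset p c, q, k, j, l) - \<phi> (a, add_mset k c, q, p, j, l)
        - \<phi> (a, add_mset p c, l, k, j, q) + \<phi> (a, add_mset k c, l, p, j, q) = ?x"
    proof -
      have "\<phi> (a, add_mset p c, q, k, j, l) - \<phi> (a, add_mset k c, q, p, j, l) = \<phi> (a, add_mset q c, p, k, j, l)"
        using jacobi1[of a q c p k j l] by simp
      moreover have "\<phi> (a, add_mset p c, l, k, j, q) - \<phi> (a, add_mset k c, l, p, j, q) = \<phi> (a, add_mset l c, p, k, j, q)"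
        using jacobi1[of a l c p k j q] by simp
      ultimately show ?thesis using r by (simp add: algebra_simps)
    qed
    have c2: "\<phi> (a, add_mset q c, j, k, p, l) - \<phi> (a, add_mset q c, j, p, k, l)
        - \<phi> (a, add_mset l c, j, k, p, q) + \<phi> (a, add_mset l c, j, p, k, q) = ?x"
    proof -
      have "\<phi> (a, add_mset q c, j, k, p, l) - \<phi> (a, add_mset l c, j, k, p, q) = \<phi> (a, add_mset p c, j, k, q, l)"
        using jacobi2[of a p c j k q l] by simp
      moreover have "\<phi> (a, add_mset q c, j, p, k, l) - \<phi> (a, add_mset l c, j, p, k, q) = \<phi> (a, add_mset k c, j, p, q, l)"
        using jacobi2[of a k c j p q l] by simp
      ultimately show ?thesis using l by (simp add: algebra_simps)
    qed
    have g1: "\<phi> (a, add_mset q c, p, k, j, l) - \<phi> (a, add_mset q c, k, p, j, l)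
        - \<phi> (a, add_mset l c, p, k, j, q) + \<phi> (a, add_mset l c, k, p, j, q) = ?x + ?x"
      by (simp add: r anti1[of a _ k p])
    have g4: "\<phi> (a, add_mset p c, j, k, q, l) - \<phi> (a, add_mset k c, j, p, q, l)
        - \<phi> (a, add_mset p c, j, k, l, q) + \<phi> (a, add_mset k c, j, p, l, q) = ?x + ?x"
      by (simp add: l anti2[of a _ _ _ l q])
    have "W a p k q l j c - W a k p q l j c - W a p k l q j c + W a k p l q j c =
      (?x + ?x) + ?x + ?x + (?x + ?x) + scl (of_nat (size c)) ?x"
      using sum_eq[OF sum_eq[OF sum_eq[OF sum_eq[OF g1 c1] c2] g4] inner] unfolding W_def
      by (simp add: algebra_simps)
    also have "\<dots> = scl (of_nat (size b) + 5) ?x"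
    proof -
      have "(?x + ?x) + ?x + ?x + (?x + ?x) = scl 6 ?x"
        using scale_left_distrib[of 1 1 ?x] scale_left_distrib[of 2 1 ?x] scale_left_distrib[of 3 1 ?x]
          scale_left_distrib[of 4 1 ?x] scale_left_distrib[of 5 1 ?x] by (simp add: add.assoc)
      then show ?thesis
        by (simp add: b scale_left_distrib[symmetric] add_ac)
    qed
    finally show ?thesis .
  qed
  \<comment> \<open>With n = \<open>size b\<close>, the terms in \<open>W\<close> contribute n(n +
    5). The terms removing exactly \<open>p\<close> and \<open>q\<close> contribute 4 by
    antisymmetry in the given order; in the exchanged order \<open>standard'\<close> yields 1 and
    the flip.\<close>
  have TT: "T a (add_mset p (add_mset q b)) k l - T a (add_mset k (add_mset q b)) p l
      - T a (add_mset p (add_mset l b)) k q + T a (add_mset k (add_mset l b)) p q =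
      scl (of_nat (size b) ^ 2 + 5 * of_nat (size b) + 5) (\<phi> (a, b, p, k, q, l)) + \<phi> (a, b, q, l, p, k)"
    for a b p k q l
  proof -
    let ?x = "\<phi> (a, b, p, k, q, l)"
    have "contract b (\<lambda>j c. W a p k q l j c - W a k p q l j c - W a p k l q j c + W a k p l q j c) =
        scl (of_nat (size b)) (scl (of_nat (size b) + 5) ?x)"
      by (rule contract_const) (rule W)
    then have w: "contract b (W a p k q l) - contract b (W a k p q l) - contract b (W a p k l q)
        + contract b (W a k p l q) = scl (of_nat (size b) ^ 2 + 5 * of_nat (size b)) ?x"
      by (simp add: contract_add contract_minus power2_eq_square algebra_simps)
    have st: "\<phi> (a, b, q, k, p, l) + \<phi> (a, b, p, q, k, l) + \<phi> (a, b, k, l, p, q) + \<phi> (a, b, p, l, q, k)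
        = ?x + \<phi> (a, b, q, l, p, k)"
      using standard'[of a b p q k l] by (simp add: algebra_simps)
    have "scl 5 ?x = ?x + ?x + ?x + ?x + ?x"
      using scale_left_distrib[of 1 1 ?x] scale_left_distrib[of 2 1 ?x] scale_left_distrib[of 3 1 ?x]
          scale_left_distrib[of 4 1 ?x] by simp
    then have "scl (of_nat (size b) ^ 2 + 5 * of_nat (size b) + 5) ?x + \<phi> (a, b, q, l, p, k) =
        (?x + ?x + ?x + ?x) + (?x + \<phi> (a, b, q, l, p, k)) +
        scl (of_nat (size b) ^ 2 + 5 * of_nat (size b)) ?x"
      by (simp add: scale_left_distrib[of _ 5] algebra_simps)
    also have "\<dots> = T a (add_mset p (add_mset q b)) k l - T a (add_mset k (add_mset q b)) p l
      - T a (add_mset p (add_mset l b)) k q + T a (add_mset k (add_mset l b)) p q"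
      using sum_eq[OF sum_eq[OF refl[of "?x + ?x + ?x + ?x"] st] w, symmetric] unfolding T
      using anti1[of a b k p q l] anti1[of a b q p k l] anti2[of a b p k l q] anti1[of a b l k p q]
        anti1[of a b k p l q] anti1[of a b l p k q] anti2[of a b p l k q]
      by (simp add: algebra_simps)
    finally show ?thesis by simp
  qed
  txt \<open>
    By \<open>TT\<close>, differentiating twice amounts to multiplication by \<open>w\<close> plus the flip of the tensor
    factors; as the flip is an involution, this is inverted by means of \<open>w\<^sup>2 - 1\<close>.
  \<close>
  define w :: "nat \<Rightarrow> 'k" where "w n = of_nat n ^ 2 + of_nat n - 1" for n
  define R where "R = (\<lambda>(a, b, k, l).
    scl (1 / (w (size b) ^ 2 - 1)) (scl (w (size b)) (T a b k l) - T a b l k))"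
  have "lin_ext scl R (koszul2 m) = \<phi> m" for m
  proof (cases m)
    case (fields a b p k q l)
    \<comment> \<open>\<open>koszul2\<close> raises the degree in u by two, so \<open>w\<close> is
      evaluated at \<open>size b + 2\<close>; it is chosen so that w(n + 2) = n^2 + 5n + 5, the
      scalar of \<open>TT\<close>.\<close>
    define c where "c = w (size b + 2)"
    have c: "c = of_nat (size b) ^ 2 + 5 * of_nat (size b) + 5"
      by (simp add: c_def w_def power2_eq_square algebra_simps)
    \<comment> \<open>c - 1 = (n + 1)(n + 4) and c + 1 = (n + 2)(n + 3) are the scalars on the parts
      that are antisymmetric and symmetric under the flip.\<close>
    have "c ^ 2 - 1 = of_nat ((size b + 1) * (size b + 2) * (size b + 3) * (size b + 4))"
      by (simp add: c power2_eq_square algebra_simps)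
    then have c0: "c ^ 2 - 1 \<noteq> 0"
      by (simp only: of_nat_eq_0_iff) simp
    let ?S = "\<lambda>f. f (add_mset p (add_mset q b)) k l - f (add_mset k (add_mset q b)) p l
      - f (add_mset p (add_mset l b)) k q + f (add_mset k (add_mset l b)) p q"
    have S1: "?S (T a) = scl c (\<phi> (a, b, p, k, q, l)) + \<phi> (a, b, q, l, p, k)"
      by (simp add: TT c)
    have S2: "?S (\<lambda>b k l. T a b l k) = scl c (\<phi> (a, b, q, l, p, k)) + \<phi> (a, b, p, k, q, l)"
      using TT[of a q p b l k] by (simp add: c add_mset_commute algebra_simps)
    have "lin_ext scl R (koszul2 m) = scl (1 / (c ^ 2 - 1)) (scl c (?S (T a)) - ?S (\<lambda>b k l. T a b l k))"
      by (simp add: koszul2_def fields R_def lin_ext_add lin_ext_minus c_def algebra_simps)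
    also have "scl c (?S (T a)) - ?S (\<lambda>b k l. T a b l k) = scl (c ^ 2 - 1) (\<phi> (a, b, p, k, q, l))"
      unfolding S1 S2 by (simp add: power2_eq_square algebra_simps)
    also have "scl (1 / (c ^ 2 - 1)) \<dots> = \<phi> m"
      using c0 by (simp add: fields)
    finally show ?thesis .
  qed
  then have "lin_ext scl \<phi> z = lin_ext scl (\<lambda>m. lin_ext scl R (koszul2 m)) z"
    by simp
  also have "\<dots> = lin_ext scl R (lin_ext pm_scale koszul2 z)"
    by (rule lin_ext_comp[symmetric, OF linear_lin_ext])
  finally show ?thesis
    by (simp add: cycle)
qed

section \<open>The powers of the commutator ideal\<close>

interpretation PM: assoc_algebra "pm_scale :: 'k::field \<Rightarrow> ('m::monoid_add \<Rightarrow>\<^sub>0 'k) \<Rightarrow> _"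
  by (rule assoc_algebra_pm_scale)

definition commutator_ideal :: "'k::field free_algebra set"
  where "commutator_ideal = PM.span {x * commutator (t i) (t j) * y | x y i j. True}"

definition commutator_ideal2 :: "'k::field free_algebra set"
  where "commutator_ideal2 = PM.span {x * y | x y. x \<in> commutator_ideal \<and> y \<in> commutator_ideal}"

lemma subspace_commutator_ideal: "PM.subspace commutator_ideal"
  and subspace_commutator_ideal2: "PM.subspace commutator_ideal2"
  by (simp_all add: commutator_ideal_def commutator_ideal2_def)

lemma two_sided_ideal_span:
  fixes G :: "'k::field free_algebra set"
  assumes "\<And>g x. g \<in> G \<Longrightarrow> x * g \<in> PM.span G" "\<And>g x. g \<in> G \<Longrightarrow> g * x \<in> PM.span G"
  shows "two_sided_ideal pm_scale (PM.span G)"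
proof -
  have "y * x \<in> PM.span G \<and> x * y \<in> PM.span G" if "x \<in> PM.span G" for x y
    using that
    by (induction rule: PM.span_induct_alt)
      (simp_all add: distrib_left distrib_right PM.span_zero PM.scale_mult_left PM.scale_mult_right
        PM.span_add PM.span_scale assms)
  then show ?thesis by (simp add: two_sided_ideal_def)
qed

lemma ideal_rules:
  assumes "two_sided_ideal pm_scale (I :: 'k::field free_algebra set)"
  shows "0 \<in> I" "x \<in> I \<Longrightarrow> y \<in> I \<Longrightarrow> x + y \<in> I" "x \<in> I \<Longrightarrow> y \<in> I \<Longrightarrow> x - y \<in> I"
    "x \<in> I \<Longrightarrow> - x \<in> I" "x \<in> I \<Longrightarrow> y * x \<in> I" "x \<in> I \<Longrightarrow> x * y \<in> I"
    "x \<in> I \<Longrightarrow> pm_scale c x \<in> I" "x \<in> I \<Longrightarrow> commutator y x \<in> I" "x \<in> I \<Longrightarrow> commutator x y \<in> I"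
  using assms unfolding two_sided_ideal_def commutator_def
  by (auto intro: PM.subspace_0 PM.subspace_add PM.subspace_diff PM.subspace_neg PM.subspace_scale)

lemma ideal_commutator_ideal: "two_sided_ideal pm_scale commutator_ideal"
  unfolding commutator_ideal_def
proof (rule two_sided_ideal_span)
  fix g x :: "'a free_algebra"
  assume "g \<in> {x * commutator (t i) (t j) * y | x y i j. True}"
  then obtain y z i j where g: "g = y * commutator (t i) (t j) * z"
    by blast
  have "x * g = (x * y) * commutator (t i) (t j) * z" "g * x = y * commutator (t i) (t j) * (z * x)"
    by (simp_all add: g mult.assoc)
  then show "x * g \<in> PM.span {x * commutator (t i) (t j) * y | x y i j. True}"
    "g * x \<in> PM.span {x * commutator (t i) (t j) * y | x y i j. True}"
    by (blast intro: PM.span_base)+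
qed

lemmas commutator_ideal_rules = ideal_rules[OF ideal_commutator_ideal]

lemma ideal_commutator_ideal2: "two_sided_ideal pm_scale commutator_ideal2"
  unfolding commutator_ideal2_def
proof (rule two_sided_ideal_span)
  let ?G = "{x * y | x y. x \<in> commutator_ideal \<and> y \<in> commutator_ideal}"
  fix g x :: "'a free_algebra"
  assume "g \<in> ?G"
  then obtain y z where g: "g = y * z" "y \<in> commutator_ideal" "z \<in> commutator_ideal"
    by blast
  have "x * g = (x * y) * z" "g * x = y * (z * x)" "x * y \<in> commutator_ideal" "z * x \<in> commutator_ideal"
    using g by (simp_all add: mult.assoc commutator_ideal_rules(5,6))
  then show "x * g \<in> PM.span ?G" "g * x \<in> PM.span ?G"
    using g by (blast intro: PM.span_base)+
qed

lemmas commutator_ideal2_rules = ideal_rules[OF ideal_commutator_ideal2]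

lemma mult_in_commutator_ideal2:
  "x \<in> commutator_ideal \<Longrightarrow> y \<in> commutator_ideal \<Longrightarrow> x * y \<in> commutator_ideal2"
  unfolding commutator_ideal2_def by (blast intro: PM.span_base)

lemma free_algebra_induct [case_names zero one generator add scale]:
  fixes x :: "'k::field free_algebra"
  assumes zero: "P 0" and one: "P 1" and generator: "\<And>i x. P x \<Longrightarrow> P (t i * x)"
    and add: "\<And>x y. P x \<Longrightarrow> P y \<Longrightarrow> P (x + y)" and scale: "\<And>c x. P x \<Longrightarrow> P (pm_scale c x)"
  shows "P x"
proof (induction x rule: poly_mapping_add_induct)
  case (single w c)
  have "P (prod_list (map t l))" for l
    by (induction l) (auto intro: one generator)
  then show ?case
    by (simp add: single_eq_prod_t scale)
qed (auto intro: zero add)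

lemma commutator_t_in_commutator_ideal:
  fixes x :: "'k::field free_algebra"
  shows "commutator (t i) x \<in> commutator_ideal"
proof (induction x rule: free_algebra_induct)
  case (generator j x)
  have "commutator (t i) (t j) = 1 * commutator (t i) (t j) * (1 :: 'k free_algebra)"
    by simp
  then have "commutator (t i) (t j) \<in> (commutator_ideal :: 'k free_algebra set)"
    unfolding commutator_ideal_def by (blast intro: PM.span_base)
  moreover have "commutator (t i) (t j * x) = commutator (t i) (t j) * x + t j * commutator (t i) x"
    by (simp add: commutator_def algebra_simps)
  ultimately show ?case
    using generator by (auto intro: commutator_ideal_rules)
next
  case (add x y)
  have "commutator (t i) (x + y) = commutator (t i) x + commutator (t i) y"
    by (simp add: commutator_def algebra_simps)
  then show ?case using add by (auto intro: commutator_ideal_rules)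
next
  case (scale c x)
  have "commutator (t i) (pm_scale c x) = pm_scale c (commutator (t i) x)"
    by (simp add: commutator_def PM.scale_mult_left PM.scale_mult_right PM.scale_right_diff_distrib)
  then show ?case using scale by (auto intro: commutator_ideal_rules)
qed (auto simp: commutator_def commutator_ideal_rules)

lemma commutator_in_commutator_ideal:
  fixes x :: "'k::field free_algebra"
  shows "commutator x y \<in> commutator_ideal"
proof (induction x rule: free_algebra_induct)
  case (generator i x)
  have "commutator (t i * x) y = t i * commutator x y + commutator (t i) y * x"
    by (simp add: commutator_def algebra_simps)
  then show ?case
    using generator commutator_t_in_commutator_ideal[of i y] by (auto intro: commutator_ideal_rules)
next
  case (add x z)
  have "commutator (x + z) y = commutator x y + commutator z y"
    by (simp add: commutator_def algebra_simps)
  then show ?case using add by (auto intro: commutator_ideal_rules)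
next
  case (scale c x)
  have "commutator (pm_scale c x) y = pm_scale c (commutator x y)"
    by (simp add: commutator_def PM.scale_mult_left PM.scale_mult_right PM.scale_right_diff_distrib)
  then show ?case using scale by (auto intro: commutator_ideal_rules)
qed (auto simp: commutator_def commutator_ideal_rules)

lemma left_mult_closed:
  assumes "PM.subspace W" "\<And>i w. w \<in> W \<Longrightarrow> t i * w \<in> W" "w \<in> W"
  shows "x * w \<in> (W :: 'k::field free_algebra set)"
  by (induction x rule: free_algebra_induct)
    (use assms in \<open>auto simp: mult.assoc distrib_right PM.scale_mult_left
      intro: PM.subspace_0 PM.subspace_add PM.subspace_scale\<close>)

lemma right_mult_closed:
  assumes "PM.subspace W" "\<And>i w. w \<in> W \<Longrightarrow> w * t i \<in> W" "w \<in> W"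
  shows "w * x \<in> (W :: 'k::field free_algebra set)"
proof -
  have "\<forall>w\<in>W. w * x \<in> W"
    by (induction x rule: free_algebra_induct)
      (use assms in \<open>auto simp: mult.assoc[symmetric] distrib_left PM.scale_mult_right
      intro: PM.subspace_0 PM.subspace_add PM.subspace_scale\<close>)
  then show ?thesis using assms(3) by blast
qed

section \<open>Spanning sets modulo powers of the commutator ideal\<close>

text \<open>Sorting merely selects a representative. Words are indexed by multisets because
  reordering changes a product of generators only modulo C, and a nest of commutators applied to an
  element of C only modulo C^2.\<close>

definition sorted_monomial :: "nat multiset \<Rightarrow> 'k::field free_algebra"
  where "sorted_monomial a = prod_list (map t (sorted_list_of_multiset a))"

definition iterated_commutator :: "nat multiset \<Rightarrow> 'k::field free_algebra \<Rightarrow> 'k free_algebra"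
  where "iterated_commutator b x = foldr (\<lambda>i. commutator (t i)) (sorted_list_of_multiset b) x"

definition commutator_word :: "nat multiset \<times> nat multiset \<times> nat \<times> nat \<Rightarrow> 'k::field free_algebra"
  where "commutator_word = (\<lambda>(a, b, p, k).
    sorted_monomial a * iterated_commutator b (commutator (t p) (t k)))"

definition commutator_word2 ::
  "nat multiset \<times> nat multiset \<times> nat \<times> nat \<times> nat \<times> nat \<Rightarrow> 'k::field free_algebra"
  where "commutator_word2 = (\<lambda>(a, b, p, k, q, l). commutator_word (a, b, p, k) * commutator (t q) (t l))"

lemma prod_t_insort:
  "prod_list (map t (insort i l)) - t i * prod_list (map t l) \<in> (commutator_ideal :: 'k::field free_algebra set)"
proof (induction l)
  case (Cons j l)
  have "t j * prod_list (map t (insort i l)) - t i * (t j * prod_list (map t l)) =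
      t j * (prod_list (map t (insort i l)) - t i * prod_list (map t l)) -
      commutator (t i) (t j) * (prod_list (map t l) :: 'k free_algebra)"
    by (simp add: commutator_def algebra_simps)
  also have "\<dots> \<in> commutator_ideal"
    by (rule commutator_ideal_rules(3)[OF commutator_ideal_rules(5)[OF Cons] commutator_ideal_rules(6)[OF commutator_t_in_commutator_ideal]])
  finally show ?case
    by (simp add: commutator_ideal_rules)
qed (simp add: commutator_ideal_rules)

lemma sorted_monomial_add_mset:
  "sorted_monomial (add_mset i a) - t i * sorted_monomial a \<in> (commutator_ideal :: 'k::field free_algebra set)"
  unfolding sorted_monomial_def by (simp add: sorted_list_of_multiset_insert prod_t_insort)

lemma commutator_linear:
  "commutator a (x + y) = commutator a x + commutator a y"
  "commutator a (x - y) = commutator a x - commutator a y"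
  "commutator a (- x) = - commutator a x"
  by (simp_all add: commutator_def algebra_simps)

lemma iterated_commutator_linear:
  "iterated_commutator b (x + y) = iterated_commutator b x + iterated_commutator b y"
  "iterated_commutator b (x - y) = iterated_commutator b x - iterated_commutator b y"
  "iterated_commutator b (- x) = - iterated_commutator b x"
proof -
  have "foldr (\<lambda>i. commutator (t i)) l (x + y) =
      foldr (\<lambda>i. commutator (t i)) l x + foldr (\<lambda>i. commutator (t i)) l y"
    "foldr (\<lambda>i. commutator (t i)) l (x - y) =
      foldr (\<lambda>i. commutator (t i)) l x - foldr (\<lambda>i. commutator (t i)) l y"
    "foldr (\<lambda>i. commutator (t i)) l (- x) = - foldr (\<lambda>i. commutator (t i)) l x" for l
    by (induction l) (simp_all add: commutator_linear)
  then show "iterated_commutator b (x + y) = iterated_commutator b x + iterated_commutator b y"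
    "iterated_commutator b (x - y) = iterated_commutator b x - iterated_commutator b y"
    "iterated_commutator b (- x) = - iterated_commutator b x"
    by (simp_all add: iterated_commutator_def)
qed

lemma iterated_commutator_in_ideal:
  assumes "two_sided_ideal pm_scale I" "x \<in> I"
  shows "iterated_commutator b x \<in> I"
proof -
  have "foldr (\<lambda>i. commutator (t i)) l x \<in> I" for l
    by (induction l) (auto intro: assms(2) ideal_rules[OF assms(1)])
  then show ?thesis by (simp add: iterated_commutator_def)
qed

text \<open>The operators ad t_i and ad t_j commute up to ad [t_j, t_i], which maps C into C^2, so a
  new outermost letter can be moved to its sorted place.\<close>

lemma iterated_commutator_add_mset:
  assumes "x \<in> commutator_ideal"
  shows "iterated_commutator (add_mset i b) x - commutator (t i) (iterated_commutator b x)
    \<in> commutator_ideal2"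
proof -
  have C: "foldr (\<lambda>i. commutator (t i)) l x \<in> commutator_ideal" for l
    by (induction l) (auto intro: assms commutator_ideal_rules)
  have "foldr (\<lambda>i. commutator (t i)) (insort i l) x -
      commutator (t i) (foldr (\<lambda>i. commutator (t i)) l x) \<in> commutator_ideal2" for l
  proof (induction l)
    case (Cons j l)
    let ?y = "foldr (\<lambda>i. commutator (t i)) l x"
    have "commutator (t j) (foldr (\<lambda>i. commutator (t i)) (insort i l) x)
        - commutator (t i) (commutator (t j) ?y) =
      commutator (t j) (foldr (\<lambda>i. commutator (t i)) (insort i l) x - commutator (t i) ?y)
        + commutator (commutator (t j) (t i)) ?y"
      by (simp add: commutator_def algebra_simps)
    also have "\<dots> \<in> commutator_ideal2"
    proof (rule commutator_ideal2_rules(2))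
      show "commutator (commutator (t j) (t i)) ?y \<in> commutator_ideal2"
        using C[of l] commutator_t_in_commutator_ideal[of j "t i"]
        unfolding commutator_def[of _ ?y] by (intro commutator_ideal2_rules mult_in_commutator_ideal2)
    qed (intro commutator_ideal2_rules Cons)
    finally show ?case
      by (simp add: commutator_ideal2_rules)
  qed (simp add: commutator_ideal2_rules)
  then show ?thesis
    by (simp add: iterated_commutator_def sorted_list_of_multiset_insert)
qed

text \<open>The counterpart for a new innermost letter: the Jacobi identity applies at the innermost
  commutator, whereas multiplication by generators acts from outside.\<close>

lemma iterated_commutator_add_mset':
  assumes "x \<in> commutator_ideal"
  shows "iterated_commutator (add_mset i b) x - iterated_commutator b (commutator (t i) x)
    \<in> commutator_ideal2"
proof (induction b)
  case empty
  show ?case by (simp add: iterated_commutator_def commutator_ideal2_rules)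
next
  case (add j b)
  let ?I = "iterated_commutator"
  have 1: "?I (add_mset j (add_mset i b)) x - commutator (t j) (?I (add_mset i b) x) \<in> commutator_ideal2"
    using assms by (rule iterated_commutator_add_mset)
  have 2: "?I (add_mset j b) (commutator (t i) x) - commutator (t j) (?I b (commutator (t i) x))
      \<in> commutator_ideal2"
    by (rule iterated_commutator_add_mset) (rule commutator_t_in_commutator_ideal)
  have 3: "commutator (t j) (?I (add_mset i b) x - ?I b (commutator (t i) x)) \<in> commutator_ideal2"
    by (intro commutator_ideal2_rules add)
  have "?I (add_mset i (add_mset j b)) x - ?I (add_mset j b) (commutator (t i) x) =
    (?I (add_mset j (add_mset i b)) x - commutator (t j) (?I (add_mset i b) x))
    - (?I (add_mset j b) (commutator (t i) x) - commutator (t j) (?I b (commutator (t i) x)))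
    + commutator (t j) (?I (add_mset i b) x - ?I b (commutator (t i) x))"
    by (simp add: commutator_def algebra_simps add_mset_commute)
  also have "\<dots> \<in> commutator_ideal2"
    by (intro commutator_ideal2_rules(2,3) 1 2 3)
  finally show ?case .
qed

lemma commutator_word_in_commutator_ideal: "commutator_word m \<in> commutator_ideal"
  by (cases m) (simp add: commutator_word_def commutator_ideal_rules commutator_t_in_commutator_ideal
      iterated_commutator_in_ideal[OF ideal_commutator_ideal])

lemma commutator_word_antisymmetric:
  "commutator_word (a, b, k, p) = - commutator_word (a, b, p, k)"
proof -
  have "commutator (t k) (t p) = - commutator (t p) (t k :: 'a free_algebra)"
    by (simp add: commutator_def)
  then show ?thesis
    by (simp add: commutator_word_def iterated_commutator_linear)
qed

lemma commutator_word_jacobi: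
  "commutator_word (a, add_mset i b, p, k) - (commutator_word (a, add_mset p b, i, k)
    - commutator_word (a, add_mset k b, i, p)) \<in> (commutator_ideal2 :: 'k::field free_algebra set)"
proof -
  let ?I = "iterated_commutator"
  let ?m = "sorted_monomial a :: 'k free_algebra"
  let ?e = "\<lambda>p k. commutator (t p) (t k) :: 'k free_algebra"
  let ?d = "\<lambda>i p k. ?I (add_mset i b) (?e p k) - ?I b (commutator (t i) (?e p k))"
  have d: "?d i p k \<in> commutator_ideal2" for i p k
    by (rule iterated_commutator_add_mset') (rule commutator_t_in_commutator_ideal)
  have "commutator (t i) (?e p k) = commutator (t p) (?e i k) - commutator (t k) (?e i p)"
    by (simp add: commutator_def algebra_simps)
  then have "?I b (commutator (t i) (?e p k)) =
      ?I b (commutator (t p) (?e i k)) - ?I b (commutator (t k) (?e i p))"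
    by (simp add: iterated_commutator_linear)
  then have "commutator_word (a, add_mset i b, p, k) - (commutator_word (a, add_mset p b, i, k)
      - commutator_word (a, add_mset k b, i, p)) = ?m * (?d i p k - (?d p i k - ?d k i p))"
    by (simp add: commutator_word_def algebra_simps)
  also have "\<dots> \<in> commutator_ideal2"
    by (intro commutator_ideal2_rules(3,5) d)
  finally show ?thesis .
qed

section \<open>Spanning families modulo C and modulo C^2\<close>

lemma in_span_lin_ext:
  assumes "PM.subspace J" "f \<in> PM.span (range \<phi> \<union> J)"
  shows "\<exists>z. f - lin_ext pm_scale \<phi> z \<in> (J :: 'k::field free_algebra set)"
  using assms(2)
proof (induction rule: PM.span_induct_alt)
  case base
  have "0 - lin_ext pm_scale \<phi> 0 \<in> J"
    using assms(1) by (simp add: PM.subspace_0)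
  then show ?case by blast
next
  case (step c x y)
  then obtain z where z: "y - lin_ext pm_scale \<phi> z \<in> J"
    by blast
  show ?case
  proof (cases "x \<in> J")
    case True
    then have "pm_scale c x + (y - lin_ext pm_scale \<phi> z) \<in> J"
      using z assms(1) by (intro PM.subspace_add PM.subspace_scale)
    then show ?thesis by (auto simp: algebra_simps)
  next
    case False
    then obtain m where "x = \<phi> m"
      using step by blast
    then have "pm_scale c x + y - lin_ext pm_scale \<phi> (Poly_Mapping.single m c + z) \<in> J"
      using z by (simp add: PM.lin_ext_add)
    then show ?thesis by blast
  qed
qed

lemma span_Un_cong:
  assumes "x - y \<in> J" "y \<in> PM.span (G \<union> J)"
  shows "x \<in> PM.span (G \<union> (J :: 'k::field free_algebra set))"
proof -
  have "(x - y) + y \<in> PM.span (G \<union> J)"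
    using assms by (intro PM.span_add) (auto intro: PM.span_base)
  then show ?thesis by simp
qed

lemma spanning_free_algebra:
  "\<exists>z. f - lin_ext pm_scale sorted_monomial z \<in> (commutator_ideal :: 'k::field free_algebra set)"
proof (rule in_span_lin_ext)
  let ?W = "PM.span (range sorted_monomial \<union> commutator_ideal) :: 'k free_algebra set"
  have closed: "t i * w \<in> ?W" if "w \<in> ?W" for i w
    using that
  proof (induction rule: PM.span_induct_alt)
    case (step c x y)
    have "t i * x \<in> ?W"
    proof (cases "x \<in> commutator_ideal")
      case True
      then show ?thesis by (intro PM.span_base) (auto intro: commutator_ideal_rules)
    next
      case False
      then obtain a where a: "x = sorted_monomial a"
        using step by blast
      have "- (sorted_monomial (add_mset i a) - t i * sorted_monomial a) \<in> (commutator_ideal :: 'k free_algebra set)"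
        by (intro commutator_ideal_rules sorted_monomial_add_mset)
      then have "t i * x - sorted_monomial (add_mset i a) \<in> commutator_ideal"
        by (simp add: a)
      then show ?thesis
        by (rule span_Un_cong) (auto intro: PM.span_base)
    qed
    then show ?case
      using step by (simp add: distrib_left PM.scale_mult_right PM.span_add PM.span_scale)
  qed (simp add: PM.span_zero)
  have one: "1 \<in> ?W"
    by (rule PM.span_base) (auto simp: sorted_monomial_def intro!: image_eqI[where x = "{#}"])
  have "f * 1 \<in> ?W"
    by (rule left_mult_closed[OF PM.subspace_span closed one])
  then show "f \<in> ?W" by simp
qed (rule subspace_commutator_ideal)

text \<open>Modulo C^2, left multiplication by \<open>t i\<close> adds \<open>i\<close> to the first
  multiset and ad \<open>t i\<close> adds it to the second. Right multiplication is the difference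
  of the two, so the span is a two-sided ideal containing all [t_i, t_j].\<close>

lemma commutator_ideal_subset_span:
  "commutator_ideal \<subseteq> (PM.span (range commutator_word \<union> commutator_ideal2) :: 'k::field free_algebra set)"
proof -
  let ?W = "PM.span (range commutator_word \<union> commutator_ideal2) :: 'k free_algebra set"
  let ?I = "iterated_commutator"
  have left: "t i * w \<in> ?W" and ad: "commutator (t i) w \<in> ?W" if "w \<in> ?W" for i w
    using that
  proof (induction rule: PM.span_induct_alt)
    case (step c x y)
    have "t i * x \<in> ?W \<and> commutator (t i) x \<in> ?W"
    proof (cases "x \<in> commutator_ideal2")
      case True
      then show ?thesis by (simp add: PM.span_base commutator_ideal2_rules)
    next
      case False
      then obtain a b p k where x: "x = commutator_word (a, b, p, k)"
        using step by auto
      let ?e = "commutator (t p) (t k) :: 'k free_algebra"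
      have e: "?e \<in> commutator_ideal"
        by (rule commutator_t_in_commutator_ideal)
      then have c: "?I b ?e \<in> commutator_ideal"
        by (rule iterated_commutator_in_ideal[OF ideal_commutator_ideal])
      have "t i * x - commutator_word (add_mset i a, b, p, k) =
          - ((sorted_monomial (add_mset i a) - t i * sorted_monomial a) * ?I b ?e)"
        by (simp add: x commutator_word_def algebra_simps)
      also have "\<dots> \<in> commutator_ideal2"
        using c sorted_monomial_add_mset by (intro commutator_ideal2_rules mult_in_commutator_ideal2)
      finally have 1: "t i * x \<in> ?W"
        by (rule span_Un_cong) (auto intro: PM.span_base)
      have "commutator (t i) x - commutator_word (a, add_mset i b, p, k) =
          commutator (t i) (sorted_monomial a) * ?I b ?e -
          sorted_monomial a * (?I (add_mset i b) ?e - commutator (t i) (?I b ?e))"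
        by (simp add: x commutator_word_def commutator_def algebra_simps)
      also have "\<dots> \<in> commutator_ideal2"
        by (intro commutator_ideal2_rules(3,5) mult_in_commutator_ideal2 c commutator_t_in_commutator_ideal
            iterated_commutator_add_mset)
      finally have "commutator (t i) x \<in> ?W"
        by (rule span_Un_cong) (auto intro: PM.span_base)
      with 1 show ?thesis ..
    qed
    moreover have "commutator (t i) (pm_scale c x + y) = pm_scale c (commutator (t i) x) + commutator (t i) y"
      by (simp add: commutator_def PM.scale_mult_left PM.scale_mult_right PM.scale_right_diff_distrib
          algebra_simps)
    ultimately show "t i * (pm_scale c x + y) \<in> ?W" "commutator (t i) (pm_scale c x + y) \<in> ?W"
      using step by (simp_all add: distrib_left PM.scale_mult_right PM.span_add PM.span_scale)
  qed (simp_all add: PM.span_zero commutator_def)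
  have right: "w * t i \<in> ?W" if "w \<in> ?W" for w i
  proof -
    have "t i * w - commutator (t i) w \<in> ?W"
      using that by (intro PM.span_diff left ad)
    then show ?thesis by (simp add: commutator_def)
  qed
  have "x * commutator (t i) (t j) * y \<in> ?W" for x y i j
  proof -
    have "commutator (t i) (t j) = commutator_word ({#}, {#}, i, j)"
      by (simp add: commutator_word_def sorted_monomial_def iterated_commutator_def)
    then have "commutator (t i) (t j) \<in> ?W"
      by (metis PM.span_base UnI1 rangeI)
    then show ?thesis
      by (intro right_mult_closed[OF _ right] left_mult_closed[OF _ left]) auto
  qed
  then show ?thesis
    unfolding commutator_ideal_def by (intro PM.span_minimal) auto
qed

section \<open>Algebras with central products of commutators\<close>

text \<open>Of the T-ideal only the substitution instances of the three generators are retained. The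
  assumption \<open>standard\<close> is s_4 written in products of commutators, which is the form in
  which words of C^2 see it.\<close>

locale central_commutator_ideal =
  fixes I :: "'k::field_char_0 free_algebra set"
  assumes ideal: "two_sided_ideal pm_scale I"
    and central: "commutator (commutator a b * commutator c d) e \<in> I"
    and triple: "commutator a b * commutator c d * commutator e f \<in> I"
    and standard: "commutator a b * commutator c d + commutator c d * commutator a b
      - commutator a c * commutator b d - commutator b d * commutator a c
      + commutator a d * commutator b c + commutator b c * commutator a d \<in> I"
begin

lemmas I_rules = ideal_rules[OF ideal]

text \<open>Moving \<open>x\<close> or \<open>y\<close> to the left past a commutator leaves an
  error that is again a commutator, so each error term still contains three commutator
  factors.\<close>

lemma triple': "commutator a b * x * commutator c d * y * commutator e f \<in> I"
proof -
  have 1: "commutator a b * commutator c d * y * commutator e f \<in> I" for a b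
  proof -
    have "commutator a b * commutator c d * y * commutator e f =
      commutator a b * commutator (commutator c d) y * commutator e f
      + y * (commutator a b * commutator c d * commutator e f)
      + commutator (commutator a b) y * commutator c d * commutator e f"
      by (simp add: commutator_def algebra_simps)
    also have "\<dots> \<in> I"
      by (intro I_rules(2) I_rules(5) triple)
    finally show ?thesis .
  qed
  have "commutator a b * x * commutator c d * y * commutator e f =
    x * (commutator a b * commutator c d * y * commutator e f)
    + commutator (commutator a b) x * commutator c d * y * commutator e f"
    by (simp add: commutator_def algebra_simps)
  also have "\<dots> \<in> I"
    by (intro I_rules(2) I_rules(5) 1)
  finally show ?thesis .
qed

lemma commutator_ideal_cubed:
  assumes "x \<in> commutator_ideal" "y \<in> commutator_ideal" "w \<in> commutator_ideal"
  shows "x * y * w \<in> I"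
proof -
  let ?G = "{x * commutator (t i) (t j) * y | x y i j. True} :: 'k free_algebra set"
  have 1: "x * y * w \<in> I" if G: "x \<in> ?G" "y \<in> ?G" "w \<in> ?G" for x y w
  proof -
    obtain x1 x2 y1 y2 w1 w2 i1 j1 i2 j2 i3 j3 where "x = x1 * commutator (t i1) (t j1) * x2"
      "y = y1 * commutator (t i2) (t j2) * y2" "w = w1 * commutator (t i3) (t j3) * w2"
      using G by blast
    then have "x * y * w = x1 * (commutator (t i1) (t j1) * (x2 * y1) * commutator (t i2) (t j2)
        * (y2 * w1) * commutator (t i3) (t j3)) * w2"
      by (simp add: mult.assoc)
    also have "\<dots> \<in> I"
      by (intro I_rules(5) I_rules(6) triple')
    finally show ?thesis .
  qed
  have 2: "x * y * w \<in> I" if "x \<in> commutator_ideal" "y \<in> ?G" "w \<in> ?G" for x y w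
    using that(1) unfolding commutator_ideal_def
    by (induction rule: PM.span_induct_alt)
      (use that 1 in \<open>simp_all add: I_rules distrib_right PM.scale_mult_left\<close>)
  have 3: "x * y * w \<in> I" if "x \<in> commutator_ideal" "y \<in> commutator_ideal" "w \<in> ?G" for x y w
    using that(2) unfolding commutator_ideal_def
    by (induction rule: PM.span_induct_alt)
      (use that 2 in \<open>simp_all add: I_rules distrib_right distrib_left PM.scale_mult_left PM.scale_mult_right\<close>)
  show ?thesis
    using assms(3) unfolding commutator_ideal_def
    by (induction rule: PM.span_induct_alt)
      (use assms 3 in \<open>simp_all add: I_rules distrib_left PM.scale_mult_right\<close>)
qed

lemma commutator_ideal2_times:
  assumes "x \<in> commutator_ideal2" "y \<in> commutator_ideal"
  shows "x * y \<in> I"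
  using assms(1) unfolding commutator_ideal2_def
  by (induction rule: PM.span_induct_alt)
    (use assms(2) commutator_ideal_cubed in \<open>auto simp: I_rules distrib_right PM.scale_mult_left\<close>)

text \<open>Outer factors do no harm: their commutators with \<open>z\<close> create a third
  commutator. A factor between the two commutators is moved to the left at the price of another
  product of two commutators.\<close>

lemma commutator_ideal2_central:
  assumes "x \<in> commutator_ideal" "y \<in> commutator_ideal"
  shows "commutator (x * y) z \<in> I"
proof -
  let ?G = "{x * commutator (t i) (t j) * y | x y i j. True} :: 'k free_algebra set"
  note C = commutator_in_commutator_ideal
  have 0: "commutator (u * (commutator a b * commutator c d) * v) z \<in> I" for a b c d u v
  proof -
    have "commutator (u * (commutator a b * commutator c d) * v) z =
      u * commutator (commutator a b * commutator c d) z * v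
      + u * (commutator a b * commutator c d * commutator v z)
      + commutator u z * commutator a b * commutator c d * v"
      by (simp add: commutator_def[of _ z] algebra_simps)
    also have "\<dots> \<in> I"
      by (intro I_rules(2) I_rules(5) I_rules(6) commutator_ideal_cubed central C)
    finally show ?thesis .
  qed
  have 1: "commutator (x * y) z \<in> I" if G: "x \<in> ?G" "y \<in> ?G" for x y
  proof -
    obtain x1 x2 y1 y2 i1 j1 i2 j2 where "x = x1 * commutator (t i1) (t j1) * x2"
      "y = y1 * commutator (t i2) (t j2) * y2"
      using G by blast
    then have "x * y = (x1 * (x2 * y1)) * (commutator (t i1) (t j1) * commutator (t i2) (t j2)) * y2
        + x1 * (commutator (commutator (t i1) (t j1)) (x2 * y1) * commutator (t i2) (t j2)) * y2"
      by (simp add: commutator_def[of "commutator _ _"] algebra_simps)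
    moreover have "commutator (v + w) z = commutator v z + commutator w z" for v w
      by (simp add: commutator_def algebra_simps)
    ultimately show ?thesis
      using 0 by (simp only:) (intro I_rules(2) 0)
  qed
  have lin: "commutator (pm_scale c v + w) z = pm_scale c (commutator v z) + commutator w z" for c v w
    by (simp add: commutator_def PM.scale_mult_left PM.scale_mult_right PM.scale_right_diff_distrib
        algebra_simps)
  have zero: "commutator 0 z = 0"
    by (simp add: commutator_def)
  have 2: "commutator (x * y) z \<in> I" if "x \<in> commutator_ideal" "y \<in> ?G" for x y
    using that(1) unfolding commutator_ideal_def
    by (induction rule: PM.span_induct_alt)
      (use that 1 in \<open>simp_all add: I_rules distrib_right PM.scale_mult_left lin zero\<close>)
  show ?thesis
    using assms(2) unfolding commutator_ideal_def
    by (induction rule: PM.span_induct_alt)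
      (use assms 2 in \<open>simp_all add: I_rules distrib_left PM.scale_mult_right lin zero\<close>)
qed

text \<open>The second factor can be a plain [t_q, t_l]: what stands to its left is absorbed into
  the first factor, and what stands to its right is brought to the front by centrality and absorbed
  there too.\<close>

lemma commutator_ideal2_subset_span:
  "commutator_ideal2 \<subseteq> PM.span (range commutator_word2 \<union> I)"
proof -
  let ?W = "PM.span (range commutator_word2 \<union> I)"
  have 1: "x * commutator (t q) (t l) \<in> ?W" if x: "x \<in> commutator_ideal" for x q l
  proof -
    have "x \<in> PM.span (range commutator_word \<union> commutator_ideal2)"
      using x commutator_ideal_subset_span by blast
    then show ?thesis
    proof (induction rule: PM.span_induct_alt)
      case (step c x y)
      have "x * commutator (t q) (t l) \<in> ?W"
      proof (cases "x \<in> commutator_ideal2")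
        case True
        then have "x * commutator (t q) (t l) \<in> I"
          by (intro commutator_ideal2_times commutator_in_commutator_ideal)
        then show ?thesis by (simp add: PM.span_base)
      next
        case False
        then obtain a b p k where "x = commutator_word (a, b, p, k)"
          using step by auto
        then have "x * commutator (t q) (t l) = commutator_word2 (a, b, p, k, q, l)"
          by (simp add: commutator_word2_def)
        then show ?thesis by (metis PM.span_base UnI1 rangeI)
      qed
      then show ?case
        using step by (simp add: distrib_right PM.scale_mult_left PM.span_add PM.span_scale)
    qed (simp add: PM.span_zero)
  qed
  have 2: "x * (y * commutator (t q) (t l) * z) \<in> ?W" if x: "x \<in> commutator_ideal" for x y z q l
  proof -
    have xy: "x * y \<in> commutator_ideal"
      using x by (rule commutator_ideal_rules)
    have "commutator (x * y * commutator (t q) (t l)) z \<in> I"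
      by (intro commutator_ideal2_central xy commutator_in_commutator_ideal)
    moreover have "z * (x * y) * commutator (t q) (t l) \<in> ?W"
      by (intro 1 commutator_ideal_rules(5) xy)
    ultimately have "commutator (x * y * commutator (t q) (t l)) z +
        z * (x * y) * commutator (t q) (t l) \<in> ?W"
      by (intro PM.span_add) (auto intro: PM.span_base)
    then show ?thesis
      by (simp add: commutator_def[of _ z] mult.assoc)
  qed
  have "x * y \<in> ?W" if "x \<in> commutator_ideal" "y \<in> commutator_ideal" for x y
    using that(2) unfolding commutator_ideal_def
    by (induction rule: PM.span_induct_alt)
      (use 2[OF that(1)] in \<open>auto simp: distrib_left PM.scale_mult_right PM.span_zero
        intro!: PM.span_add PM.span_scale\<close>)
  then show ?thesis
    unfolding commutator_ideal2_def by (intro PM.span_minimal) auto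
qed

section \<open>Relations between the spanning words of C^2 modulo \<open>I\<close>\<close>

lemma commutator_word2_antisymmetric:
  "commutator_word2 (a, b, k, p, q, l) = - commutator_word2 (a, b, p, k, q, l)"
  "commutator_word2 (a, b, p, k, l, q) = - commutator_word2 (a, b, p, k, q, l)"
  by (simp_all add: commutator_word2_def commutator_word_antisymmetric[of a b k p])
    (simp add: commutator_def algebra_simps)

lemma commutator_word2_jacobi1:
  "commutator_word2 (a, add_mset i b, p, k, q, l) - (commutator_word2 (a, add_mset p b, i, k, q, l)
    - commutator_word2 (a, add_mset k b, i, p, q, l)) \<in> I"
proof -
  have "(commutator_word (a, add_mset i b, p, k) - (commutator_word (a, add_mset p b, i, k)
    - commutator_word (a, add_mset k b, i, p))) * commutator (t q) (t l) \<in> I"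
    by (intro commutator_ideal2_times commutator_word_jacobi commutator_in_commutator_ideal)
  then show ?thesis
    by (simp add: commutator_word2_def left_diff_distrib)
qed

text \<open>As the product of the two factors is central modulo \<open>I\<close>, the derivation ad
  \<open>t i\<close> annihilates it, so ad \<open>t i\<close> on the first factor is minus ad
  \<open>t i\<close> on the second. This transports the Jacobi identity of the second commutator
  into the common multiset \<open>b\<close>; the sign is the same in all three terms.\<close>

lemma commutator_word2_shift:
  "commutator_word2 (a, add_mset i b, p, k, q, l)
    + commutator_word (a, b, p, k) * commutator (t i) (commutator (t q) (t l)) \<in> I"
proof -
  let ?e = "commutator (t p) (t k) :: 'k free_algebra" and ?f = "commutator (t q) (t l) :: 'k free_algebra"
  let ?m = "sorted_monomial a :: 'k free_algebra" and ?I = "iterated_commutator"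
  have e: "?e \<in> commutator_ideal" and f: "?f \<in> commutator_ideal"
    by (rule commutator_in_commutator_ideal)+
  have c: "?I b ?e \<in> commutator_ideal"
    by (intro iterated_commutator_in_ideal[OF ideal_commutator_ideal] e)
  have "commutator_word2 (a, add_mset i b, p, k, q, l)
    + commutator_word (a, b, p, k) * commutator (t i) ?f =
    ?m * ((?I (add_mset i b) ?e - commutator (t i) (?I b ?e)) * ?f) - ?m * commutator (?I b ?e * ?f) (t i)"
    by (simp add: commutator_word2_def commutator_word_def commutator_def[of _ "t i"]
        commutator_def[of "t i"] algebra_simps)
  also have "\<dots> \<in> I"
    by (intro I_rules(3) I_rules(5) commutator_ideal2_times commutator_ideal2_central
        iterated_commutator_add_mset e f c)
  finally show ?thesis .
qed

lemma commutator_word2_jacobi2: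
  "commutator_word2 (a, add_mset i b, p, k, q, l) - (commutator_word2 (a, add_mset q b, p, k, i, l)
    - commutator_word2 (a, add_mset l b, p, k, i, q)) \<in> I"
proof -
  let ?w = "commutator_word (a, b, p, k) :: 'k free_algebra"
  let ?s = "\<lambda>i q l. commutator_word2 (a, add_mset i b, p, k, q, l)
    + ?w * commutator (t i) (commutator (t q) (t l))"
  have "?s i q l - (?s q i l - ?s l i q) \<in> I"
    by (intro I_rules(3) commutator_word2_shift)
  also have "?s i q l - (?s q i l - ?s l i q) =
    commutator_word2 (a, add_mset i b, p, k, q, l) - (commutator_word2 (a, add_mset q b, p, k, i, l)
    - commutator_word2 (a, add_mset l b, p, k, i, q))
    + ?w * (commutator (t i) (commutator (t q) (t l)) - (commutator (t q) (commutator (t i) (t l))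
      - commutator (t l) (commutator (t i) (t q))))"
    by (simp add: algebra_simps)
  also have "commutator (t i) (commutator (t q) (t l)) - (commutator (t q) (commutator (t i) (t l))
      - commutator (t l) (commutator (t i) (t q :: 'k free_algebra))) = 0"
    by (simp add: commutator_def algebra_simps)
  finally show ?thesis by simp
qed

lemma commutator_word2_standard:
  "commutator_word2 (a, {#}, p, q, k, l) + commutator_word2 (a, {#}, k, l, p, q)
      - commutator_word2 (a, {#}, p, k, q, l) - commutator_word2 (a, {#}, q, l, p, k)
      + commutator_word2 (a, {#}, p, l, q, k) + commutator_word2 (a, {#}, q, k, p, l) \<in> I"
proof -
  have "sorted_monomial a * (commutator (t p) (t q) * commutator (t k) (t l)
      + commutator (t k) (t l) * commutator (t p) (t q)
      - commutator (t p) (t k) * commutator (t q) (t l) - commutator (t q) (t l) * commutator (t p) (t k)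
      + commutator (t p) (t l) * commutator (t q) (t k) + commutator (t q) (t k) * commutator (t p) (t l)) \<in> I"
    by (intro I_rules(5) standard)
  then show ?thesis
    by (simp add: commutator_word2_def commutator_word_def iterated_commutator_def distrib_left
        right_diff_distrib mult.assoc)
qed

lemma lin_ext_commutator_word2:
  assumes "lin_ext pm_scale koszul2 z = 0"
  shows "lin_ext pm_scale commutator_word2 z \<in> I"
proof -
  obtain \<pi> :: "'k free_algebra \<Rightarrow> 'k free_algebra" where
    \<pi>: "Vector_Spaces.linear pm_scale pm_scale \<pi>" "\<And>x. \<pi> x = 0 \<longleftrightarrow> x \<in> I"
    using PM.ex_linear_with_kernel[of I] ideal by (auto simp: two_sided_ideal_def)
  interpret \<pi>: Vector_Spaces.linear pm_scale pm_scale \<pi> by fact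
  have eq: "\<pi> x = \<pi> y - \<pi> w" if "x - (y - w) \<in> I" for x y w
    using that \<pi>(2)[of "x - (y - w)"] by (simp add: \<pi>.diff)
  have "lin_ext pm_scale (\<lambda>m. \<pi> (commutator_word2 m)) z = 0"
  proof (rule koszul2_exact[OF vector_space_pm_scale])
    fix a b i p k q l
    show "\<pi> (commutator_word2 (a, b, k, p, q, l)) = - \<pi> (commutator_word2 (a, b, p, k, q, l))"
      "\<pi> (commutator_word2 (a, b, p, k, l, q)) = - \<pi> (commutator_word2 (a, b, p, k, q, l))"
      by (simp_all only: commutator_word2_antisymmetric(1)[of a b k p q l]
          commutator_word2_antisymmetric(2)[of a b p k l q] \<pi>.neg)
    show "\<pi> (commutator_word2 (a, add_mset i b, p, k, q, l)) =
      \<pi> (commutator_word2 (a, add_mset p b, i, k, q, l)) - \<pi> (commutator_word2 (a, add_mset k b, i, p, q, l))"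
      by (rule eq) (rule commutator_word2_jacobi1)
    show "\<pi> (commutator_word2 (a, add_mset i b, p, k, q, l)) =
      \<pi> (commutator_word2 (a, add_mset q b, p, k, i, l)) - \<pi> (commutator_word2 (a, add_mset l b, p, k, i, q))"
      by (rule eq) (rule commutator_word2_jacobi2)
    show "\<pi> (commutator_word2 (a, {#}, p, q, k, l)) + \<pi> (commutator_word2 (a, {#}, k, l, p, q))
      - \<pi> (commutator_word2 (a, {#}, p, k, q, l)) - \<pi> (commutator_word2 (a, {#}, q, l, p, k))
      + \<pi> (commutator_word2 (a, {#}, p, l, q, k)) + \<pi> (commutator_word2 (a, {#}, q, k, p, l)) = 0"
      using commutator_word2_standard[of a p q k l] \<pi>(2) by (simp flip: \<pi>.add \<pi>.diff)
  qed (rule assms)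
  then show ?thesis
    using \<pi>(2) by (simp flip: lin_ext_comp[OF \<pi>(1)])
qed

end

lemma lin_ext_commutator_word:
  fixes z :: "_ \<Rightarrow>\<^sub>0 'k::field_char_0"
  assumes "lin_ext pm_scale koszul z = 0"
  shows "lin_ext pm_scale commutator_word z \<in> commutator_ideal2"
proof -
  obtain \<pi> :: "'k free_algebra \<Rightarrow> 'k free_algebra" where
    \<pi>: "Vector_Spaces.linear pm_scale pm_scale \<pi>" "\<And>x. \<pi> x = 0 \<longleftrightarrow> x \<in> commutator_ideal2"
    using PM.ex_linear_with_kernel[OF subspace_commutator_ideal2] by auto
  interpret \<pi>: Vector_Spaces.linear pm_scale pm_scale \<pi> by fact
  have eq: "\<pi> x = \<pi> y - \<pi> w" if "x - (y - w) \<in> commutator_ideal2" for x y w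
    using that \<pi>(2)[of "x - (y - w)"] by (simp add: \<pi>.diff)
  have "lin_ext pm_scale (\<lambda>m. \<pi> (commutator_word m)) z = 0"
  proof (rule koszul_exact[OF vector_space_pm_scale])
    fix a b i p k
    show "\<pi> (commutator_word (a, b, k, p)) = - \<pi> (commutator_word (a, b, p, k))"
      by (simp only: commutator_word_antisymmetric[of a b k p] \<pi>.neg)
    show "\<pi> (commutator_word (a, add_mset i b, p, k)) =
      \<pi> (commutator_word (a, add_mset p b, i, k)) - \<pi> (commutator_word (a, add_mset k b, i, p))"
      by (rule eq) (rule commutator_word_jacobi)
  qed (rule assms)
  then show ?thesis
    using \<pi>(2) by (simp flip: lin_ext_comp[OF \<pi>(1)])
qed

section \<open>A triangular test algebra\<close>

text \<open>\<open>Tri a b e d c\<close> is the upper triangular matrix with rows \<open>(a, b, e)\<close>, \<open>(0, d, c)\<close>, \<open>(0, 0, a)\<close>.\<close>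

datatype 'k tri = Tri (tri_a: 'k) (tri_b: 'k) (tri_e: 'k) (tri_d: 'k) (tri_c: 'k)

instantiation tri :: (comm_ring_1) ring_1
begin

definition "0 = Tri 0 0 0 0 0"
definition "1 = Tri 1 0 0 1 0"
definition "x + y = Tri (tri_a x + tri_a y) (tri_b x + tri_b y) (tri_e x + tri_e y)
  (tri_d x + tri_d y) (tri_c x + tri_c y)"
definition "x - y = Tri (tri_a x - tri_a y) (tri_b x - tri_b y) (tri_e x - tri_e y)
  (tri_d x - tri_d y) (tri_c x - tri_c y)"
definition "- x = Tri (- tri_a x) (- tri_b x) (- tri_e x) (- tri_d x) (- tri_c x)"
definition "x * y = Tri (tri_a x * tri_a y) (tri_a x * tri_b y + tri_b x * tri_d y)
  (tri_a x * tri_e y + tri_b x * tri_c y + tri_e x * tri_a y)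
  (tri_d x * tri_d y) (tri_d x * tri_c y + tri_c x * tri_a y)"

instance
  by standard
    (simp_all add: zero_tri_def one_tri_def plus_tri_def minus_tri_def uminus_tri_def times_tri_def
      algebra_simps)

end

definition tri_scale :: "'k::field \<Rightarrow> 'k tri \<Rightarrow> 'k tri"
  where "tri_scale r x = Tri (r * tri_a x) (r * tri_b x) (r * tri_e x) (r * tri_d x) (r * tri_c x)"

lemmas tri_defs = zero_tri_def one_tri_def plus_tri_def minus_tri_def uminus_tri_def times_tri_def
  tri_scale_def

lemma assoc_algebra_tri_scale: "assoc_algebra (tri_scale :: 'k::field \<Rightarrow> _)"
  by standard (simp_all add: tri_defs algebra_simps)

context
  fixes x u d e :: "nat \<Rightarrow> 'k::field_char_0"
begin

text \<open>On matrices with zero diagonal, ad \<open>t i\<close> multiplies the (1,2) entry by the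
  difference of the first two diagonal entries, that is by \<open>u i\<close>. Equal first and third
  diagonal entries make matrices supported in the corner central, as C^2 requires. The entries
  \<open>d\<close> and \<open>e\<close> are the coordinates of the two commutator factors.\<close>

definition tri_eval :: "'k free_algebra \<Rightarrow> 'k tri"
  where "tri_eval = evaluate tri_scale (\<lambda>i. Tri (x i) (d i) 0 (x i - u i) (e i))"

lemma algebra_hom_tri_eval: "algebra_hom pm_scale tri_scale tri_eval"
  unfolding tri_eval_def by (rule assoc_algebra.algebra_hom_evaluate[OF assoc_algebra_tri_scale])

lemmas tri_eval_hom = algebra_homD[OF algebra_hom_tri_eval]

lemma tri_eval_t: "tri_eval (t i) = Tri (x i) (d i) 0 (x i - u i) (e i)"
  unfolding tri_eval_def by (rule assoc_algebra.evaluate_t[OF assoc_algebra_tri_scale])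

lemma linear_tri_functionals:
  "Vector_Spaces.linear pm_scale (*) (\<lambda>f. r * tri_a (tri_eval f))"
  "Vector_Spaces.linear pm_scale (*) (\<lambda>f. r * tri_b (tri_eval f))"
  "Vector_Spaces.linear pm_scale (*) (\<lambda>f. r * tri_e (tri_eval f))"
proof -
  show "Vector_Spaces.linear pm_scale (*) (\<lambda>f. r * tri_a (tri_eval f))"
    "Vector_Spaces.linear pm_scale (*) (\<lambda>f. r * tri_b (tri_eval f))"
    "Vector_Spaces.linear pm_scale (*) (\<lambda>f. r * tri_e (tri_eval f))"
    unfolding linear_iff_pointwise
    by (auto simp: vector_space_pm_scale vector_space_over_itself.vector_space_axioms tri_eval_hom tri_defs
        algebra_simps)
qed

lemma tri_eval_commutator_ideal:
  assumes "f \<in> commutator_ideal"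
  shows "tri_a (tri_eval f) = 0" "tri_d (tri_eval f) = 0"
proof -
  have "tri_a (tri_eval f) = 0 \<and> tri_d (tri_eval f) = 0"
    using assms unfolding commutator_ideal_def
  proof (induction rule: PM.span_induct_alt)
    case (step c y z)
    then obtain v w i j where "y = v * commutator (t i) (t j) * w"
      by blast
    then have "tri_a (tri_eval y) = 0 \<and> tri_d (tri_eval y) = 0"
      by (simp add: tri_eval_hom commutator_def tri_defs)
    then show ?case
      using step by (simp add: tri_eval_hom tri_defs)
  qed (simp add: tri_eval_hom tri_defs)
  then show "tri_a (tri_eval f) = 0" "tri_d (tri_eval f) = 0"
    by simp_all
qed

lemma tri_eval_commutator_ideal2:
  assumes "f \<in> commutator_ideal2"
  shows "tri_b (tri_eval f) = 0"
  using assms unfolding commutator_ideal2_def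
proof (induction rule: PM.span_induct_alt)
  case (step c y z)
  then obtain v w where "y = v * w" "v \<in> commutator_ideal" "w \<in> commutator_ideal"
    by blast
  then have "tri_b (tri_eval y) = 0"
    using tri_eval_commutator_ideal by (simp add: tri_eval_hom tri_defs)
  then show ?case
    using step by (simp add: tri_eval_hom tri_defs)
qed (simp add: tri_eval_hom tri_defs)

lemma tri_eval_sorted_monomial: "tri_a (tri_eval (sorted_monomial a)) = (\<Prod>i\<in>#a. x i)"
proof -
  have "tri_a (tri_eval (prod_list (map t l))) = prod_list (map x l)" for l
    by (induction l) (simp_all add: tri_eval_hom tri_eval_t tri_defs)
  then have "tri_a (tri_eval (sorted_monomial a)) = prod_list (map x (sorted_list_of_multiset a))"
    by (simp add: sorted_monomial_def)
  also have "\<dots> = (\<Prod>i\<in>#mset (sorted_list_of_multiset a). x i)"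
    by (simp only: prod_mset_prod_list[symmetric] mset_map)
  finally show ?thesis by simp
qed

lemma tri_eval_iterated_commutator:
  assumes "f \<in> commutator_ideal"
  shows "tri_b (tri_eval (iterated_commutator b f)) = (\<Prod>i\<in>#b. u i) * tri_b (tri_eval f)"
proof -
  have C: "foldr (\<lambda>i. commutator (t i)) l f \<in> commutator_ideal" for l
    by (induction l) (auto intro: assms commutator_ideal_rules)
  have "tri_b (tri_eval (foldr (\<lambda>i. commutator (t i)) l f)) = prod_list (map u l) * tri_b (tri_eval f)" for l
  proof (induction l)
    case (Cons i l)
    have "tri_b (tri_eval (commutator (t i) g)) = u i * tri_b (tri_eval g)" if "g \<in> commutator_ideal" for g
      using tri_eval_commutator_ideal[OF that]
      by (simp add: tri_eval_hom commutator_def tri_eval_t) (simp add: tri_defs algebra_simps)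
    then show ?case
      using Cons C by simp
  qed simp
  then have "tri_b (tri_eval (iterated_commutator b f)) =
      prod_list (map u (sorted_list_of_multiset b)) * tri_b (tri_eval f)"
    by (simp add: iterated_commutator_def)
  also have "prod_list (map u (sorted_list_of_multiset b)) = (\<Prod>i\<in>#mset (sorted_list_of_multiset b). u i)"
    by (simp only: prod_mset_prod_list[symmetric] mset_map)
  finally show ?thesis by simp
qed

lemma tri_eval_commutator_word:
  "tri_b (tri_eval (commutator_word (a, b, p, k))) =
    (\<Prod>i\<in>#a. x i) * (\<Prod>i\<in>#b. u i) * (u p * d k - u k * d p)"
proof -
  let ?e = "commutator (t p) (t k) :: 'k free_algebra"
  have e: "?e \<in> commutator_ideal"
    by (rule commutator_in_commutator_ideal)
  have "tri_b (tri_eval ?e) = u p * d k - u k * d p"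
    by (simp add: tri_eval_hom tri_eval_t commutator_def) (simp add: tri_defs algebra_simps)
  moreover have "tri_d (tri_eval (iterated_commutator b ?e)) = 0"
    by (intro tri_eval_commutator_ideal iterated_commutator_in_ideal[OF ideal_commutator_ideal] e)
  ultimately show ?thesis
    by (simp add: commutator_word_def tri_eval_hom times_tri_def tri_eval_sorted_monomial
        tri_eval_iterated_commutator[OF e] mult.assoc)
qed

lemma tri_eval_commutator_word2:
  "tri_e (tri_eval (commutator_word2 (a, b, p, k, q, l))) =
    (\<Prod>i\<in>#a. x i) * (\<Prod>i\<in>#b. u i) * (u p * d k - u k * d p) * (u l * e q - u q * e l)"
proof -
  let ?w = "commutator_word (a, b, p, k) :: 'k free_algebra"
  let ?e = "commutator (t q) (t l) :: 'k free_algebra"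
  have "tri_c (tri_eval ?e) = u l * e q - u q * e l"
    by (simp add: tri_eval_hom tri_eval_t commutator_def) (simp add: tri_defs algebra_simps)
  moreover have "tri_a (tri_eval ?w) = 0" "tri_a (tri_eval ?e) = 0"
    by (intro tri_eval_commutator_ideal commutator_word_in_commutator_ideal commutator_in_commutator_ideal)+
  ultimately show ?thesis
    by (simp add: commutator_word2_def tri_eval_hom times_tri_def tri_eval_commutator_word)
qed

end

section \<open>Detecting membership in \<open>I\<close> by triangular matrices\<close>

lemma lin_ext_monomial_value:
  fixes D :: "'i \<Rightarrow> (nat multiset \<times> nat multiset \<times> nat \<times> nat) \<Rightarrow>\<^sub>0 'k::field_char_0"
  assumes "Vector_Spaces.linear pm_scale (*) L"
    and "\<And>m. lin_ext (*) (monomial_value (x, u, d, e)) (D m) = L (\<phi> m)"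
    and "L (lin_ext pm_scale \<phi> z) = 0"
  shows "lin_ext (*) (monomial_value (x, u, d, e)) (lin_ext pm_scale D z) = 0"
proof -
  show ?thesis
    using assms(3) by (simp add: lin_ext_comp[OF vector_space_over_itself.linear_lin_ext] lin_ext_comp[OF assms(1)] assms(2))
qed

text \<open>The entries are used in turn: the diagonal puts \<open>f\<close> into C, then the (1,2)
  entry into C^2, then the corner into \<open>I\<close>. Each vanishes at all points, so the
  coordinates of a combination representing \<open>f\<close> vanish as polynomials.\<close>

lemma (in central_commutator_ideal) tri_identity_in_ideal:
  assumes zero: "\<And>x u d e. tri_eval x u d e f = 0"
    and I: "\<And>g x u d e. g \<in> I \<Longrightarrow> tri_eval x u d e g = 0"
  shows "f \<in> I"
proof -
  have f1: "f \<in> commutator_ideal"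
  proof -
    obtain z where z: "f - lin_ext pm_scale sorted_monomial z \<in> commutator_ideal"
      using spanning_free_algebra by blast
    \<comment> \<open>Monomials in x alone are given dummy indices 0 for d and e so that the same
      independence lemma applies; the factor \<open>d 0 * e 0\<close> in the functional matches
      them.\<close>
    define D where "D a = Poly_Mapping.single (a, {#} :: nat multiset, 0 :: nat, 0 :: nat) (1 :: 'k)"
      for a :: "nat multiset"
    have "lin_ext pm_scale D z = 0"
    proof (rule monomial_values_independent)
      fix x u d e :: "nat \<Rightarrow> 'k"
      show "lin_ext (*) (monomial_value (x, u, d, e)) (lin_ext pm_scale D z) = 0"
        by (rule lin_ext_monomial_value[where L = "\<lambda>f. d 0 * e 0 * tri_a (tri_eval x u d e f)" and
              \<phi> = sorted_monomial, OF linear_tri_functionals(1)])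
          (use tri_eval_commutator_ideal(1)[OF z, of x u d e] in
            \<open>simp_all add: D_def monomial_value_def tri_eval_sorted_monomial zero tri_eval_hom tri_defs\<close>)
    qed
    then have "lin_ext pm_scale (\<lambda>m. sorted_monomial (fst m) :: 'k free_algebra) (lin_ext pm_scale D z) = 0"
      by simp
    then have "lin_ext pm_scale sorted_monomial z = (0 :: 'k free_algebra)"
      by (simp add: lin_ext_comp[OF PM.linear_lin_ext] D_def)
    with z show ?thesis by simp
  qed
  have f2: "f \<in> commutator_ideal2"
  proof -
    obtain z where z: "f - lin_ext pm_scale commutator_word z \<in> commutator_ideal2"
      using in_span_lin_ext[OF subspace_commutator_ideal2] commutator_ideal_subset_span f1 by blast
    have "lin_ext pm_scale koszul z = 0"
    proof (rule monomial_values_independent)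
      fix x u d e :: "nat \<Rightarrow> 'k"
      show "lin_ext (*) (monomial_value (x, u, d, e)) (lin_ext pm_scale koszul z) = 0"
      proof (rule lin_ext_monomial_value[where L = "\<lambda>f. e 0 * tri_b (tri_eval x u d e f)" and
              \<phi> = commutator_word, OF linear_tri_functionals(2)])
        fix m :: "nat multiset \<times> nat multiset \<times> nat \<times> nat"
        show "lin_ext (*) (monomial_value (x, u, d, e)) (koszul m) =
            e 0 * tri_b (tri_eval x u d e (commutator_word m))"
          by (cases m) (simp add: koszul_def vector_space_over_itself.lin_ext_minus monomial_value_def
              tri_eval_commutator_word algebra_simps)
      qed (use tri_eval_commutator_ideal2[OF z, of x u d e] in \<open>simp add: zero tri_eval_hom tri_defs\<close>)
    qed
    then have "lin_ext pm_scale commutator_word z \<in> (commutator_ideal2 :: 'k free_algebra set)"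
      by (rule lin_ext_commutator_word)
    from commutator_ideal2_rules(2)[OF z this] show ?thesis by simp
  qed
  obtain z where z: "f - lin_ext pm_scale commutator_word2 z \<in> I"
    using in_span_lin_ext[of I] commutator_ideal2_subset_span f2 ideal
    unfolding two_sided_ideal_def by blast
  have "lin_ext pm_scale koszul2 z = 0"
  proof (rule monomial_values_independent)
    fix x u d e :: "nat \<Rightarrow> 'k"
    show "lin_ext (*) (monomial_value (x, u, d, e)) (lin_ext pm_scale koszul2 z) = 0"
    \<comment> \<open>The sign is that of ad \<open>t i\<close> on the (2,3) entry, where it acts as
      \<open>- u i\<close>, while \<open>koszul2\<close> uses u_q e_l - u_l e_q for the second
      factor.\<close>
    proof (rule lin_ext_monomial_value[where L = "\<lambda>f. - 1 * tri_e (tri_eval x u d e f)" and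
            \<phi> = commutator_word2, OF linear_tri_functionals(3)])
      fix m :: "nat multiset \<times> nat multiset \<times> nat \<times> nat \<times> nat \<times> nat"
      show "lin_ext (*) (monomial_value (x, u, d, e)) (koszul2 m) =
          - 1 * tri_e (tri_eval x u d e (commutator_word2 m))"
        by (cases m) (simp add: koszul2_def vector_space_over_itself.lin_ext_minus
            vector_space_over_itself.lin_ext_add monomial_value_def tri_eval_commutator_word2
            algebra_simps)
    qed (use I[OF z, of x u d e] in \<open>simp add: zero tri_eval_hom tri_defs\<close>)
  qed
  then have "lin_ext pm_scale commutator_word2 z \<in> I"
    by (rule lin_ext_commutator_word2)
  from I_rules(2)[OF z this] show ?thesis by simp
qed

section \<open>Parity in Grassmann algebras\<close>

definition geven :: "('v::{finite, linorder}, 'r::comm_ring_1) grassmann \<Rightarrow> bool"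
  where "geven f \<longleftrightarrow> (\<forall>S. odd (card S) \<longrightarrow> gcoeff f S = 0)"

definition godd :: "('v::{finite, linorder}, 'r::comm_ring_1) grassmann \<Rightarrow> bool"
  where "godd f \<longleftrightarrow> (\<forall>S. even (card S) \<longrightarrow> gcoeff f S = 0)"

lemma grassmann_eqI: "(\<And>S. gcoeff f S = gcoeff g S) \<Longrightarrow> f = g"
  by (simp add: gcoeff_inject[symmetric] fun_eq_iff)

lemma card_split: "A \<subseteq> S \<Longrightarrow> card S = card A + card (S - A)" for S :: "'v::finite set"
  by (metis add_diff_inverse_nat card_Diff_subset card_mono finite_class.finite not_less)

lemma geven_add: "geven f \<Longrightarrow> geven g \<Longrightarrow> geven (f + g)"
  and geven_diff: "geven f \<Longrightarrow> geven g \<Longrightarrow> geven (f - g)"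
  and geven_neg: "geven f \<Longrightarrow> geven (- f)"
  and godd_add: "godd f \<Longrightarrow> godd g \<Longrightarrow> godd (f + g)"
  and godd_neg: "godd f \<Longrightarrow> godd (- f)"
  and geven_zero: "geven 0"
  and godd_zero: "godd 0"
  and geven_one: "geven 1"
  by (auto simp: geven_def godd_def plus_grassmann.rep_eq minus_grassmann.rep_eq uminus_grassmann.rep_eq
      zero_grassmann.rep_eq one_grassmann.rep_eq)

lemma geven_gconst: "geven (gconst r)"
  by (auto simp: geven_def gconst.rep_eq)

lemma godd_ggen: "godd (ggen v)"
  by (auto simp: godd_def ggen.rep_eq)

lemma parity_mult:
  shows "geven f \<Longrightarrow> geven g \<Longrightarrow> geven (f * g)"
    and "godd f \<Longrightarrow> godd g \<Longrightarrow> geven (f * g)"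
    and "geven f \<Longrightarrow> godd g \<Longrightarrow> godd (f * g)"
    and "godd f \<Longrightarrow> geven g \<Longrightarrow> godd (f * g)"
  unfolding geven_def godd_def times_grassmann.rep_eq
  by (intro allI impI sum.neutral ballI; (use card_split in \<open>auto simp: dest!: card_split\<close>; fail))+

text \<open>For disjoint sets, each pair in \<open>A \<times> B\<close> is out of order in exactly
  one of the two arrangements.\<close>

lemma inversions_swap:
  assumes "A \<inter> B = {}"
  shows "inversions A B + inversions B A = card A * card (B :: 'v::{finite, linorder} set)"
proof -
  have "A \<times> B = {(s, u). s \<in> A \<and> u \<in> B \<and> u < s} \<union> prod.swap ` {(s, u). s \<in> B \<and> u \<in> A \<and> u < s}"
    using assms by (auto simp: image_iff disjoint_iff) (metis not_less_iff_gr_or_eq)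
  then have "card A * card B =
      card ({(s, u). s \<in> A \<and> u \<in> B \<and> u < s} \<union> prod.swap ` {(s, u). s \<in> B \<and> u \<in> A \<and> u < s})"
    by (metis card_cartesian_product)
  also have "\<dots> = inversions A B + card (prod.swap ` {(s, u). s \<in> B \<and> u \<in> A \<and> u < s})"
    unfolding inversions_def by (intro card_Un_disjoint) auto
  also have "card (prod.swap ` {(s, u). s \<in> B \<and> u \<in> A \<and> u < s}) = inversions B A"
    unfolding inversions_def by (rule card_image) (auto simp: inj_on_def)
  finally show ?thesis by simp
qed

lemma gsign_swap:
  fixes A B :: "'v::{finite, linorder} set"
  assumes "A \<inter> B = {}"
  shows "gsign A B = (- 1) ^ (card A * card B) * (gsign B A :: 'r::comm_ring_1)"
  unfolding gsign_def inversions_swap[OF assms, symmetric]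
  by (simp add: power_add mult.assoc flip: power_mult_distrib)

lemma gcoeff_times_swap:
  "gcoeff (g * f) S = (\<Sum>A\<in>Pow S. (- 1) ^ (card A * card (S - A)) * gsign A (S - A) * gcoeff f A * gcoeff g (S - A))"
proof -
  have "gcoeff (g * f) S = (\<Sum>A\<in>Pow S. gsign (S - A) A * gcoeff g (S - A) * gcoeff f A)"
    unfolding times_grassmann.rep_eq
    by (rule sum.reindex_bij_witness[where i = "\<lambda>A. S - A" and j = "\<lambda>A. S - A"])
      (auto simp: double_diff)
  also have "\<dots> = (\<Sum>A\<in>Pow S. (- 1) ^ (card A * card (S - A)) * gsign A (S - A) * gcoeff f A * gcoeff g (S - A))"
    by (intro sum.cong refl) (simp add: gsign_swap[of "S - _"] mult_ac Int_commute)
  finally show ?thesis .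
qed

lemma geven_central:
  assumes "geven f"
  shows "f * g = g * f"
proof (rule grassmann_eqI)
  fix S
  have "gsign A (S - A) * gcoeff f A * gcoeff g (S - A) =
    (- 1) ^ (card A * card (S - A)) * gsign A (S - A) * gcoeff f A * gcoeff g (S - A)" for A
    using assms by (cases "even (card A)") (simp_all add: geven_def)
  then show "gcoeff (f * g) S = gcoeff (g * f) S"
    unfolding gcoeff_times_swap[of g f] by (simp add: times_grassmann.rep_eq)
qed

lemma godd_anticommute:
  assumes "godd f" "godd g"
  shows "f * g = - (g * f)"
proof (rule grassmann_eqI)
  fix S
  have "gsign A (S - A) * gcoeff f A * gcoeff g (S - A) =
    - ((- 1) ^ (card A * card (S - A)) * gsign A (S - A) * gcoeff f A * gcoeff g (S - A))" for A
    using assms by (cases "even (card A) \<or> even (card (S - A))") (auto simp: godd_def)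
  then show "gcoeff (f * g) S = gcoeff (- (g * f)) S"
    unfolding uminus_grassmann.rep_eq gcoeff_times_swap[of g f]
    by (simp add: times_grassmann.rep_eq sum_negf)
qed

lemma godd_square_zero:
  fixes f :: "('v::{finite, linorder}, 'r::{idom, ring_char_0}) grassmann"
  assumes "godd f"
  shows "f * f = 0"
proof (rule grassmann_eqI)
  fix S
  have "gcoeff (f * f) S = gcoeff (- (f * f)) S"
    by (metis assms godd_anticommute)
  then have "2 * gcoeff (f * f) S = 0"
    by (simp add: uminus_grassmann.rep_eq)
  then show "gcoeff (f * f) S = gcoeff 0 S"
    by (simp add: zero_grassmann.rep_eq)
qed

section \<open>Two by two matrices\<close>

definition mat2 :: "'a \<Rightarrow> 'a \<Rightarrow> 'a \<Rightarrow> 'a \<Rightarrow> ('a::ring_1, 2) sqmat"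
  where "mat2 a b c d = to_sqmat (vector [vector [a, b], vector [c, d]])"

lemma of_sqmat_mat2 [simp]:
  "of_sqmat (mat2 a b c d) $ 1 $ 1 = a" "of_sqmat (mat2 a b c d) $ 1 $ 2 = b"
  "of_sqmat (mat2 a b c d) $ 2 $ 1 = c" "of_sqmat (mat2 a b c d) $ 2 $ 2 = d"
  by (simp_all add: mat2_def to_sqmat_inverse)

lemma sqmat2_eq_iff:
  "M = N \<longleftrightarrow> of_sqmat M $ 1 $ 1 = of_sqmat N $ 1 $ 1 \<and> of_sqmat M $ 1 $ 2 = of_sqmat N $ 1 $ 2 \<and>
    of_sqmat M $ 2 $ 1 = of_sqmat N $ 2 $ 1 \<and> of_sqmat M $ 2 $ 2 = of_sqmat N $ 2 $ (2 :: 2)"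
  by (auto simp: of_sqmat_inject[symmetric] vec_eq_iff forall_2)

lemma mat2_arith:
  "mat2 a b c d + mat2 a' b' c' d' = mat2 (a + a') (b + b') (c + c') (d + d')"
  "mat2 a b c d - mat2 a' b' c' d' = mat2 (a - a') (b - b') (c - c') (d - d')"
  "mat2 a b c d * mat2 a' b' c' d' = mat2 (a * a' + b * c') (a * b' + b * d') (c * a' + d * c') (c * b' + d * d')"
  "mat2 1 0 0 1 = 1" "mat2 0 0 0 0 = 0"
  by (simp_all add: sqmat2_eq_iff plus_sqmat.rep_eq minus_sqmat.rep_eq times_sqmat.rep_eq
      one_sqmat.rep_eq zero_sqmat.rep_eq matrix_matrix_mult_def sum_2 mat_def)

lemma mat2_inject: "mat2 a b c d = mat2 a' b' c' d' \<longleftrightarrow> a = a' \<and> b = b' \<and> c = c' \<and> d = d'"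
  by (simp add: sqmat2_eq_iff)

lemma mat2_exhaust: obtains a b c d where "M = mat2 a b c d"
proof -
  have "M = mat2 (of_sqmat M $ 1 $ 1) (of_sqmat M $ 1 $ 2) (of_sqmat M $ 2 $ 1) (of_sqmat M $ 2 $ 2)"
    by (simp add: sqmat2_eq_iff)
  then show ?thesis using that by blast
qed

lemma mat_scale_mat2:
  "mat_scale r (mat2 a b c d) = mat2 (super_scale r a) (super_scale r b) (super_scale r c) (super_scale r d)"
  by (simp add: sqmat2_eq_iff)

section \<open>Matrices with two odd directions\<close>

text \<open>Over two odd elements \<open>\<eta>\<close>, \<open>\<eta>'\<close> every product of three off-diagonal entries vanishes.\<close>

locale odd_directions =
  fixes \<eta> \<eta>' :: "('v::{finite, linorder}, 'r::{idom, ring_char_0}) grassmann"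
  assumes odd: "godd \<eta>" "godd \<eta>'"
begin

definition hmat where "hmat a b c d = mat2 a (b * \<eta>) (c * \<eta>') d"

definition odd_matrices :: "(('v, 'r) grassmann, 2) sqmat set"
  where "odd_matrices = {hmat a b c d | a b c d. geven a \<and> geven b \<and> geven c \<and> geven d}"

definition \<epsilon> where "\<epsilon> = \<eta> * \<eta>'"

lemma eta_rules:
  "\<eta> * \<eta> = 0" "\<eta>' * \<eta>' = 0" "\<eta> * \<eta>' = \<epsilon>" "\<eta>' * \<eta> = - \<epsilon>"
  "\<epsilon> * \<eta> = 0" "\<epsilon> * \<eta>' = 0" "\<eta> * \<epsilon> = 0" "\<eta>' * \<epsilon> = 0" "\<epsilon> * \<epsilon> = 0"
proof -
  show 1: "\<eta> * \<eta> = 0" "\<eta>' * \<eta>' = 0"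
    using odd by (simp_all add: godd_square_zero)
  show 2: "\<eta> * \<eta>' = \<epsilon>" "\<eta>' * \<eta> = - \<epsilon>"
    using odd godd_anticommute[of \<eta>' \<eta>] by (simp_all add: \<epsilon>_def)
  have "\<eta> * (\<eta> * \<eta>') = (\<eta> * \<eta>) * \<eta>'" "(\<eta> * \<eta>') * \<eta>' = \<eta> * (\<eta>' * \<eta>')"
    by (simp_all only: mult.assoc)
  then show 3: "\<eta> * \<epsilon> = 0" "\<epsilon> * \<eta>' = 0"
    by (simp_all only: \<epsilon>_def 1 mult_zero_left mult_zero_right)
  have "(\<eta> * \<eta>') * \<eta> = \<eta> * (\<eta>' * \<eta>)" "\<eta>' * (\<eta> * \<eta>') = (\<eta>' * \<eta>) * \<eta>'"
    by (simp_all only: mult.assoc)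
  then show "\<epsilon> * \<eta> = 0" "\<eta>' * \<epsilon> = 0"
    by (simp_all add: 2 3)
  have "\<epsilon> * (\<eta> * \<eta>') = (\<epsilon> * \<eta>) * \<eta>'"
    by (simp only: mult.assoc)
  then show "\<epsilon> * \<epsilon> = 0"
    using \<open>\<epsilon> * \<eta> = 0\<close> by (simp add: 2)
qed

lemma geven_epsilon: "geven \<epsilon>"
  unfolding \<epsilon>_def using odd by (rule parity_mult)

lemmas even_intros = geven_add geven_diff geven_neg geven_zero geven_one parity_mult(1) geven_epsilon

lemma even_left:
  assumes "geven x"
  shows "\<eta> * x = x * \<eta>" "\<eta> * (x * y) = x * (\<eta> * y)" "\<eta>' * x = x * \<eta>'" "\<eta>' * (x * y) = x * (\<eta>' * y)"
    "\<epsilon> * x = x * \<epsilon>" "\<epsilon> * (x * y) = x * (\<epsilon> * y)"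
  by (metis geven_central[OF assms] mult.assoc)+

lemma even_commute:
  assumes "geven x"
  shows "x * y = y * x" "x * (y * z) = y * (x * z)" "y * (x * z) = x * (y * z)"
  by (metis geven_central[OF assms] mult.assoc)+

lemma hmat_arith:
  "hmat a b c d + hmat a' b' c' d' = hmat (a + a') (b + b') (c + c') (d + d')"
  "hmat a b c d - hmat a' b' c' d' = hmat (a - a') (b - b') (c - c') (d - d')"
  "hmat 0 0 0 0 = 0"
  by (simp_all add: hmat_def mat2_arith algebra_simps)

lemma hmat_mult:
  assumes "geven a" "geven b" "geven c" "geven d" "geven a'" "geven b'" "geven c'" "geven d'"
  shows "hmat a b c d * hmat a' b' c' d' =
    hmat (a * a' + b * c' * \<epsilon>) (a * b' + b * d') (c * a' + d * c') (d * d' - c * b' * \<epsilon>)"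
  unfolding hmat_def mat2_arith mat2_inject
  by (simp add: assms distrib_right mult.assoc even_left eta_rules)

lemma hmat_commutator:
  assumes "geven a" "geven b" "geven c" "geven d" "geven a'" "geven b'" "geven c'" "geven d'"
  shows "commutator (hmat a b c d) (hmat a' b' c' d') =
    hmat ((b * c' - b' * c) * \<epsilon>) ((a - d) * b' - (a' - d') * b)
      ((a' - d') * c - (a - d) * c') ((b * c' - b' * c) * \<epsilon>)"
proof -
  have "a' * a = a * a'" "d' * d = d * d'" "b * d' = d' * b" "b' * d = d * b'" "c * a' = a' * c"
    "c' * a = a * c'" "c * b' = b' * c" "c' * b = b * c'"
    using assms by (simp_all only: geven_central)
  then show ?thesis
    unfolding commutator_def using assms
    by (simp add: hmat_mult hmat_arith) (simp add: algebra_simps)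
qed

text \<open>The diagonal entries coincide because the supertrace of a commutator of even
  supermatrices is zero.\<close>

definition commutators :: "(('v, 'r) grassmann, 2) sqmat set"
  where "commutators = {hmat (k * \<epsilon>) b c (k * \<epsilon>) | k b c. geven k \<and> geven b \<and> geven c}"

lemma commutator_in_commutators:
  assumes "M \<in> odd_matrices" "N \<in> odd_matrices"
  shows "commutator M N \<in> commutators"
proof -
  obtain a b c d a' b' c' d' where eq: "M = hmat a b c d" "N = hmat a' b' c' d'"
    and e: "geven a" "geven b" "geven c" "geven d" "geven a'" "geven b'" "geven c'" "geven d'"
    using assms by (auto simp: odd_matrices_def)
  show ?thesis
    unfolding commutators_def eq hmat_commutator[OF e] using e by (blast intro: even_intros)
qed

text \<open>\<open>\<epsilon>\<close> annihilates \<open>\<eta>\<close>, \<open>\<eta>'\<close> and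
  itself, so only products of off-diagonal entries survive, on the diagonal and as multiples of
  \<open>\<epsilon>\<close>. The same annihilation then kills triple products and makes double
  products central.\<close>

lemma commutators_mult:
  assumes "geven k" "geven b" "geven c" "geven k'" "geven b'" "geven c'"
  shows "hmat (k * \<epsilon>) b c (k * \<epsilon>) * hmat (k' * \<epsilon>) b' c' (k' * \<epsilon>) =
    hmat (b * c' * \<epsilon>) 0 0 (- (c * b' * \<epsilon>))"
  unfolding hmat_mult[OF parity_mult(1)[OF assms(1) geven_epsilon] assms(2,3)
      parity_mult(1)[OF assms(1) geven_epsilon] parity_mult(1)[OF assms(4) geven_epsilon] assms(5,6)
      parity_mult(1)[OF assms(4) geven_epsilon]]
  by (simp add: hmat_def mat2_inject assms distrib_right mult.assoc even_left eta_rules)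

lemma commutators_triple:
  assumes "L \<in> commutators" "M \<in> commutators" "N \<in> commutators"
  shows "L * M * N = 0"
proof -
  obtain k b c k' b' c' k'' b'' c'' where
    eq: "L = hmat (k * \<epsilon>) b c (k * \<epsilon>)" "M = hmat (k' * \<epsilon>) b' c' (k' * \<epsilon>)"
      "N = hmat (k'' * \<epsilon>) b'' c'' (k'' * \<epsilon>)"
    and e: "geven k" "geven b" "geven c" "geven k'" "geven b'" "geven c'" "geven k''" "geven b''" "geven c''"
    using assms by (auto simp: commutators_def)
  show ?thesis
    unfolding eq commutators_mult[OF e(1-6)] hmat_def mat2_arith(3) mat2_arith(5)[symmetric] mat2_inject
    by (simp add: e mult.assoc even_left eta_rules)
qed

lemma commutators_central:
  assumes "L \<in> commutators" "M \<in> commutators" "N \<in> odd_matrices"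
  shows "commutator (L * M) N = 0"
proof -
  obtain k b c k' b' c' a'' b'' c'' d'' where
    eq: "L = hmat (k * \<epsilon>) b c (k * \<epsilon>)" "M = hmat (k' * \<epsilon>) b' c' (k' * \<epsilon>)" "N = hmat a'' b'' c'' d''"
    and e: "geven k" "geven b" "geven c" "geven k'" "geven b'" "geven c'" "geven a''" "geven b''" "geven c''"
      "geven d''"
    using assms by (auto simp: commutators_def odd_matrices_def)
  have "x * a'' = a'' * x" "x * d'' = d'' * x" for x
    using e geven_central by metis+
  then show ?thesis
    unfolding eq commutators_mult[OF e(1-6)] commutator_def hmat_def mat2_arith(2,3)
      mat2_arith(5)[symmetric] mat2_inject
    by (simp add: e mult.assoc even_left eta_rules)
qed

lemma standard_identity:
  assumes "A \<in> odd_matrices" "B \<in> odd_matrices" "C \<in> odd_matrices" "D \<in> odd_matrices"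
  shows "commutator A B * commutator C D + commutator C D * commutator A B
    - commutator A C * commutator B D - commutator B D * commutator A C
    + commutator A D * commutator B C + commutator B C * commutator A D = 0"
proof -
  obtain a1 b1 c1 d1 a2 b2 c2 d2 a3 b3 c3 d3 a4 b4 c4 d4 where
    eq: "A = hmat a1 b1 c1 d1" "B = hmat a2 b2 c2 d2" "C = hmat a3 b3 c3 d3" "D = hmat a4 b4 c4 d4"
    and e: "geven a1" "geven b1" "geven c1" "geven d1" "geven a2" "geven b2" "geven c2" "geven d2"
      "geven a3" "geven b3" "geven c3" "geven d3" "geven a4" "geven b4" "geven c4" "geven d4"
    using assms unfolding odd_matrices_def by blast
  have prod: "commutator (hmat a b c d) (hmat a' b' c' d') * commutator (hmat p q r s) (hmat p' q' r' s') =
    hmat (((a - d) * b' - (a' - d') * b) * ((p' - s') * r - (p - s) * r') * \<epsilon>) 0 0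
      (- (((a' - d') * c - (a - d) * c') * ((p - s) * q' - (p' - s') * q) * \<epsilon>))"
    if "geven a" "geven b" "geven c" "geven d" "geven a'" "geven b'" "geven c'" "geven d'"
      "geven p" "geven q" "geven r" "geven s" "geven p'" "geven q'" "geven r'" "geven s'"
    for a b c d a' b' c' d' p q r s p' q' r' s'
    unfolding hmat_commutator[OF that(1-8)] hmat_commutator[OF that(9-16)]
    by (intro commutators_mult even_intros that)
  define u1 u2 u3 u4 where u: "u1 = a1 - d1" "u2 = a2 - d2" "u3 = a3 - d3" "u4 = a4 - d4"
  have eu: "geven u1" "geven u2" "geven u3" "geven u4"
    unfolding u by (intro geven_diff e)+
  \<comment> \<open>Up to sign this is the Laplace expansion, by pairs of rows, of a 4 by 4
    determinant with rows u, b, u, c, which vanishes because u is repeated. It is used a second time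
    with b and c exchanged, for the lower diagonal entry.\<close>
  have "(u1 * b2 - u2 * b1) * (u4 * c3 - u3 * c4) + (u3 * b4 - u4 * b3) * (u2 * c1 - u1 * c2)
      - (u1 * b3 - u3 * b1) * (u4 * c2 - u2 * c4) - (u2 * b4 - u4 * b2) * (u3 * c1 - u1 * c3)
      + (u1 * b4 - u4 * b1) * (u3 * c2 - u2 * c3) + (u2 * b3 - u3 * b2) * (u4 * c1 - u1 * c4) = 0"
    if "geven b1" "geven b2" "geven b3" "geven b4" "geven c1" "geven c2" "geven c3" "geven c4"
    for b1 b2 b3 b4 c1 c2 c3 c4
    using eu that by (simp add: left_diff_distrib right_diff_distrib mult.assoc even_commute)
  note id = this[OF e(2) e(6) e(10) e(14) e(3) e(7) e(11) e(15)]
    this[OF e(3) e(7) e(11) e(15) e(2) e(6) e(10) e(14)]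
  have sum: "hmat (x1 * \<epsilon>) 0 0 (- (y1 * \<epsilon>)) + hmat (x2 * \<epsilon>) 0 0 (- (y2 * \<epsilon>))
    - hmat (x3 * \<epsilon>) 0 0 (- (y3 * \<epsilon>)) - hmat (x4 * \<epsilon>) 0 0 (- (y4 * \<epsilon>))
    + hmat (x5 * \<epsilon>) 0 0 (- (y5 * \<epsilon>)) + hmat (x6 * \<epsilon>) 0 0 (- (y6 * \<epsilon>)) = 0"
    if "x1 + x2 - x3 - x4 + x5 + x6 = 0" "y1 + y2 - y3 - y4 + y5 + y6 = 0"
    for x1 x2 x3 x4 x5 x6 y1 y2 y3 y4 y5 y6
  proof -
    have "(x1 + x2 - x3 - x4 + x5 + x6) * \<epsilon> = 0" "- ((y1 + y2 - y3 - y4 + y5 + y6) * \<epsilon>) = 0"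
      unfolding that by simp_all
    then have "x1 * \<epsilon> + x2 * \<epsilon> - x3 * \<epsilon> - x4 * \<epsilon> + x5 * \<epsilon> + x6 * \<epsilon> = 0"
      "- (y1 * \<epsilon>) + - (y2 * \<epsilon>) - - (y3 * \<epsilon>) - - (y4 * \<epsilon>) + - (y5 * \<epsilon>) + - (y6 * \<epsilon>) = 0"
      by (simp_all add: algebra_simps)
    then show ?thesis
      by (simp only: hmat_arith diff_self add_0_right)
  qed
  show ?thesis
    unfolding eq
    by (simp only: prod e flip: u, rule sum, rule id(1))
      (use id(2) in \<open>simp add: algebra_simps\<close>)
qed

end

text \<open>A noncommutative Laplace expansion: permutations are grouped by the pair of indices in
  the first two positions, and each group is a product of two commutators.\<close>

lemma standard_polynomial_expand:
  fixes f :: "nat \<Rightarrow> 'b::ring_1"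
  shows "(\<Sum>\<sigma> | \<sigma> permutes {1..4}. of_int (sign \<sigma>) * (f (\<sigma> 1) * f (\<sigma> 2) * f (\<sigma> 3) * f (\<sigma> 4))) =
    commutator (f 1) (f 2) * commutator (f 3) (f 4) + commutator (f 3) (f 4) * commutator (f 1) (f 2)
    - commutator (f 1) (f 3) * commutator (f 2) (f 4) - commutator (f 2) (f 4) * commutator (f 1) (f 3)
    + commutator (f 1) (f 4) * commutator (f 2) (f 3) + commutator (f 2) (f 3) * commutator (f 1) (f 4)"
proof -
  have S: "{1..4} = {1, 2, 3, 4 :: nat}" by auto
  have n: "finite {2, 3, 4 :: nat}" "1 \<notin> {2, 3, 4 :: nat}" "finite {3, 4 :: nat}" "2 \<notin> {3, 4 :: nat}"
    "finite {4 :: nat}" "3 \<notin> {4 :: nat}" by auto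
  show ?thesis
    unfolding S sum_over_permutations_insert[OF n(1,2)] sum_over_permutations_insert[OF n(3,4)]
      sum_over_permutations_insert[OF n(5,6)] permutes_sing
    by (simp add: sign_swap_id permutation_swap_id sign_compose sign_id permutation_compose transpose_def
      commutator_def algebra_simps)
qed

section \<open>Identities of the generic algebra\<close>

text \<open>An arbitrary order on the variables makes the exponents an ordered monoid, which
  provides that the polynomial ring has no zero divisors.\<close>

instantiation even_var :: linorder
begin

fun even_rank :: "even_var \<Rightarrow> nat" where
  "even_rank X1 = 0"
| "even_rank X2 = 1"
| "even_rank X1' = 2"
| "even_rank X2' = 3"

definition less_eq_even_var :: "even_var \<Rightarrow> even_var \<Rightarrow> bool"
  where "v \<le> w \<longleftrightarrow> even_rank v \<le> even_rank w"

definition less_even_var :: "even_var \<Rightarrow> even_var \<Rightarrow> bool"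
  where "v < w \<longleftrightarrow> even_rank v < even_rank w"

instance
proof
  fix v w :: even_var
  show "v \<le> w \<Longrightarrow> w \<le> v \<Longrightarrow> v = w"
    by (cases v; cases w) (simp_all add: less_eq_even_var_def)
qed (auto simp: less_eq_even_var_def less_even_var_def)

end

lemma gconst_times_eq_0D:
  fixes f :: "('v::{finite, linorder}, 'r::idom) grassmann"
  assumes "gconst r * f = 0" "r \<noteq> 0"
  shows "f = 0"
proof (rule grassmann_eqI)
  fix S
  have "r * gcoeff f S = 0"
    using arg_cong[OF assms(1), of "\<lambda>g. gcoeff g S"] by (simp add: gcoeff_gconst_times zero_grassmann.rep_eq)
  then show "gcoeff f S = gcoeff 0 S"
    using assms(2) by (simp add: zero_grassmann.rep_eq)
qed

section \<open>Diagonalising \<open>C1\<close> with cleared denominators\<close>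

definition gap :: "'k::field_char_0 super_poly"
  where "gap = even_gen X1 - even_gen X1'"

lemma geven_even_gen: "geven (even_gen x)"
  by (simp add: even_gen_def geven_gconst)

lemma godd_odd_gen: "godd (odd_gen y)"
  by (simp add: odd_gen_def godd_ggen)

lemma geven_gap: "geven gap"
  by (simp add: gap_def geven_diff geven_even_gen)

lemma gap_times_eq_0D:
  fixes f :: "'k::field_char_0 super_poly"
  assumes "gap * f = 0"
  shows "f = 0"
proof -
  let ?r = "Poly_Mapping.single (Poly_Mapping.single X1 (1 :: nat)) 1 -
    Poly_Mapping.single (Poly_Mapping.single X1' 1) (1 :: 'k)"
  have "gap = gconst ?r"
    by (rule grassmann_eqI) (simp add: gap_def even_gen_def minus_grassmann.rep_eq gconst.rep_eq)
  moreover have "Poly_Mapping.single X1 (1 :: nat) \<noteq> Poly_Mapping.single X1' 1"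
    by (metis even_var.distinct(3) lookup_single_eq lookup_single_not_eq zero_neq_one)
  then have "Poly_Mapping.lookup ?r (Poly_Mapping.single X1 1) = 1"
    by (simp add: lookup_minus lookup_single when_def)
  then have "?r \<noteq> 0"
    by (metis lookup_zero zero_neq_one)
  ultimately show ?thesis
    using assms gconst_times_eq_0D by metis
qed

lemma gap_power_times_eq_0D:
  fixes f :: "'k::field_char_0 super_poly"
  assumes "gap ^ n * f = 0"
  shows "f = 0"
  using assms by (induction n) (auto simp: mult.assoc dest: gap_times_eq_0D)

definition even_matrices :: "('k::field_char_0 super_poly, 2) sqmat set"
  where "even_matrices = {mat2 a b c d | a b c d. geven a \<and> godd b \<and> godd c \<and> geven d}"

lemma even_matrices_mult:
  assumes "M \<in> even_matrices" "N \<in> even_matrices"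
  shows "M * N \<in> even_matrices"
  using assms unfolding even_matrices_def
  by (auto simp: mat2_arith mat2_inject intro!: geven_add godd_add intro: parity_mult)

lemma C_eq_mat2:
  "C1 = mat2 (even_gen X1) (odd_gen Y1) (odd_gen Y1') (even_gen X1')"
  "C2 = mat2 (even_gen X2) (odd_gen Y2) (odd_gen Y2') (even_gen X2')"
  by (simp_all add: C1_def C2_def mat2_def)

text \<open>
  Conjugation by \<open>gauge\<close>, which is invertible once \<open>gap\<close> is inverted, diagonalises \<open>C1\<close>.  As
  \<open>gap\<close> is not a zero divisor, denominators can be cleared instead of localising.
\<close>

definition gauge :: "('k::field_char_0 super_poly, 2) sqmat"
  where "gauge = mat2 gap (odd_gen Y1) (- odd_gen Y1') gap"

text \<open>\<open>gauge\<close> times the first factor is diagonal with entries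
  \<open>gap * gap\<close> plus and minus \<open>odd_gen Y1 * odd_gen Y1'\<close>. The second factor
  carries the opposite signs, and since that odd product squares to zero only gap^4 remains.\<close>

definition gauge_inv :: "('k::field_char_0 super_poly, 2) sqmat"
  where "gauge_inv = mat2 gap (- odd_gen Y1) (odd_gen Y1') gap *
    mat2 (gap * gap - odd_gen Y1 * odd_gen Y1') 0 0 (gap * gap + odd_gen Y1 * odd_gen Y1')"

definition gap_matrix :: "('k::field_char_0 super_poly, 2) sqmat"
  where "gap_matrix = mat2 gap 0 0 gap"

lemma gap_matrix_power: "gap_matrix ^ n = mat2 (gap ^ n) 0 0 (gap ^ n)"
  by (induction n) (simp_all add: gap_matrix_def mat2_arith)

lemma gap_matrix_central: "gap_matrix ^ n * M = M * gap_matrix ^ n"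
proof -
  have "gap_matrix * M = M * gap_matrix" for M
    by (rule mat2_exhaust[of M]) (simp add: gap_matrix_def mat2_arith mat2_inject geven_central[OF geven_gap])
  then show ?thesis
    by (rule power_commuting_commutes)
qed

lemma gap_matrix_power_times_eq_0D:
  assumes "gap_matrix ^ n * M = 0"
  shows "M = 0"
proof -
  obtain a b c d where M: "M = mat2 a b c d"
    by (rule mat2_exhaust)
  with assms show ?thesis
    by (auto simp: gap_matrix_power mat2_arith sqmat2_eq_iff zero_sqmat.rep_eq dest: gap_power_times_eq_0D)
qed

lemma odd_gen_rules:
  "odd_gen v * odd_gen v = 0" "odd_gen v * (odd_gen v * f) = 0"
  "odd_gen Y1' * odd_gen Y1 = - (odd_gen Y1 * odd_gen Y1')"
  "odd_gen Y1' * (odd_gen Y1 * f) = - (odd_gen Y1 * (odd_gen Y1' * f))"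
  by (simp_all add: odd_gen_def ggen_square_zero ggen_anticommute[of Y1' Y1] flip: mult.assoc)

lemma even_gen_rules:
  assumes "geven x"
  shows "odd_gen v * x = x * odd_gen v" "odd_gen v * (x * f) = x * (odd_gen v * f)"
  by (metis geven_central[OF assms] mult.assoc)+

lemma gauge_inv: "gauge_inv * gauge = gap_matrix ^ 4"
  unfolding gauge_inv_def gauge_def gap_matrix_power mat2_arith mat2_inject
  by (simp add: geven_gap algebra_simps odd_gen_rules even_gen_rules numeral_eq_Suc)

text \<open>After localisation the diagonal form of \<open>C1\<close> has entries x_1 + y_1 y_1'/gap
  and x_1' + y_1 y_1'/gap; one factor \<open>gap\<close> clears both denominators.\<close>

lemma gauge_C1:
  "gap_matrix * (gauge * C1) =
    mat2 (gap * even_gen X1 + odd_gen Y1 * odd_gen Y1') 0 0 (gap * even_gen X1' + odd_gen Y1 * odd_gen Y1') * gauge"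
proof -
  have x: "even_gen X1 = gap + even_gen X1'"
    by (simp add: gap_def)
  have c: "even_gen X1' * gap = gap * even_gen X1'"
    by (rule geven_central) (rule geven_even_gen)
  show ?thesis
    unfolding C_eq_mat2 gauge_def gap_matrix_def mat2_arith mat2_inject x
    by (simp add: geven_gap geven_even_gen algebra_simps odd_gen_rules even_gen_rules c)
qed

section \<open>Transfer of identities along the conjugation\<close>

context odd_directions
begin

lemma odd_matrices_closed:
  assumes "M \<in> odd_matrices" "N \<in> odd_matrices"
  shows "M + N \<in> odd_matrices" "M * N \<in> odd_matrices"
proof -
  obtain a b c d a' b' c' d' where eq: "M = hmat a b c d" "N = hmat a' b' c' d'"
    and e: "geven a" "geven b" "geven c" "geven d" "geven a'" "geven b'" "geven c'" "geven d'"
    using assms unfolding odd_matrices_def by blast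
  show "M + N \<in> odd_matrices" "M * N \<in> odd_matrices"
    unfolding odd_matrices_def eq hmat_mult[OF e] hmat_arith using e by (blast intro: even_intros)+
qed

end

text \<open>Expresses that conjugating \<open>M\<close> by \<open>gauge\<close> gives
  \<open>N\<close> divided by gap^n. The exponent adds up in products, and terms of a sum must first
  be raised to a common exponent.\<close>

definition conjugate ::
  "nat \<Rightarrow> ('k::field_char_0 super_poly, 2) sqmat \<Rightarrow> ('k super_poly, 2) sqmat \<Rightarrow> bool"
  where "conjugate n M N \<longleftrightarrow> gap_matrix ^ n * (gauge * M) = N * gauge"

lemma conjugate_arith:
  assumes "conjugate n M N" "conjugate n M' N'"
  shows "conjugate n (M + M') (N + N')" "conjugate n (M - M') (N - N')"
  using assms by (simp_all add: conjugate_def distrib_left distrib_right right_diff_distrib left_diff_distrib)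

lemma conjugate_mult:
  assumes "conjugate m M N" "conjugate n M' N'"
  shows "conjugate (m + n) (M * M') (N * N')"
proof -
  have "gap_matrix ^ (m + n) * (gauge * (M * M')) = gap_matrix ^ n * (gap_matrix ^ m * (gauge * M)) * M'"
    by (simp add: power_add mult.assoc gap_matrix_central[of m "gap_matrix ^ n"])
  also have "\<dots> = N * (gap_matrix ^ n * (gauge * M'))"
    using assms(1) gap_matrix_central[of n N] by (simp add: conjugate_def flip: mult.assoc)
  also have "\<dots> = N * N' * gauge"
    using assms(2) by (simp add: conjugate_def mult.assoc)
  finally show ?thesis by (simp add: conjugate_def)
qed

lemma conjugate_commutator:
  assumes "conjugate m M N" "conjugate n M' N'"
  shows "conjugate (m + n) (commutator M M') (commutator N N')"
  unfolding commutator_def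
  using conjugate_mult[OF assms] conjugate_mult[OF assms(2,1)]
  by (intro conjugate_arith) (simp_all add: add.commute)

lemma conjugate_raise:
  assumes "conjugate n M N"
  shows "conjugate (m + n) M (gap_matrix ^ m * N)"
  using assms by (simp add: conjugate_def power_add mult.assoc)

text \<open>Multiplying by \<open>gauge_inv\<close> from the left turns \<open>gauge\<close> into a
  power of \<open>gap_matrix\<close>, and \<open>gap\<close> is not a zero divisor.\<close>

lemma conjugate_zero:
  assumes "conjugate n M 0"
  shows "M = 0"
proof -
  have "gauge_inv * (gap_matrix ^ n * (gauge * M)) = 0"
    using assms by (simp add: conjugate_def)
  then have "gap_matrix ^ n * (gauge_inv * gauge * M) = 0"
    by (simp add: mult.assoc[symmetric] gap_matrix_central[of n gauge_inv])
  then show ?thesis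
    by (auto simp: gauge_inv dest!: gap_matrix_power_times_eq_0D)
qed

interpretation MS: assoc_algebra "mat_scale :: 'k::field \<Rightarrow> ('k super_poly, 'n::finite) sqmat \<Rightarrow> _"
  by (rule assoc_algebra_mat_scale)

lemma (in odd_directions) odd_matrices_scale:
  assumes "geven r" "M \<in> odd_matrices"
  shows "mat2 r 0 0 r * M \<in> odd_matrices"
proof -
  have "mat2 r 0 0 r = hmat r 0 0 r"
    by (simp add: hmat_def)
  also have "\<dots> \<in> odd_matrices"
    unfolding odd_matrices_def using assms(1) geven_zero by blast
  finally show ?thesis
    using assms(2) by (rule odd_matrices_closed)
qed

lemma geven_gap_power: "geven (gap ^ n)"
  by (induction n) (simp_all add: geven_one geven_gap parity_mult)

lemma subalgebra_conjugates:
  assumes "odd_directions (\<eta> :: 'k::field_char_0 super_poly) \<eta>'"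
  shows "subalgebra mat_scale {M. \<exists>n. \<exists>N\<in>odd_directions.odd_matrices \<eta> \<eta>'. conjugate n M N}"
    (is "subalgebra _ ?A")
proof -
  interpret odd_directions \<eta> \<eta>' by fact
  have "0 \<in> ?A"
  proof -
    have "0 \<in> odd_matrices"
      unfolding odd_matrices_def hmat_arith(3)[symmetric] using geven_zero by blast
    moreover have "conjugate 0 0 0" by (simp add: conjugate_def)
    ultimately show ?thesis by blast
  qed
  moreover have "1 \<in> ?A"
  proof -
    have "1 = hmat 1 0 0 1"
      by (simp add: hmat_def mat2_arith(4))
    then have "1 \<in> odd_matrices"
      unfolding odd_matrices_def using geven_zero geven_one by blast
    moreover have "conjugate 0 1 1" by (simp add: conjugate_def)
    ultimately show ?thesis by blast
  qed
  moreover have "M + M' \<in> ?A" if M: "M \<in> ?A" "M' \<in> ?A" for M M'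
  proof -
    obtain m N n N' where N: "N \<in> odd_matrices" "conjugate m M N" "N' \<in> odd_matrices" "conjugate n M' N'"
      using M by blast
    have "conjugate (m + n) M (gap_matrix ^ n * N)" "conjugate (m + n) M' (gap_matrix ^ m * N')"
      using conjugate_raise[OF N(2), of n] conjugate_raise[OF N(4), of m] by (simp_all add: add.commute)
    then have "conjugate (m + n) (M + M') (gap_matrix ^ n * N + gap_matrix ^ m * N')"
      by (rule conjugate_arith)
    moreover have "gap_matrix ^ n * N + gap_matrix ^ m * N' \<in> odd_matrices"
      unfolding gap_matrix_power using N by (intro odd_matrices_closed(1) odd_matrices_scale geven_gap_power)
    ultimately show ?thesis by blast
  qed
  moreover have "M * M' \<in> ?A" if M: "M \<in> ?A" "M' \<in> ?A" for M M'
    using M conjugate_mult odd_matrices_closed(2) by blast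
  moreover have "mat_scale c M \<in> ?A" if M: "M \<in> ?A" for c M
  proof -
    obtain n N where N: "N \<in> odd_matrices" "conjugate n M N"
      using M by blast
    have "conjugate n (mat_scale c M) (mat_scale c N)"
      using N(2) by (simp add: conjugate_def MS.scale_mult_left MS.scale_mult_right)
    moreover have "mat_scale c N = mat2 (gconst (Poly_Mapping.single 0 c)) 0 0 (gconst (Poly_Mapping.single 0 c)) * N"
      by (rule mat2_exhaust[of N]) (simp add: mat_scale_mat2 mat2_arith super_scale_eq_times)
    then have "mat_scale c N \<in> odd_matrices"
      using odd_matrices_scale[OF geven_gconst N(1)] by simp
    ultimately show ?thesis by blast
  qed
  ultimately show ?thesis
    unfolding subalgebra_def MS.subspace_def by blast
qed

lemma generic_algebra_conjugate:
  "\<exists>\<eta> \<eta>'. odd_directions \<eta> \<eta>' \<and> (\<forall>M\<in>(generic_algebra :: ('k::field_char_0 super_poly, 2) sqmat set).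
    \<exists>n. \<exists>N\<in>odd_directions.odd_matrices \<eta> \<eta>'. conjugate n M N)"
proof -
  have "mat2 (even_gen X2) (odd_gen Y2) (odd_gen Y2') (even_gen X2')
      \<in> (even_matrices :: ('k super_poly, 2) sqmat set)"
    unfolding even_matrices_def using geven_even_gen godd_odd_gen by blast
  moreover have "gauge \<in> (even_matrices :: ('k super_poly, 2) sqmat set)"
    unfolding even_matrices_def gauge_def using geven_gap godd_odd_gen godd_neg by blast
  moreover have "mat2 gap (- odd_gen Y1) (odd_gen Y1') gap \<in> (even_matrices :: ('k super_poly, 2) sqmat set)"
    unfolding even_matrices_def using geven_gap godd_odd_gen godd_neg by blast
  moreover have "mat2 (gap * gap - odd_gen Y1 * odd_gen Y1') 0 0 (gap * gap + odd_gen Y1 * odd_gen Y1')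
      \<in> (even_matrices :: ('k super_poly, 2) sqmat set)"
    unfolding even_matrices_def mem_Collect_eq
    by (intro exI conjI, rule refl)
      (intro geven_diff geven_add parity_mult(1)[OF geven_gap geven_gap] parity_mult(2) godd_odd_gen godd_zero)+
  \<comment> \<open>The off-diagonal entries of this product are the two odd elements
    \<open>\<eta>\<close> and \<open>\<eta>'\<close>. Relative to them \<open>C2\<close> has
    off-diagonal coefficients 1, and \<open>C1\<close>, being diagonal after conjugation, has
    coefficients 0. The exponent 4 for \<open>C2\<close> is the one in
    \<open>gauge_inv * gauge\<close>.\<close>
  ultimately have "gauge * C2 * gauge_inv \<in> (even_matrices :: ('k super_poly, 2) sqmat set)"
    unfolding gauge_inv_def C_eq_mat2 by (intro even_matrices_mult)
  then obtain a \<eta> \<eta>' d :: "'k super_poly" where N: "gauge * C2 * gauge_inv = mat2 a \<eta> \<eta>' d"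
    and e: "geven a" "godd \<eta>" "godd \<eta>'" "geven d"
    unfolding even_matrices_def by blast
  interpret odd_directions \<eta> \<eta>'
    using e by unfold_locales
  let ?A = "{M. \<exists>n. \<exists>N\<in>odd_matrices. conjugate n M N}"
  have "C2 \<in> ?A"
  proof -
    have "mat2 a \<eta> \<eta>' d = hmat a 1 1 d"
      by (simp add: hmat_def)
    then have "mat2 a \<eta> \<eta>' d \<in> odd_matrices"
      unfolding odd_matrices_def using e geven_one by blast
    moreover have "conjugate 4 C2 (mat2 a \<eta> \<eta>' d)"
      unfolding conjugate_def N[symmetric] mult.assoc gauge_inv
      by (simp only: gap_matrix_central mult.assoc)
    ultimately show ?thesis by blast
  qed
  moreover have "C1 \<in> ?A"
  proof -
    let ?N = "mat2 (gap * even_gen X1 + odd_gen Y1 * odd_gen Y1') 0 0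
      (gap * even_gen X1' + odd_gen Y1 * odd_gen Y1') :: ('k super_poly, 2) sqmat"
    have "?N = hmat (gap * even_gen X1 + odd_gen Y1 * odd_gen Y1') 0 0
      (gap * even_gen X1' + odd_gen Y1 * odd_gen Y1')"
      by (simp add: hmat_def)
    moreover have "geven (gap * even_gen x + odd_gen Y1 * odd_gen Y1')" for x
      by (intro geven_add parity_mult(1)[OF geven_gap geven_even_gen] parity_mult(2) godd_odd_gen)
    ultimately have "?N \<in> odd_matrices"
      unfolding odd_matrices_def using geven_zero by blast
    moreover have "conjugate 1 C1 ?N"
      unfolding conjugate_def by (simp add: gauge_C1)
    ultimately show ?thesis by blast
  qed
  moreover have "subalgebra mat_scale ?A"
    by (rule subalgebra_conjugates) (rule odd_directions_axioms)
  ultimately have "generic_algebra \<subseteq> ?A"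
    unfolding generic_algebra_def by (intro hull_minimal) auto
  then show ?thesis
    using odd_directions_axioms by blast
qed

text \<open>Conjugation is compatible with sums and products, so the value of each polynomial is
  conjugate to its value on \<open>odd_matrices\<close>, which is 0.\<close>

lemma generic_algebra_identities:
  fixes A B C D E G :: "('k::field_char_0 super_poly, 2) sqmat"
  assumes "A \<in> generic_algebra" "B \<in> generic_algebra" "C \<in> generic_algebra" "D \<in> generic_algebra"
  shows "E \<in> generic_algebra \<Longrightarrow> commutator (commutator A B * commutator C D) E = 0" (is "_ \<Longrightarrow> ?t1")
    and "E \<in> generic_algebra \<Longrightarrow> G \<in> generic_algebra \<Longrightarrow>
      commutator A B * commutator C D * commutator E G = 0" (is "_ \<Longrightarrow> _ \<Longrightarrow> ?t2")
    and "commutator A B * commutator C D + commutator C D * commutator A B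
      - commutator A C * commutator B D - commutator B D * commutator A C
      + commutator A D * commutator B C + commutator B C * commutator A D = 0" (is ?t3)
proof -
  obtain \<eta> \<eta>' :: "'k super_poly" where o: "odd_directions \<eta> \<eta>'"
    and conj: "\<And>M. M \<in> generic_algebra \<Longrightarrow> \<exists>n. \<exists>N\<in>odd_directions.odd_matrices \<eta> \<eta>'. conjugate n M N"
    using generic_algebra_conjugate by blast
  interpret odd_directions \<eta> \<eta>' by fact
  obtain a A' b B' c C' d D' where
    N: "A' \<in> odd_matrices" "B' \<in> odd_matrices" "C' \<in> odd_matrices" "D' \<in> odd_matrices"
    and cA: "conjugate a A A'" and cB: "conjugate b B B'" and cC: "conjugate c C C'" and cD: "conjugate d D D'"
    using conj[OF assms(1)] conj[OF assms(2)] conj[OF assms(3)] conj[OF assms(4)] by blast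
  note cAB = conjugate_commutator[OF cA cB] and cCD = conjugate_commutator[OF cC cD]
  {
    assume "E \<in> generic_algebra"
    then obtain e E' where E: "E' \<in> odd_matrices" "conjugate e E E'"
      using conj by blast
    have "commutator (commutator A' B' * commutator C' D') E' = 0"
      by (intro commutators_central commutator_in_commutators N E)
    with conjugate_commutator[OF conjugate_mult[OF cAB cCD] E(2)] show ?t1
      by (auto dest: conjugate_zero)
    assume "G \<in> generic_algebra"
    then obtain g G' where G: "G' \<in> odd_matrices" "conjugate g G G'"
      using conj by blast
    have "commutator A' B' * commutator C' D' * commutator E' G' = 0"
      by (intro commutators_triple commutator_in_commutators N E G)
    with conjugate_mult[OF conjugate_mult[OF cAB cCD] conjugate_commutator[OF E(2) G(2)]] show ?t2
      by (auto dest: conjugate_zero)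
  }
  have "conjugate (a + b + c + d) ((commutator A B * commutator C D + commutator C D * commutator A B
      - commutator A C * commutator B D - commutator B D * commutator A C)
      + commutator A D * commutator B C + commutator B C * commutator A D)
    ((commutator A' B' * commutator C' D' + commutator C' D' * commutator A' B'
      - commutator A' C' * commutator B' D' - commutator B' D' * commutator A' C')
      + commutator A' D' * commutator B' C' + commutator B' C' * commutator A' D')"
    using conjugate_mult[OF cAB cCD] conjugate_mult[OF cCD cAB]
      conjugate_mult[OF conjugate_commutator[OF cA cC] conjugate_commutator[OF cB cD]]
      conjugate_mult[OF conjugate_commutator[OF cB cD] conjugate_commutator[OF cA cC]]
      conjugate_mult[OF conjugate_commutator[OF cA cD] conjugate_commutator[OF cB cC]]
      conjugate_mult[OF conjugate_commutator[OF cB cC] conjugate_commutator[OF cA cD]]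
    by (intro conjugate_arith) (simp_all add: add_ac)
  then show ?t3
    unfolding standard_identity[OF N] by (rule conjugate_zero)
qed

section \<open>Specialising the generic algebra\<close>

text \<open>
  Putting \<open>X1 = 1\<close>, \<open>X2 = X1' = X2' = 0\<close> and \<open>Y1 = Y1' = 0\<close> turns \<open>C1\<close> into a matrix unit and
  leaves only the odd entries \<open>Y2\<close>, \<open>Y2'\<close> of \<open>C2\<close>; \<open>to_tri\<close> reads off the remaining coefficients.
\<close>

definition special_value :: "((even_var \<Rightarrow>\<^sub>0 nat) \<Rightarrow>\<^sub>0 'k::field) \<Rightarrow> 'k"
  where "special_value = lin_ext (*) (\<lambda>m. if Poly_Mapping.lookup m X2 = 0 \<and>
    Poly_Mapping.lookup m X1' = 0 \<and> Poly_Mapping.lookup m X2' = 0 then 1 else 0)"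

lemma algebra_hom_special_value: "algebra_hom pm_scale (*) (special_value :: _ \<Rightarrow> 'k::field)"
proof -
  have "assoc_algebra ((*) :: 'k \<Rightarrow> _)"
    by standard (simp_all add: algebra_simps)
  then show ?thesis
    unfolding special_value_def by (rule assoc_algebra.algebra_hom_lin_ext) (auto simp: lookup_add)
qed

lemmas special_value_simps = algebra_homD[OF algebra_hom_special_value]

lemma special_value_single:
  "special_value (Poly_Mapping.single (Poly_Mapping.single v (Suc 0)) 1) = (if v = X1 then 1 else (0 :: 'k::field))"
  by (cases v) (simp_all add: special_value_def vector_space_over_itself.lin_ext_single lookup_single when_def)

definition special_coeff :: "odd_var set \<Rightarrow> 'k::field super_poly \<Rightarrow> 'k"
  where "special_coeff S f = special_value (gcoeff f S)"

lemma special_coeff_linear: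
  "special_coeff S 0 = 0" "special_coeff S (f + g) = special_coeff S f + special_coeff S g"
  "special_coeff S (super_scale c f) = c * special_coeff S f"
  by (simp_all add: special_coeff_def zero_grassmann.rep_eq plus_grassmann.rep_eq special_value_simps)

lemma special_coeff_mult:
  "special_coeff {} (f * g) = special_coeff {} f * special_coeff {} g"
  "special_coeff {v} (f * g) = special_coeff {} f * special_coeff {v} g + special_coeff {v} f * special_coeff {} g"
  "special_coeff {Y2, Y2'} (f * g) = special_coeff {} f * special_coeff {Y2, Y2'} g
    + special_coeff {Y2} f * special_coeff {Y2'} g - special_coeff {Y2'} f * special_coeff {Y2} g
    + special_coeff {Y2, Y2'} f * special_coeff {} g"
proof -
  have "{(s, w). s = Y2 \<and> w = Y2' \<and> w < s} = {}" "{(s, w). s = Y2' \<and> w = Y2 \<and> w < s} = {(Y2', Y2)}"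
    by (auto simp: less_odd_var_def)
  then have "inversions {Y2} {Y2'} = 0" "inversions {Y2'} {Y2} = 1"
    unfolding inversions_def by (simp_all only: singleton_iff card.empty card_1_singleton_iff) auto
  then have sgn: "gsign {Y2} {Y2'} = (1 :: (even_var \<Rightarrow>\<^sub>0 nat) \<Rightarrow>\<^sub>0 'a)"
      "gsign {Y2'} {Y2} = (- 1 :: (even_var \<Rightarrow>\<^sub>0 nat) \<Rightarrow>\<^sub>0 'a)"
    by (simp_all add: gsign_def)
  have P: "Pow {v} = {{}, {v}}" "Pow {Y2, Y2'} = {{}, {Y2}, {Y2'}, {Y2, Y2'}}" for v :: odd_var
    by auto
  have D: "{Y2, Y2'} - {Y2} = {Y2'}" "{Y2, Y2'} - {Y2'} = {Y2}"
    by auto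
  have N: "{Y2'} \<noteq> {Y2, Y2'}" "{Y2} \<noteq> {Y2, Y2'}"
    by (auto simp: set_eq_iff)
  show "special_coeff {} (f * g) = special_coeff {} f * special_coeff {} g"
    "special_coeff {v} (f * g) = special_coeff {} f * special_coeff {v} g + special_coeff {v} f * special_coeff {} g"
    "special_coeff {Y2, Y2'} (f * g) = special_coeff {} f * special_coeff {Y2, Y2'} g
    + special_coeff {Y2} f * special_coeff {Y2'} g - special_coeff {Y2'} f * special_coeff {Y2} g
    + special_coeff {Y2, Y2'} f * special_coeff {} g"
    unfolding special_coeff_def times_grassmann.rep_eq P
    by (simp_all add: special_value_simps sgn D N)
qed

lemma special_coeff_generators:
  "special_coeff S (even_gen x) = (if S = {} \<and> x = X1 then 1 else 0)"
  "special_coeff S (odd_gen y) = (if S = {y} then 1 else 0)"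
  "special_coeff S 1 = (if S = {} then 1 else 0)"
  by (auto simp: special_coeff_def even_gen_def odd_gen_def gconst.rep_eq ggen.rep_eq
      one_grassmann.rep_eq special_value_simps special_value_single)

definition to_tri :: "('k::field super_poly, 2) sqmat \<Rightarrow> 'k tri"
  where "to_tri M = Tri (special_coeff {} (of_sqmat M $ 1 $ 1)) (special_coeff {Y2} (of_sqmat M $ 1 $ 2))
    (special_coeff {Y2, Y2'} (of_sqmat M $ 1 $ 1)) (special_coeff {} (of_sqmat M $ 2 $ 2))
    (special_coeff {Y2'} (of_sqmat M $ 2 $ 1))"

text \<open>Vanishing of these coefficients makes \<open>to_tri\<close> multiplicative. The
  conditions hold for both generators and survive products, hence hold throughout the generic
  algebra.\<close>

definition graded_matrices :: "('k::field super_poly, 2) sqmat set"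
  where "graded_matrices = {mat2 a b c d | a b c d.
    special_coeff {Y2} a = 0 \<and> special_coeff {Y2'} a = 0 \<and> special_coeff {Y2} d = 0 \<and> special_coeff {Y2'} d = 0 \<and>
    special_coeff {} b = 0 \<and> special_coeff {Y2'} b = 0 \<and> special_coeff {} c = 0 \<and> special_coeff {Y2} c = 0}"

lemma to_tri_mat2:
  "to_tri (mat2 a b c d) = Tri (special_coeff {} a) (special_coeff {Y2} b) (special_coeff {Y2, Y2'} a)
    (special_coeff {} d) (special_coeff {Y2'} c)"
  by (simp add: to_tri_def)

lemma to_tri_mult:
  "M \<in> graded_matrices \<Longrightarrow> N \<in> graded_matrices \<Longrightarrow> to_tri (M * N) = to_tri M * to_tri N"
  by (auto simp: graded_matrices_def mat2_arith to_tri_mat2 special_coeff_linear special_coeff_mult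
      times_tri_def)

lemma to_tri_linear:
  "to_tri (M + N) = to_tri M + to_tri N" "to_tri (mat_scale c M) = tri_scale c (to_tri M)" "to_tri 1 = 1"
  by (simp_all add: to_tri_def plus_sqmat.rep_eq one_sqmat.rep_eq mat_def special_coeff_linear
      special_coeff_generators tri_defs)

lemma subalgebra_graded_matrices: "subalgebra mat_scale (graded_matrices :: ('k::field_char_0 super_poly, 2) sqmat set)"
proof -
  have "mat2 0 0 0 0 \<in> (graded_matrices :: ('k super_poly, 2) sqmat set)"
    "mat2 1 0 0 1 \<in> (graded_matrices :: ('k super_poly, 2) sqmat set)"
    unfolding graded_matrices_def by (auto simp: mat2_inject special_coeff_linear special_coeff_generators)
  moreover have "M + N \<in> graded_matrices" "M * N \<in> graded_matrices"
    if "M \<in> graded_matrices" "N \<in> graded_matrices" for M N :: "('k super_poly, 2) sqmat"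
    using that unfolding graded_matrices_def
    by (auto simp: mat2_arith mat2_inject special_coeff_linear special_coeff_mult)
  moreover have "mat_scale c M \<in> graded_matrices" if "M \<in> graded_matrices" for c and M :: "('k super_poly, 2) sqmat"
    using that unfolding graded_matrices_def
    by (auto simp: mat_scale_mat2 mat2_inject special_coeff_linear)
  ultimately show ?thesis
    unfolding subalgebra_def MS.subspace_def mat2_arith by blast
qed

lemma generic_algebra_graded: "generic_algebra \<subseteq> (graded_matrices :: ('k::field_char_0 super_poly, 2) sqmat set)"
proof -
  have "C1 \<in> (graded_matrices :: ('k super_poly, 2) sqmat set)" "C2 \<in> (graded_matrices :: ('k super_poly, 2) sqmat set)"
    unfolding graded_matrices_def C_eq_mat2 by (auto simp: mat2_inject special_coeff_generators)
  then show ?thesis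
    unfolding generic_algebra_def using subalgebra_graded_matrices by (intro hull_minimal) auto
qed

lemma to_tri_surj:
  "\<exists>M\<in>(generic_algebra :: ('k::field_char_0 super_poly, 2) sqmat set). to_tri M = Tri a b 0 d c"
proof -
  have C: "C1 \<in> (generic_algebra :: ('k super_poly, 2) sqmat set)" "C2 \<in> (generic_algebra :: ('k super_poly, 2) sqmat set)"
    using hull_subset[of "{C1, C2}" "subalgebra mat_scale"] unfolding generic_algebra_def by auto
  have sub: "MS.subspace (generic_algebra :: ('k super_poly, 2) sqmat set)"
    and one: "1 \<in> (generic_algebra :: ('k super_poly, 2) sqmat set)"
    and mult: "\<And>x y. x \<in> generic_algebra \<Longrightarrow> y \<in> generic_algebra \<Longrightarrow> x * y \<in> (generic_algebra :: ('k super_poly, 2) sqmat set)"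
    using subalgebra_generic_algebra[where ?'a = 'k] by (auto simp: subalgebra_def)
  \<comment> \<open>\<open>C1\<close> specialises to an idempotent, so \<open>C1 * C2\<close> and
    \<open>C2 * C1\<close> isolate the entries b and c of the image of \<open>C2\<close>, while
    \<open>1\<close> and \<open>C1\<close> generate the diagonal. None of the four images has a
    corner entry, whence the 0 in the statement and in \<open>tri_eval\<close>.\<close>
  let ?M = "mat_scale d 1 + mat_scale (a - d) C1 + mat_scale b (C1 * C2) + mat_scale c (C2 * C1)"
  have "?M \<in> (generic_algebra :: ('k super_poly, 2) sqmat set)"
    by (intro MS.subspace_add[OF sub] MS.subspace_scale[OF sub] one mult C)
  moreover have "to_tri C1 = Tri 1 0 0 0 (0 :: 'k)" "to_tri C2 = Tri 0 1 0 0 (1 :: 'k)"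
    unfolding C_eq_mat2 to_tri_mat2 by (simp_all add: special_coeff_generators)
  then have "to_tri ?M = Tri a b 0 d c"
    using to_tri_mult[OF subsetD[OF generic_algebra_graded C(1)] subsetD[OF generic_algebra_graded C(2)]]
      to_tri_mult[OF subsetD[OF generic_algebra_graded C(2)] subsetD[OF generic_algebra_graded C(1)]]
    by (simp add: to_tri_linear tri_defs)
  ultimately show ?thesis by blast
qed

lemma tri_eval_identity:
  assumes "f \<in> polynomial_identities mat_scale (generic_algebra :: ('k::field_char_0 super_poly, 2) sqmat set)"
  shows "tri_eval x u d e f = 0"
proof -
  have "\<exists>M\<in>(generic_algebra :: ('k super_poly, 2) sqmat set). to_tri M = Tri (x i) (d i) 0 (x i - u i) (e i)" for i
    by (rule to_tri_surj)
  then obtain N :: "nat \<Rightarrow> ('k super_poly, 2) sqmat" where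
    N: "\<And>i. N i \<in> generic_algebra" "\<And>i. to_tri (N i) = Tri (x i) (d i) 0 (x i - u i) (e i)"
    by metis
  have "to_tri (evaluate mat_scale N f) = evaluate tri_scale (\<lambda>i. to_tri (N i)) f"
    by (rule evaluate_hom[OF assoc_algebra_mat_scale assoc_algebra_tri_scale _ _ _ _ subalgebra_graded_matrices])
      (use N generic_algebra_graded in \<open>auto simp: to_tri_linear to_tri_mult\<close>)
  moreover have "evaluate mat_scale N f = 0"
    using assms N(1) by (simp add: polynomial_identities_def)
  moreover have "to_tri 0 = (0 :: 'k tri)"
    by (simp add: to_tri_def zero_sqmat.rep_eq special_coeff_linear tri_defs)
  ultimately show ?thesis
    by (simp add: tri_eval_def N(2))
qed

theorem theorem8:
  shows "polynomial_identities mat_scale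
      (generic_algebra :: ('k::field_char_0 super_poly, 2) sqmat set) =
    T_ideal_generated
     {commutator (commutator (t 1) (t 2) * commutator (t 3) (t 4)) (t 5),
      commutator (t 1) (t 2) * commutator (t 3) (t 4) * commutator (t 5) (t 6),
      \<Sum>\<sigma> | \<sigma> permutes {1..4}. of_int (sign \<sigma>) * (t (\<sigma> 1) * t (\<sigma> 2) * t (\<sigma> 3) * t (\<sigma> 4))}"
    (is "?P = T_ideal_generated ?G")
proof
  have T: "T_ideal ?P"
    by (rule T_ideal_polynomial_identities[OF assoc_algebra_mat_scale subalgebra_generic_algebra])
  have "?G \<subseteq> ?P"
    unfolding polynomial_identities_def standard_polynomial_expand
    by (auto simp: algebra_homD[OF MS.algebra_hom_evaluate] generic_algebra_identities)
  then show GP: "T_ideal_generated ?G \<subseteq> ?P"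
    using T by (rule T_ideal_generated_minimal)
  let ?I = "T_ideal_generated ?G :: 'k free_algebra set"
  note sub = T_ideal_substitution[OF T_ideal_T_ideal_generated[of ?G]
      subsetD[OF generators_subset_T_ideal_generated[of ?G]]]
  note ev = algebra_homD[OF PM.algebra_hom_evaluate]
  interpret central_commutator_ideal ?I
  proof
    show "two_sided_ideal pm_scale ?I"
      using T_ideal_T_ideal_generated[of ?G] by (simp add: T_ideal_def)
    fix a b c d e f :: "'k free_algebra"
    define s where "s = (\<lambda>i :: nat. if i = 1 then a else if i = 2 then b else if i = 3 then c
      else if i = 4 then d else if i = 5 then e else f)"
    have s: "s 1 = a" "s 2 = b" "s 3 = c" "s 4 = d" "s 5 = e" "s 6 = f"
      by (simp_all add: s_def)
    show "commutator (commutator a b * commutator c d) e \<in> ?I"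
      using sub[of "commutator (commutator (t 1) (t 2) * commutator (t 3) (t 4)) (t 5)" s]
      by (simp only: ev PM.evaluate_t s) simp
    show "commutator a b * commutator c d * commutator e f \<in> ?I"
      using sub[of "commutator (t 1) (t 2) * commutator (t 3) (t 4) * commutator (t 5) (t 6)" s]
      by (simp only: ev PM.evaluate_t s) simp
    show "commutator a b * commutator c d + commutator c d * commutator a b
      - commutator a c * commutator b d - commutator b d * commutator a c
      + commutator a d * commutator b c + commutator b c * commutator a d \<in> ?I"
      using sub[of "\<Sum>\<sigma> | \<sigma> permutes {1..4}. of_int (sign \<sigma>) * (t (\<sigma> 1) * t (\<sigma> 2) * t (\<sigma> 3) * t (\<sigma> 4))" s]
      by (simp only: ev PM.evaluate_t standard_polynomial_expand s) simp
  qed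
  \<comment> \<open>The inclusion already shown is needed here: elements of \<open>?I\<close> vanish
    on the test algebra, so the corner coordinates may be computed from a representative of
    \<open>f\<close> modulo \<open>?I\<close>.\<close>
  show "?P \<subseteq> ?I"
    using tri_identity_in_ideal tri_eval_identity GP by blast
qed

end
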